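(* Let $d\ge 1$, $1<p<\infty$ and $p^*=\max\left(p,\frac{p}{p-1}\right)$. Let $\mathbf{R}'f=(R_1'f,\dots,R_d'f)$, where $R_i'=\delta_i^*L'^{-1/2}$. Then for every $f\in L^p(\mathbb{R}^d)$, $$\|\mathbf{R}'f\|_p:=\left(\int_{\mathbb{R}^d}|\mathbf{R}'f(x)|^p\,dx\right)^{1/p}\le 36\,(p^*-1)\,\|f\|_p .$$
   Context: All functions are real-valued; $|\cdot|$ is the Euclidean norm; $\|\cdot\|_p$ is the $L^p(\mathbb{R}^d)$ norm with respect to Lebesgue measure; $\langle\cdot,\cdot\rangle$ is the $L^2(\mathbb{R}^d)$ inner product; $\mathbb{N}=\{0,1,2,\dots\}$. Hermite functions: for $k\in\mathbb{N}$ and $x\in\mathbb{R}$, $h_k(x)=(2^k k!\sqrt{\pi})^{-1/2}e^{-x^2/2}H_k(x)$ with $H_k(x)=(-1)^ke^{x^2}\frac{d^k}{dx^k}e^{-x^2}$; for $n=(n_1,\dots,n_d)\in\mathbb{N}^d$ and $x\in\mathbb{R}^d$, $h_n(x)=h_{n_1}(x_1)\cdots h_{n_d}(x_d)$. They form an orthonormal basis of $L^2(\mathbb{R}^d)$. Let $\mathcal{D}$ be the linear span of $\{h_n:n\in\mathbb{N}^d\}$; it is dense in $L^p(\mathbb{R}^d)$ for $1\le p<\infty$. Let $\delta_i=\partial_{x_i}+x_i$, $\delta_i^*=-\partial_{x_i}+x_i$, and $L'=\sum_{i=1}^d(\delta_i\delta_i^*+1)=-\Delta+|x|^2+2d$.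 Then $L'h_n=\lambda_n'h_n$ with $\lambda_n'=2|n|+3d$, where $|n|=n_1+\dots+n_d$. The operator $R_i'=\delta_i^*L'^{-1/2}$ is defined by $$R_i'f=\sum_{n\in\mathbb{N}^d}(\lambda_n')^{-1/2}\langle f,h_n\rangle\,\delta_i^*h_n,$$ a finite sum for $f\in\mathcal{D}$. A densely defined bounded operator is identified with its unique bounded extension; thus the statement for $f\in L^p$ means that the inequality holds for $f\in\mathcal{D}$ and that $\mathbf{R}'$ on $L^p$ is the bounded extension from $\mathcal{D}$. *)

theory Defs
  imports "HOL-Analysis.Analysis"
begin

subsection \<open>Lebesgue spaces\<close>

text \<open>
  Elements of \<open>L\<^sup>p\<close> are represented by Lebesgue measurable functions, not by equivalence classes.
  The type \<open>'b\<close> is \<open>real\<close> for scalar functions and \<open>real ^ 'd\<close>, with its Euclidean norm, for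
  vector-valued ones.
\<close>

definition Lp_space :: "real \<Rightarrow> ('a::euclidean_space \<Rightarrow> 'b::euclidean_space) set" where
  "Lp_space p =
     {f. f \<in> borel_measurable lebesgue \<and> integrable lebesgue (\<lambda>x. norm (f x) powr p)}"

text \<open>
  Since the integral of a non-integrable function is \<open>0\<close>, this is meaningful only on
  \<^const>\<open>Lp_space\<close>.
\<close>

definition Lp_norm :: "real \<Rightarrow> ('a::euclidean_space \<Rightarrow> 'b::euclidean_space) \<Rightarrow> real" where
  "Lp_norm p f = (LINT x|lebesgue. norm (f x) powr p) powr (1 / p)"

definition L2_inner :: "('a::euclidean_space \<Rightarrow> real) \<Rightarrow> ('a \<Rightarrow> real) \<Rightarrow> real" where
  "L2_inner f g = (LINT x|lebesgue. f x * g x)"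

text \<open>
  \<open>T\<close> is a bounded linear operator on \<open>L\<^sup>p\<close> that agrees with \<open>S\<close> on \<open>D\<close>; equalities between
  elements of \<open>L\<^sup>p\<close> are equalities almost everywhere. Linearity and boundedness make \<open>T\<close>
  respect almost-everywhere equality of its arguments.
\<close>

definition bounded_Lp_extension ::
  "real \<Rightarrow> ('a::euclidean_space \<Rightarrow> real) set \<Rightarrow> (('a \<Rightarrow> real) \<Rightarrow> 'a \<Rightarrow> 'b::euclidean_space)
    \<Rightarrow> (('a \<Rightarrow> real) \<Rightarrow> 'a \<Rightarrow> 'b) \<Rightarrow> bool" where
  "bounded_Lp_extension p D S T \<longleftrightarrow>
     (\<forall>f\<in>Lp_space p. T f \<in> Lp_space p) \<and>
     (\<forall>f\<in>Lp_space p. \<forall>g\<in>Lp_space p.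
        AE x in lebesgue. T (\<lambda>y. f y + g y) x = T f x + T g x) \<and>
     (\<forall>c. \<forall>f\<in>Lp_space p. AE x in lebesgue. T (\<lambda>y. c * f y) x = c *\<^sub>R T f x) \<and>
     (\<exists>C. \<forall>f\<in>Lp_space p. Lp_norm p (T f) \<le> C * Lp_norm p f) \<and>
     (\<forall>f\<in>D. AE x in lebesgue. T f x = S f x)"

subsection \<open>Hermite functions\<close>

definition hermite_poly :: "nat \<Rightarrow> real \<Rightarrow> real" where
  "hermite_poly k x = (- 1) ^ k * exp (x\<^sup>2) * (deriv ^^ k) (\<lambda>t. exp (- t\<^sup>2)) x"

definition hermite_fun1 :: "nat \<Rightarrow> real \<Rightarrow> real" where
  "hermite_fun1 k x =
     (2 ^ k * fact k * sqrt pi) powr (- 1 / 2) * exp (- x\<^sup>2 / 2) * hermite_poly k x"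

definition hermite_fun :: "nat ^ 'd \<Rightarrow> real ^ 'd \<Rightarrow> real" where
  "hermite_fun n x = (\<Prod>i\<in>UNIV. hermite_fun1 (n $ i) (x $ i))"

definition hermite_span :: "(real ^ 'd \<Rightarrow> real) set" where
  "hermite_span =
     {f. \<exists>N c. finite N \<and> f = (\<lambda>x. \<Sum>n\<in>N. c n * hermite_fun n x)}"

subsection \<open>The Riesz transform\<close>

definition partial_deriv :: "'d \<Rightarrow> (real ^ 'd \<Rightarrow> real) \<Rightarrow> real ^ 'd \<Rightarrow> real" where
  "partial_deriv i f x = deriv (\<lambda>t. f (x + t *\<^sub>R axis i 1)) 0"

definition delta_adj :: "'d \<Rightarrow> (real ^ 'd \<Rightarrow> real) \<Rightarrow> real ^ 'd \<Rightarrow> real" where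
  "delta_adj i f x = - partial_deriv i f x + x $ i * f x"

text \<open>
  The eigenvalue \<open>2 |n| + 3 d\<close> of \<open>L' = - \<Delta> + |x|\<^sup>2 + 2 d\<close> on \<open>hermite_fun n\<close>.
\<close>

definition eigval :: "nat ^ 'd \<Rightarrow> real" where
  "eigval n = 2 * real (\<Sum>i\<in>UNIV. n $ i) + 3 * real CARD('d)"

text \<open>
  The operator \<open>\<delta>\<^sub>i\<^sup>* L'\<^bsup>-1/2\<^esup>\<close> on \<^const>\<open>hermite_span\<close>, where all but finitely many
  terms of the series vanish.
\<close>

definition riesz_comp :: "'d \<Rightarrow> (real ^ 'd \<Rightarrow> real) \<Rightarrow> real ^ 'd \<Rightarrow> real" where
  "riesz_comp i f x =
     (\<Sum>\<^sub>\<infinity>n. eigval n powr (- 1 / 2) * L2_inner f (hermite_fun n) * delta_adj i (hermite_fun n) x)"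

definition riesz :: "(real ^ 'd \<Rightarrow> real) \<Rightarrow> real ^ 'd \<Rightarrow> real ^ 'd" where
  "riesz f x = (\<chi> i. riesz_comp i f x)"

definition p_star :: "real \<Rightarrow> real" where
  "p_star p = max p (p / (p - 1))"

end

theory Submission
  imports Defs "HOL-Probability.Distributions"
begin

text \<open>
  The estimate is dual to a bilinear one, which is proved with a Bellman function. Let \<open>u\<close> be the
  Poisson extension of \<open>f\<close> for \<open>L'\<close>, and \<open>v\<close> that of a vector-valued \<open>g\<close> for \<open>L' - 2\<close>. Since
  \<open>\<delta>\<^sub>i\<^sup>* L' = (L' - 2) \<delta>\<^sub>i\<^sup>*\<close>, the function
  \<open>I t = - \<Sum>\<^sub>i \<integral> \<delta>\<^sub>i\<^sup>* u \<partial>\<^sub>t v\<^sub>i dx\<close> is \<open>J''\<close> with \<open>J 0 = \<langle>R' f, g\<rangle> / 4\<close> and \<open>J \<longlonglongrightarrow> 0\<close> at infinity.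
  A function \<open>b\<close> of \<open>(u, v)\<close> with a suitably large Hessian satisfies, by the equations for \<open>u\<close> and \<open>v\<close>,
  \<open>(\<partial>\<^sub>t\<^sup>2 + \<Delta>) b \<ge> 2 |\<delta>\<^sup>* u| |\<partial>\<^sub>t v|\<close>. So \<open>F t = \<integral> b dx\<close> has \<open>F'' \<ge> 2 I\<close>, the bounded function
  \<open>F - 2 J\<close> is convex, hence decreasing, and \<open>\<langle>R' f, g\<rangle> \<le> 2 F 0\<close>. For \<open>P = p\<^sup>*\<close> with conjugate exponent \<open>Q\<close>
  this is at most \<open>2 \<integral> |f|\<^sup>P + 2 (8 P + 1) \<integral> |g|\<^sup>Q\<close>, or the same with \<open>f\<close> and \<open>g\<close> exchanged, and scaling
  gives the constant \<open>16 P + 4 \<le> 36 (P - 1)\<close>. Density of the Hermite functions in \<open>L\<^sup>p\<close> and in \<open>L\<^sup>q\<close> does the rest.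
\<close>

subsection \<open>Integration\<close>

text \<open>The constant is free of the dimension because the Hessian bound is kept as a sum of
  squares \<open>z * |u'|^2 + (4 / z) * |v'|^2\<close> whose weight \<open>z\<close> depends on the
  value of \<open>v\<close> but not on the direction. It is summed over time and all coordinates;
  one arithmetic-geometric mean inequality afterwards yields the product of the full gradient norms.
  Since \<open>\<delta>\<^sub>i\<^sup>* u\<close> contains \<open>x\<^sub>i u\<close> besides a
  derivative, the gradient must include \<open>|x| |u|\<close>. That part comes from the zero-order
  terms of the two equations, which is why the first derivatives of the Bellman function are bounded
  below as well. For finite Hermite expansions the flows and their derivatives are dominated by a
  Gaussian, which justifies every differentiation under the integral; the passage to all functions
  is shifted to density and extension. The two powers stay a sum until scaling balances them at the
  end. The inequality \<open>16 * P + 4 \<le> 36 * (P - 1)\<close> is an equality at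
  \<open>P = 2\<close>, so the larger of the two conjugate exponents has to carry the
  estimate.\<close>

lemma integral_prod_coordinates:
  fixes f :: "'d::finite \<Rightarrow> real \<Rightarrow> real"
  assumes "\<And>i. integrable lborel (f i)"
  shows "integrable lborel (\<lambda>x::real^'d. \<Prod>i\<in>UNIV. f i (x $ i))"
    and "(LINT x::real^'d|lborel. (\<Prod>i\<in>UNIV. f i (x $ i))) = (\<Prod>i\<in>UNIV. LINT x|lborel. f i x)"
proof -
  interpret product_sigma_finite "\<lambda>_::real^'d. lborel :: real measure" by standard
  \<comment> \<open>\<open>lborel_eq\<close> presents Lebesgue measure as the image of a product
    indexed by \<open>Basis\<close>; \<open>F\<close> carries the factors from coordinates to basis
    vectors, with \<open>SOME\<close> inverting the injective map
    \<open>\<lambda>i. axis i 1\<close>.\<close>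
  define F where "F b = f (SOME i. b = axis i (1::real))" for b :: "real^'d"
  have F_axis: "F (axis i 1) = f i" for i
    unfolding F_def by (rule arg_cong[where f=f]) (auto simp: axis_eq_axis)
  have Basis: "(Basis :: (real^'d) set) = (\<lambda>i. axis i 1) ` UNIV"
    by (auto simp: Basis_vec_def)
  have inj: "inj (\<lambda>i::'d. axis i (1::real))"
    by (auto simp: inj_on_def axis_eq_axis)
  have *: "(\<Prod>i\<in>UNIV. f i ((\<Sum>b\<in>Basis. y b *\<^sub>R b) $ i)) = (\<Prod>b\<in>Basis. F b (y b))" for y :: "real^'d \<Rightarrow> real"
  proof -
    have "(\<Sum>b\<in>Basis. y b *\<^sub>R b) $ i = y (axis i 1)" for i
    proof -
      have "(\<Sum>b\<in>Basis. y b *\<^sub>R b) $ i = (\<Sum>b\<in>Basis. y b *\<^sub>R b) \<bullet> axis i 1"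
        by (simp add: inner_axis)
      also have "\<dots> = y (axis i 1)"
        by (rule inner_sum_left_Basis) (auto simp: Basis)
      finally show ?thesis .
    qed
    then show ?thesis
      unfolding Basis by (subst prod.reindex[OF inj]) (simp add: F_axis)
  qed
  have F_int: "integrable lborel (F b)" for b unfolding F_def using assms by blast
  have [measurable]: "f i \<in> borel_measurable borel" for i using assms[of i] by auto
  have [measurable]: "(\<lambda>y. \<Sum>b\<in>(Basis::(real^'d) set). y b *\<^sub>R b) \<in> measurable (\<Pi>\<^sub>M b\<in>Basis. lborel) borel"
    by simp
  have [measurable]: "(\<lambda>x::real^'d. \<Prod>i\<in>UNIV. f i (x $ i)) \<in> borel_measurable borel"
  proof (intro borel_measurable_prod)
    fix i :: 'd
    have "(\<lambda>x::real^'d. x $ i) \<in> borel_measurable borel" by simp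
    then show "(\<lambda>x::real^'d. f i (x $ i)) \<in> borel_measurable borel"
      by (rule measurable_compose) measurable
  qed
  show "integrable lborel (\<lambda>x::real^'d. \<Prod>i\<in>UNIV. f i (x $ i))"
    by (subst lborel_eq, subst integrable_distr_eq, measurable, measurable)
       (unfold *, rule product_integrable_prod[OF _ F_int], simp)
  have "(LINT x::real^'d|lborel. (\<Prod>i\<in>UNIV. f i (x $ i))) = (\<Prod>b\<in>Basis. LINT x|lborel. F b x)"
    by (subst lborel_eq, subst integral_distr, measurable, measurable)
       (unfold *, rule product_integral_prod[OF _ F_int], simp)
  also have "\<dots> = (\<Prod>i\<in>UNIV. LINT x|lborel. f i x)"
    unfolding Basis by (subst prod.reindex[OF inj]) (simp add: F_axis)
  finally show "(LINT x::real^'d|lborel. (\<Prod>i\<in>UNIV. f i (x $ i))) = (\<Prod>i\<in>UNIV. LINT x|lborel. f i x)" .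
qed

section \<open>Differentiation under the integral sign and translation invariance\<close>

lemma has_real_derivative_integral:
  fixes f f' :: "real \<Rightarrow> 'a \<Rightarrow> real"
  assumes S: "open S" "convex S" "s \<in> S"
    and f: "\<And>t. t \<in> S \<Longrightarrow> integrable M (f t)"
    and f': "\<And>t x. t \<in> S \<Longrightarrow> ((\<lambda>t. f t x) has_real_derivative f' t x) (at t)"
    and w: "integrable M w" "\<And>t x. t \<in> S \<Longrightarrow> \<bar>f' t x\<bar> \<le> w x"
  shows "integrable M (f' s)"
    and "((\<lambda>t. LINT x|M. f t x) has_real_derivative (LINT x|M. f' s x)) (at s)"
proof -
  \<comment> \<open>The mean value theorem bounds every difference quotient at \<open>s\<close> by
    \<open>w\<close>, so dominated convergence applies along any sequence in
    \<open>S\<close>.\<close>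
  have lip: "\<bar>f t x - f s x\<bar> \<le> w x * \<bar>t - s\<bar>" if "t \<in> S" for t x
    using field_differentiable_bound[OF S(2), of "\<lambda>t. f t x" "\<lambda>t. f' t x" "w x" t s]
      f'[THEN has_field_derivative_at_within] w(2) that S(3) by simp
  have meas: "f' s \<in> borel_measurable M" and
    lim: "(\<lambda>n. LINT x|M. (f (X n) x - f s x) / (X n - s)) \<longlonglongrightarrow> (LINT x|M. f' s x)"
    if X: "\<And>n. X n \<in> S" "\<And>n. X n \<noteq> s" "X \<longlonglongrightarrow> s" for X
  proof -
    have pt: "(\<lambda>n. (f (X n) x - f s x) / (X n - s)) \<longlonglongrightarrow> f' s x" for x
      using f'[OF S(3), of x] X(2,3)
      unfolding has_field_derivative_iff tendsto_at_iff_sequentially comp_def by blast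
    have m: "(\<lambda>x. (f (X n) x - f s x) / (X n - s)) \<in> borel_measurable M" for n
      using f[OF X(1)[of n]] f[OF S(3)] by auto
    show "f' s \<in> borel_measurable M"
      by (rule borel_measurable_LIMSEQ_real[OF pt m])
    show "(\<lambda>n. LINT x|M. (f (X n) x - f s x) / (X n - s)) \<longlonglongrightarrow> (LINT x|M. f' s x)"
    proof (rule integral_dominated_convergence[where w = w])
      show "AE x in M. norm ((f (X n) x - f s x) / (X n - s)) \<le> w x" for n
        using lip[OF X(1)[of n]] X(2)[of n] by (intro AE_I2) (simp add: divide_le_eq)
    qed (use m pt w(1) \<open>f' s \<in> borel_measurable M\<close> in auto)
  qed
  obtain e where e: "e > 0" "ball s e \<subseteq> S" using S(1,3) openE by blast
  \<comment> \<open>A concrete sequence tending to \<open>s\<close>: measurability of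
    \<open>f' s\<close> follows because it is the pointwise limit of difference quotients along
    it.\<close>
  define X where "X n = s + (e / 2) / real (Suc n)" for n
  have X1: "X n \<in> S" for n
  proof -
    have "e / (2 * real (Suc n)) < e"
      using e(1) by (simp add: divide_less_eq)
    then have "X n \<in> ball s e" using e(1) by (simp add: X_def dist_real_def)
    then show ?thesis using e(2) by blast
  qed
  have X3: "X \<longlonglongrightarrow> s"
    unfolding X_def using tendsto_add[OF tendsto_const LIMSEQ_Suc[OF lim_const_over_n[of "e / 2"]], of s] by simp
  have m: "f' s \<in> borel_measurable M"
    by (rule meas[of X]) (use X1 X3 e(1) in \<open>auto simp: X_def\<close>)
  show int: "integrable M (f' s)"
    by (rule Bochner_Integration.integrable_bound[OF w(1) m]) (use w(2)[OF S(3)] in \<open>auto intro!: AE_I2 order_trans[OF _ abs_ge_self]\<close>)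
  show "((\<lambda>t. LINT x|M. f t x) has_real_derivative (LINT x|M. f' s x)) (at s)"
    unfolding has_field_derivative_iff tendsto_at_iff_sequentially comp_def
  proof (intro allI impI)
    fix Y assume Y: "\<forall>i. Y i \<in> UNIV - {s}" "Y \<longlonglongrightarrow> s"
    from Y(2) S(1,3) have "\<forall>\<^sub>F n in sequentially. Y n \<in> S" by (rule topological_tendstoD)
    then obtain N where N: "\<And>n. n \<ge> N \<Longrightarrow> Y n \<in> S" unfolding eventually_sequentially by blast
    have "(\<lambda>n. LINT x|M. (f (Y (n + N)) x - f s x) / (Y (n + N) - s)) \<longlonglongrightarrow> (LINT x|M. f' s x)"
      by (rule lim) (use Y N LIMSEQ_ignore_initial_segment in auto)
    also have "(\<lambda>n. LINT x|M. (f (Y (n + N)) x - f s x) / (Y (n + N) - s))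
      = (\<lambda>n. ((LINT x|M. f (Y (n + N)) x) - (LINT x|M. f s x)) / (Y (n + N) - s))"
      using f N S(3) by (auto simp: fun_eq_iff Bochner_Integration.integral_diff)
    finally show "(\<lambda>n. ((LINT x|M. f (Y n) x) - (LINT x|M. f s x)) / (Y n - s)) \<longlonglongrightarrow> (LINT x|M. f' s x)"
      by (rule LIMSEQ_offset)
  qed
qed

lemma integral_translate:
  fixes b :: "'a::euclidean_space \<Rightarrow> real"
  shows "(LINT x|lborel. b (x + c)) = (LINT x|lborel. b x)"
    and "integrable lborel b \<Longrightarrow> integrable lborel (\<lambda>x. b (x + c))"
proof -
  have d: "(lborel :: 'a measure) = distr lborel borel ((+) c)" by (simp add: lborel_distr_plus)
  have c: "(\<lambda>x. b (x + c)) = (\<lambda>x. b (c + x))" by (simp add: add.commute)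
  have E: "integrable lborel b \<longleftrightarrow> integrable lborel (\<lambda>x. b (x + c))" if "b \<in> borel_measurable borel"
    unfolding c by (subst d, subst integrable_distr_eq) (use that in auto)
  then show "integrable lborel b \<Longrightarrow> integrable lborel (\<lambda>x. b (x + c))" by auto
  show "(LINT x|lborel. b (x + c)) = (LINT x|lborel. b x)"
  proof (cases "b \<in> borel_measurable borel")
    case True
    then show ?thesis unfolding c by (subst (2) d, subst integral_distr) auto
  next
    \<comment> \<open>A function and its translate are measurable together, so here both integrals
      have the default value 0.\<close>
    case False
    have "(\<lambda>x. b (x + c)) \<notin> borel_measurable borel"
    proof
      assume [measurable]: "(\<lambda>x. b (x + c)) \<in> borel_measurable borel"
      have "(\<lambda>x. (\<lambda>x. b (x + c)) (x - c)) \<in> borel_measurable borel" by measurable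
      with False show False by simp
    qed
    then have "\<not> integrable lborel (\<lambda>x. b (x + c))" "\<not> integrable lborel b"
      using False by auto
    then show ?thesis by (simp add: not_integrable_integral_eq)
  qed
qed

text \<open>By translation invariance the integral of \<open>b (x + s *\<^sub>R e)\<close> is
  constant in \<open>s\<close>, and its derivative at 0 is the integral of \<open>b'\<close>. The
  majorant \<open>w\<close> has to control \<open>b'\<close> on a whole segment around
  \<open>x\<close>, hence the translated Gaussian bounds later on.\<close>

lemma integral_directional_derivative_eq_0:
  fixes b b' w :: "'a::euclidean_space \<Rightarrow> real"
  assumes b: "integrable lborel b"
    and b': "\<And>x s. ((\<lambda>s. b (x + s *\<^sub>R e)) has_real_derivative b' (x + s *\<^sub>R e)) (at s)"
    and w: "integrable lborel w" "\<And>x s. \<bar>s\<bar> < 1 \<Longrightarrow> \<bar>b' (x + s *\<^sub>R e)\<bar> \<le> w x"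
  shows "integrable lborel b'" "(LINT x|lborel. b' x) = 0"
proof -
  have S: "\<And>t::real. t \<in> ball 0 1 \<longleftrightarrow> \<bar>t\<bar> < 1" by simp
  note * = has_real_derivative_integral[where S="ball 0 1" and s=0 and M=lborel and
    f="\<lambda>s x. b (x + s *\<^sub>R e)" and f'="\<lambda>s x. b' (x + s *\<^sub>R e)",
    OF open_ball convex_ball _ integral_translate(2)[OF b] b' w[folded S], simplified]
  show "integrable lborel b'" using * by simp
  have "((\<lambda>t. LINT x|lborel. b (x + t *\<^sub>R e)) has_real_derivative (LINT x|lborel. b' x)) (at 0)"
    using * by simp
  moreover have "((\<lambda>t. LINT x|lborel. b (x + t *\<^sub>R e)) has_real_derivative 0) (at 0)"
    by (simp add: integral_translate(1))
  ultimately show "(LINT x|lborel. b' x) = 0" by (rule DERIV_unique)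
qed

subsection \<open>Hermite functions\<close>

primrec hermite_rpoly :: "nat \<Rightarrow> real poly" where
  "hermite_rpoly 0 = 1"
| "hermite_rpoly (Suc k) = [:0, 2:] * hermite_rpoly k - pderiv (hermite_rpoly k)"

text \<open>Differentiating \<open>p(t) * exp (- t\<^sup>2)\<close> replaces \<open>p\<close> by
  \<open>p' - 2 t p\<close>, the negative of the recursion of \<open>hermite_rpoly\<close>; the
  signs collect in \<open>(-1) ^ k\<close>.\<close>

lemma funpow_deriv_exp:
  "(deriv ^^ k) (\<lambda>t. exp (- t\<^sup>2)) = (\<lambda>x::real. (-1) ^ k * poly (hermite_rpoly k) x * exp (- x\<^sup>2))"
proof (induction k)
  case (Suc k)
  have "deriv (\<lambda>x. (-1) ^ k * poly (hermite_rpoly k) x * exp (- x\<^sup>2)) x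
      = (-1) ^ Suc k * poly (hermite_rpoly (Suc k)) x * exp (- x\<^sup>2)" for x :: real
    by (rule DERIV_imp_deriv) (auto intro!: derivative_eq_intros simp: algebra_simps)
  then show ?case by (simp only: funpow.simps comp_def Suc)
qed simp

lemma hermite_poly_eq: "hermite_poly k x = poly (hermite_rpoly k) x"
  unfolding hermite_poly_def funpow_deriv_exp by (simp add: exp_minus field_simps flip: power_mult_distrib)

lemma pderiv_hermite_rpoly: "pderiv (hermite_rpoly (Suc k)) = smult (2 * real (Suc k)) (hermite_rpoly k)"
proof (induction k)
  case 0
  then show ?case by (simp add: pderiv_mult pderiv_pCons)
next
  case (Suc k)
  have "pderiv (hermite_rpoly (Suc (Suc k)))
      = smult 2 (hermite_rpoly (Suc k)) + [:0, 2:] * pderiv (hermite_rpoly (Suc k)) - pderiv (pderiv (hermite_rpoly (Suc k)))"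
    by (subst hermite_rpoly.simps(2)) (simp only: pderiv_diff pderiv_mult, simp add: pderiv_pCons)
  also have "\<dots> = smult 2 (hermite_rpoly (Suc k)) + smult (2 * real (Suc k)) (hermite_rpoly (Suc k))"
  proof -
    have "pderiv (pderiv (hermite_rpoly (Suc k))) = smult (2 * real (Suc k)) (pderiv (hermite_rpoly k))"
      by (simp only: Suc pderiv_smult)
    moreover have "smult (2 * real (Suc k)) (hermite_rpoly (Suc k))
      = [:0, 2:] * smult (2 * real (Suc k)) (hermite_rpoly k) - smult (2 * real (Suc k)) (pderiv (hermite_rpoly k))"
      by (simp only: hermite_rpoly.simps(2) smult_diff_right mult_smult_right)
    ultimately show ?thesis by (simp only: Suc)
  qed
  also have "\<dots> = smult (2 * real (Suc (Suc k))) (hermite_rpoly (Suc k))"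
    by (simp flip: smult_add_left)
  finally show ?case .
qed

definition hermite_coeff :: "nat \<Rightarrow> real" where
  "hermite_coeff k = (2 ^ k * fact k * sqrt pi) powr (- 1 / 2)"

lemma hermite_coeff_Suc: "sqrt (2 * real k + 2) * hermite_coeff (Suc k) = hermite_coeff k"
proof -
  define y where "y = 2 ^ k * fact k * sqrt pi"
  have y: "y > 0" by (simp add: y_def)
  have "hermite_coeff (Suc k) = ((2 * real k + 2) * y) powr (- 1 / 2)"
    by (simp add: hermite_coeff_def y_def algebra_simps)
  also have "\<dots> = (2 * real k + 2) powr (- 1 / 2) * y powr (- 1 / 2)"
    using y by (simp add: powr_mult)
  also have "(2 * real k + 2) powr (- 1 / 2) = 1 / sqrt (2 * real k + 2)"
    by (simp add: powr_minus_divide powr_half_sqrt)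
  finally show ?thesis by (simp add: hermite_coeff_def y_def)
qed

lemma hermite_fun1_eq: "hermite_fun1 k x = hermite_coeff k * exp (- x\<^sup>2 / 2) * poly (hermite_rpoly k) x"
  by (simp add: hermite_fun1_def hermite_coeff_def hermite_poly_eq)

text \<open>For \<open>h = p * exp (- x\<^sup>2 / 2)\<close> the raising operator
  \<open>- h' + x * h\<close> is \<open>(2 * x * p - p') * exp (- x\<^sup>2 / 2)\<close>, which is
  the shape of the right-hand side.\<close>

lemma hermite_fun1_raise:
  "sqrt (2 * real k + 2) * hermite_fun1 (Suc k) x
   = hermite_coeff k * exp (- x\<^sup>2 / 2) * (2 * x * poly (hermite_rpoly k) x - poly (pderiv (hermite_rpoly k)) x)"
proof -
  have "sqrt (2 * real k + 2) * hermite_fun1 (Suc k) x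
    = (sqrt (2 * real k + 2) * hermite_coeff (Suc k)) * exp (- x\<^sup>2 / 2) * poly (hermite_rpoly (Suc k)) x"
    by (simp only: hermite_fun1_eq mult.assoc)
  then show ?thesis by (simp add: hermite_coeff_Suc)
qed

text \<open>The lowering operator \<open>h' + x * h\<close> turns
  \<open>p * exp (- x\<^sup>2 / 2)\<close> into \<open>p' * exp (- x\<^sup>2 / 2)\<close>. At
  \<open>k = 0\<close> the truncated index \<open>k - 1\<close> is multiplied by
  \<open>sqrt 0\<close>.\<close>

lemma hermite_fun1_lower:
  "sqrt (2 * real k) * hermite_fun1 (k - 1) x
   = hermite_coeff k * exp (- x\<^sup>2 / 2) * poly (pderiv (hermite_rpoly k)) x"
proof (cases k)
  case (Suc j)
  have s: "sqrt (2 * real k) * sqrt (2 * real k) = 2 * real k" by simp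
  have "hermite_coeff j = sqrt (2 * real k) * hermite_coeff k"
    using hermite_coeff_Suc[of j] Suc by (simp add: add.commute)
  then have "sqrt (2 * real k) * hermite_coeff j = sqrt (2 * real k) * sqrt (2 * real k) * hermite_coeff k"
    by (simp only: mult.assoc)
  then have "sqrt (2 * real k) * hermite_coeff j = 2 * real k * hermite_coeff k" by (simp only: s)
  then have "sqrt (2 * real k) * hermite_fun1 j x = 2 * real k * hermite_coeff k * exp (- x\<^sup>2 / 2) * poly (hermite_rpoly j) x"
    by (simp only: hermite_fun1_eq flip: mult.assoc)
  then show ?thesis using pderiv_hermite_rpoly[of j] Suc by simp
qed simp

lemma hermite_fun1_three_term:
  "2 * x * hermite_fun1 k x = sqrt (2 * real k + 2) * hermite_fun1 (Suc k) x + sqrt (2 * real k) * hermite_fun1 (k - 1) x"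
  unfolding hermite_fun1_raise hermite_fun1_lower by (simp add: hermite_fun1_eq algebra_simps)

lemma has_real_derivative_hermite_fun1:
  "(hermite_fun1 k has_real_derivative x * hermite_fun1 k x - sqrt (2 * real k + 2) * hermite_fun1 (Suc k) x) (at x)"
proof -
  have "((\<lambda>x. hermite_coeff k * exp (- x\<^sup>2 / 2) * poly (hermite_rpoly k) x) has_real_derivative
     x * hermite_fun1 k x - sqrt (2 * real k + 2) * hermite_fun1 (Suc k) x) (at x)"
    unfolding hermite_fun1_raise
    by (auto intro!: derivative_eq_intros simp: hermite_fun1_eq algebra_simps)
  then show ?thesis by (simp only: hermite_fun1_eq[symmetric])
qed

text \<open>The Hermite equation \<open>h'' = (x\<^sup>2 - 2 * k - 1) * h\<close>, with
  \<open>h'\<close> in raising form. The three-term relation rewrites the derivative of the raised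
  function in lowering form, which leads back to index \<open>k\<close>.\<close>

lemma has_real_derivative_hermite_fun1':
  "((\<lambda>x. x * hermite_fun1 k x - sqrt (2 * real k + 2) * hermite_fun1 (Suc k) x)
     has_real_derivative (x\<^sup>2 - 2 * real k - 1) * hermite_fun1 k x) (at x)"
proof -
  define s where "s = sqrt (2 * real k + 2)"
  have s2: "s * s = 2 * real k + 2" unfolding s_def by (simp only: real_sqrt_mult_self)
  have lower: "x * hermite_fun1 (Suc k) x - sqrt (2 * real (Suc k) + 2) * hermite_fun1 (Suc (Suc k)) x
     = - x * hermite_fun1 (Suc k) x + s * hermite_fun1 k x"
    using hermite_fun1_three_term[of x "Suc k"] by (simp add: s_def algebra_simps)
  have "((\<lambda>x. x * hermite_fun1 k x - s * hermite_fun1 (Suc k) x) has_real_derivative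
     hermite_fun1 k x + x * (x * hermite_fun1 k x - s * hermite_fun1 (Suc k) x)
      - s * (- x * hermite_fun1 (Suc k) x + s * hermite_fun1 k x)) (at x)"
    using has_real_derivative_hermite_fun1[of k x] has_real_derivative_hermite_fun1[of "Suc k" x]
    unfolding lower s_def[symmetric] by (auto intro!: derivative_eq_intros)
  also have "hermite_fun1 k x + x * (x * hermite_fun1 k x - s * hermite_fun1 (Suc k) x)
      - s * (- x * hermite_fun1 (Suc k) x + s * hermite_fun1 k x)
      = (1 + x\<^sup>2 - s * s) * hermite_fun1 k x" by (simp add: algebra_simps power2_eq_square)
  finally show ?thesis unfolding s2 s_def by (simp add: algebra_simps)
qed

text \<open>Each coefficient costs a factor \<open>x\<close>. Half of the exponent pays for it and
  the other half is left to the induction hypothesis, hence the arbitrary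
  \<open>\<eta>\<close>.\<close>

lemma poly_bound_exp_square:
  fixes p :: "real poly"
  assumes "\<eta> > 0"
  shows "\<exists>C. \<forall>x. \<bar>poly p x\<bar> \<le> C * exp (\<eta> * x\<^sup>2)"
  using assms
proof (induction p arbitrary: \<eta>)
  case 0
  show ?case by (rule exI[of _ 0]) simp
next
  case (pCons a p)
  obtain C where C: "\<And>x. \<bar>poly p x\<bar> \<le> C * exp (\<eta> / 2 * x\<^sup>2)"
    using pCons.IH[of "\<eta> / 2"] pCons.prems by auto
  have C0: "C \<ge> 0" using C[of 0] by simp
  have x: "\<bar>x\<bar> \<le> (1 + 2 / \<eta>) * exp (\<eta> / 2 * x\<^sup>2)" for x :: real
  proof -
    have e: "1 + \<eta> / 2 * x\<^sup>2 \<le> exp (\<eta> / 2 * x\<^sup>2)" by (rule exp_ge_add_one_self)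
    have "\<bar>x\<bar> \<le> 1 + x\<^sup>2" using sum_squares_bound[of 1 "\<bar>x\<bar>"] by (simp add: power2_eq_square)
    also have "\<dots> \<le> (1 + 2 / \<eta>) * (1 + \<eta> / 2 * x\<^sup>2)"
      using pCons.prems by (simp add: field_simps)
    also have "\<dots> \<le> (1 + 2 / \<eta>) * exp (\<eta> / 2 * x\<^sup>2)"
      using e pCons.prems by (intro mult_left_mono) auto
    finally show ?thesis .
  qed
  have "\<bar>poly (pCons a p) x\<bar> \<le> (\<bar>a\<bar> + (1 + 2 / \<eta>) * C) * exp (\<eta> * x\<^sup>2)" for x
  proof -
    have "\<bar>poly (pCons a p) x\<bar> \<le> \<bar>a\<bar> + \<bar>x\<bar> * \<bar>poly p x\<bar>"
      by (simp add: abs_mult[symmetric])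
    also have "\<bar>x\<bar> * \<bar>poly p x\<bar> \<le> ((1 + 2 / \<eta>) * exp (\<eta> / 2 * x\<^sup>2)) * (C * exp (\<eta> / 2 * x\<^sup>2))"
      using x[of x] C[of x] by (intro mult_mono) auto
    also have "\<dots> = (1 + 2 / \<eta>) * C * exp (\<eta> * x\<^sup>2)"
      by (simp add: algebra_simps flip: exp_add)
    also have "\<bar>a\<bar> \<le> \<bar>a\<bar> * exp (\<eta> * x\<^sup>2)"
      using pCons.prems by (simp add: mult_le_cancel_left1)
    finally show ?thesis by (simp add: algebra_simps)
  qed
  then show ?case by blast
qed

text \<open>The rate 3/8 lies between 1/2, the true rate up to polynomials, and 1/4, the rate of
  \<open>gauss\<close>. The distance 1/8 to the latter absorbs factors \<open>x\<close> and
  \<open>x\<^sup>2\<close>, and leaves integrable decay after multiplication by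
  \<open>exp (x\<^sup>2 / 4)\<close>.\<close>

lemma hermite_fun1_bound: "\<exists>C. \<forall>x. \<bar>hermite_fun1 k x\<bar> \<le> C * exp (- 3 / 8 * x\<^sup>2)"
proof -
  obtain C where C: "\<And>x. \<bar>poly (hermite_rpoly k) x\<bar> \<le> C * exp (1 / 8 * x\<^sup>2)"
    using poly_bound_exp_square[of "1/8"] by auto
  have "\<bar>hermite_fun1 k x\<bar> \<le> (hermite_coeff k * C) * exp (- 3 / 8 * x\<^sup>2)" for x
  proof -
    have "\<bar>hermite_fun1 k x\<bar> = hermite_coeff k * exp (- x\<^sup>2 / 2) * \<bar>poly (hermite_rpoly k) x\<bar>"
      by (simp add: hermite_fun1_eq abs_mult hermite_coeff_def)
    also have "\<dots> \<le> hermite_coeff k * exp (- x\<^sup>2 / 2) * (C * exp (1 / 8 * x\<^sup>2))"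
      using C[of x] by (intro mult_left_mono) (auto simp: hermite_coeff_def)
    also have "\<dots> = (hermite_coeff k * C) * exp (- 3 / 8 * x\<^sup>2)"
      by (simp add: flip: exp_add)
    finally show ?thesis .
  qed
  then show ?thesis by blast
qed

lemma has_bochner_integral_exp_neg_square: "has_bochner_integral lborel (\<lambda>x::real. exp (- x\<^sup>2)) (sqrt pi)"
  using has_bochner_integral_even_function[OF gaussian_moment_0] by simp

lemma integrable_exp_neg_square:
  fixes c :: real
  assumes "c > 0"
  shows "integrable lborel (\<lambda>x::real. exp (- c * x\<^sup>2))"
proof -
  have "integrable lborel (\<lambda>x. exp (- (0 + sqrt c * x)\<^sup>2))"
    using lborel_integrable_real_affine[OF has_bochner_integral_exp_neg_square[THEN integrable.intros], of "sqrt c" 0] assms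
    by auto
  then show ?thesis using assms by (simp add: power_mult_distrib)
qed

lemma continuous_on_hermite_fun1: "continuous_on UNIV (hermite_fun1 k)"
  using DERIV_isCont[OF has_real_derivative_hermite_fun1] by (simp add: continuous_at_imp_continuous_on)

lemma borel_measurable_hermite_fun1 [measurable]: "hermite_fun1 k \<in> borel_measurable borel"
  by (rule borel_measurable_continuous_onI[OF continuous_on_hermite_fun1])

text \<open>From \<open>0 \<le> (x / 2 + s)\<^sup>2\<close> one gets
  \<open>(x + s)\<^sup>2 \<ge> x\<^sup>2 / 2 - s\<^sup>2\<close>: half of the exponent survives a
  shift by less than 1.\<close>

lemma exp_add_square_bound:
  fixes x s :: real
  assumes "\<bar>s\<bar> < 1"
  shows "exp (- (x + s)\<^sup>2 / 2) \<le> exp (1 / 2) * exp (- x\<^sup>2 / 4)"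
proof -
  have "0 \<le> (x / 2 + s)\<^sup>2" by simp
  moreover have "s\<^sup>2 \<le> 1" using assms by (simp add: abs_square_le_1)
  ultimately have "- (x + s)\<^sup>2 / 2 \<le> 1 / 2 + (- x\<^sup>2 / 4)"
    unfolding power2_eq_square by (simp add: field_simps)
  then show ?thesis by (simp flip: exp_add)
qed

lemma hermite_fun1_mult_bound: "\<exists>C. \<forall>x. \<bar>hermite_fun1 j x * hermite_fun1 k x\<bar> \<le> C * exp (- 3 / 4 * x\<^sup>2)"
proof -
  obtain C where C: "\<And>x. \<bar>hermite_fun1 j x\<bar> \<le> C * exp (- 3 / 8 * x\<^sup>2)" using hermite_fun1_bound by blast
  obtain D where D: "\<And>x. \<bar>hermite_fun1 k x\<bar> \<le> D * exp (- 3 / 8 * x\<^sup>2)" using hermite_fun1_bound by blast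
  have "\<bar>hermite_fun1 j x * hermite_fun1 k x\<bar> \<le> (C * D) * exp (- 3 / 4 * x\<^sup>2)" for x
  proof -
    have "\<bar>hermite_fun1 j x * hermite_fun1 k x\<bar> \<le> (C * exp (- 3 / 8 * x\<^sup>2)) * (D * exp (- 3 / 8 * x\<^sup>2))"
      unfolding abs_mult using C[of x] D[of x] by (intro mult_mono) auto
    also have "\<dots> = (C * D) * (exp (- 3 / 8 * x\<^sup>2) * exp (- 3 / 8 * x\<^sup>2))" by (simp add: algebra_simps)
    also have "exp (- 3 / 8 * x\<^sup>2) * exp (- 3 / 8 * x\<^sup>2) = exp (- 3 / 4 * x\<^sup>2)"
      by (simp flip: exp_add)
    finally show ?thesis .
  qed
  then show ?thesis by blast
qed

lemma integrable_hermite_fun1_mult: "integrable lborel (\<lambda>x. hermite_fun1 j x * hermite_fun1 k x)"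
proof -
  obtain C where C: "\<And>x. \<bar>hermite_fun1 j x * hermite_fun1 k x\<bar> \<le> C * exp (- 3 / 4 * x\<^sup>2)"
    using hermite_fun1_mult_bound by blast
  show ?thesis
    by (rule Bochner_Integration.integrable_bound[OF integrable_mult_right[OF integrable_exp_neg_square[of "3/4"], of C]])
       (use C in \<open>auto intro!: AE_I2 order_trans[OF _ abs_ge_self]\<close>)
qed

text \<open>Raising and lowering are adjoint. In the derivative of the product of the functions with
  indices \<open>k\<close> and \<open>j\<close>, the first is differentiated in raising form and the
  second in lowering form; the terms with the factor \<open>x\<close> cancel, and the integral of
  the rest vanishes.\<close>

lemma hermite_fun1_inner_step:
  "sqrt (2 * real k + 2) * (LINT x|lborel. hermite_fun1 (Suc k) x * hermite_fun1 j x)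
   = sqrt (2 * real j) * (LINT x|lborel. hermite_fun1 k x * hermite_fun1 (j - 1) x)"
proof -
  define b where "b x = hermite_fun1 k x * hermite_fun1 j x" for x
  define b' where "b' x = sqrt (2 * real j) * (hermite_fun1 k x * hermite_fun1 (j - 1) x)
     - sqrt (2 * real k + 2) * (hermite_fun1 (Suc k) x * hermite_fun1 j x)" for x
  have d: "(b has_real_derivative b' x) (at x)" for x
  proof -
    have "(b has_real_derivative
      (x * hermite_fun1 k x - sqrt (2 * real k + 2) * hermite_fun1 (Suc k) x) * hermite_fun1 j x
      + (x * hermite_fun1 j x - sqrt (2 * real j + 2) * hermite_fun1 (Suc j) x) * hermite_fun1 k x) (at x)"
      unfolding b_def by (rule DERIV_mult'[OF has_real_derivative_hermite_fun1 has_real_derivative_hermite_fun1, THEN DERIV_cong]) simp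
    moreover have "x * hermite_fun1 j x - sqrt (2 * real j + 2) * hermite_fun1 (Suc j) x
      = - x * hermite_fun1 j x + sqrt (2 * real j) * hermite_fun1 (j - 1) x"
      using hermite_fun1_three_term[of x j] by simp
    ultimately show ?thesis
      by (elim DERIV_cong) (simp only: b'_def, simp add: algebra_simps)
  qed
  have b: "integrable lborel b" unfolding b_def by (rule integrable_hermite_fun1_mult)
  obtain C1 where C1: "\<And>x. \<bar>hermite_fun1 k x * hermite_fun1 (j - 1) x\<bar> \<le> C1 * exp (- 3 / 4 * x\<^sup>2)"
    using hermite_fun1_mult_bound by blast
  obtain C2 where C2: "\<And>x. \<bar>hermite_fun1 (Suc k) x * hermite_fun1 j x\<bar> \<le> C2 * exp (- 3 / 4 * x\<^sup>2)"
    using hermite_fun1_mult_bound by blast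
  define C where "C = sqrt (2 * real j) * C1 + sqrt (2 * real k + 2) * C2"
  have C_nn: "C1 \<ge> 0" "C2 \<ge> 0" using C1[of 0] C2[of 0] by auto
  then have "C \<ge> 0" by (simp add: C_def)
  have bd: "\<bar>b' x\<bar> \<le> C * exp (- x\<^sup>2 / 2)" for x
  proof -
    have "\<bar>b' x\<bar> \<le> sqrt (2 * real j) * \<bar>hermite_fun1 k x * hermite_fun1 (j - 1) x\<bar>
      + sqrt (2 * real k + 2) * \<bar>hermite_fun1 (Suc k) x * hermite_fun1 j x\<bar>"
      unfolding b'_def by (rule order_trans[OF abs_triangle_ineq4]) (simp add: abs_mult)
    also have "\<dots> \<le> sqrt (2 * real j) * (C1 * exp (- 3 / 4 * x\<^sup>2)) + sqrt (2 * real k + 2) * (C2 * exp (- 3 / 4 * x\<^sup>2))"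
      by (intro add_mono mult_left_mono C1 C2) auto
    also have "\<dots> = C * exp (- 3 / 4 * x\<^sup>2)" by (simp add: C_def algebra_simps)
    also have "\<dots> \<le> C * exp (- x\<^sup>2 / 2)" using \<open>C \<ge> 0\<close> by (intro mult_left_mono) auto
    finally show ?thesis .
  qed
  have "(LINT x|lborel. b' x) = 0"
  proof (rule integral_directional_derivative_eq_0(2)[of b 1 b' "\<lambda>x. C * (exp (1 / 2) * exp (- (1/4) * x\<^sup>2))"])
    show "((\<lambda>s. b (x + s *\<^sub>R 1)) has_real_derivative b' (x + s *\<^sub>R 1)) (at s)" for x s
      using DERIV_shift[of b "b' (x + s)" s x] d[of "x + s"] by (simp add: add.commute)
    show "\<bar>b' (x + s *\<^sub>R 1)\<bar> \<le> C * (exp (1 / 2) * exp (- (1/4) * x\<^sup>2))" if "\<bar>s\<bar> < 1" for x s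
      using order_trans[OF bd mult_left_mono[OF exp_add_square_bound[OF that, of x] \<open>C \<ge> 0\<close>]] by simp
    show "integrable lborel (\<lambda>x::real. C * (exp (1 / 2) * exp (- (1/4) * x\<^sup>2)))"
      using integrable_exp_neg_square[of "1/4"] by simp
  qed (rule b)
  then show ?thesis
    unfolding b'_def using integrable_hermite_fun1_mult
    by (subst (asm) Bochner_Integration.integral_diff) auto
qed

text \<open>Each step lowers both indices by 1. The descent ends either at two zeros, the Gaussian
  integral, or at one zero, where the factor \<open>sqrt 0\<close> of the adjointness relation makes
  the integral vanish.\<close>

lemma hermite_fun1_orthonormal:
  "(LINT x|lborel. hermite_fun1 j x * hermite_fun1 k x) = (if j = k then 1 else 0)"
proof (induction j arbitrary: k)
  case 0
  show ?case
  proof (cases k)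
    case 0
    have "hermite_fun1 0 x * hermite_fun1 0 x = (1 / sqrt pi) * exp (- x\<^sup>2)" for x
    proof -
      have "hermite_coeff 0 * hermite_coeff 0 = 1 / sqrt pi"
        by (simp add: hermite_coeff_def powr_minus_divide flip: powr_add)
      moreover have "exp (- x\<^sup>2 / 2) * exp (- x\<^sup>2 / 2) = exp (- x\<^sup>2)" by (simp flip: exp_add)
      ultimately show ?thesis by (simp add: hermite_fun1_eq algebra_simps flip: mult.assoc)
    qed
    then show ?thesis using has_bochner_integral_integral_eq[OF has_bochner_integral_exp_neg_square] 0 by simp
  next
    case (Suc i)
    have "0 < sqrt (2 * real i + 2)" by simp
    moreover have "sqrt (2 * real i + 2) * (LINT x|lborel. hermite_fun1 (Suc i) x * hermite_fun1 0 x) = 0"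
      by (subst hermite_fun1_inner_step) simp
    ultimately have "(LINT x|lborel. hermite_fun1 (Suc i) x * hermite_fun1 0 x) = 0"
      by (metis less_numeral_extra(3) mult_eq_0_iff)
    then show ?thesis using Suc by (simp add: mult.commute)
  qed
next
  case (Suc j)
  have pos: "0 < sqrt (2 * real j + 2)" by simp
  have eq: "sqrt (2 * real j + 2) * (LINT x|lborel. hermite_fun1 (Suc j) x * hermite_fun1 k x)
    = sqrt (2 * real k) * (if j = k - 1 then 1 else 0)"
    by (subst hermite_fun1_inner_step) (simp add: Suc)
  have "sqrt (2 * real k) * (if j = k - 1 then 1 else 0) = sqrt (2 * real j + 2) * (if Suc j = k then 1 else 0)"
    by (cases k) (auto simp: algebra_simps)
  with eq have "sqrt (2 * real j + 2) * (LINT x|lborel. hermite_fun1 (Suc j) x * hermite_fun1 k x)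
    = sqrt (2 * real j + 2) * (if Suc j = k then 1 else 0)" by (rule trans)
  with pos show ?case by (simp only: mult_cancel_left) simp
qed

section \<open>Hermite functions of several variables\<close>

lemma hermite_fun_split:
  "hermite_fun n x = hermite_fun1 (n $ i) (x $ i) * (\<Prod>j\<in>UNIV - {i}. hermite_fun1 (n $ j) (x $ j))"
  unfolding hermite_fun_def by (rule prod.remove) auto

lemma hermite_fun_split':
  assumes "\<And>j. j \<noteq> i \<Longrightarrow> m $ j = n $ j" "\<And>j. j \<noteq> i \<Longrightarrow> y $ j = x $ j"
  shows "hermite_fun m y = hermite_fun1 (m $ i) (y $ i) * (\<Prod>j\<in>UNIV - {i}. hermite_fun1 (n $ j) (x $ j))"
proof -
  have "(\<Prod>j\<in>UNIV - {i}. hermite_fun1 (m $ j) (y $ j)) = (\<Prod>j\<in>UNIV - {i}. hermite_fun1 (n $ j) (x $ j))"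
    using assms by (intro prod.cong) auto
  then show ?thesis by (simp add: hermite_fun_split[of m y i])
qed

text \<open>The partial derivative of \<open>hermite_fun n\<close> in direction \<open>i\<close>,
  written so that subtracting it from \<open>x $ i * hermite_fun n x\<close> visibly leaves the
  raised function.\<close>

definition hermite_dfun :: "'d::finite \<Rightarrow> nat ^ 'd \<Rightarrow> real ^ 'd \<Rightarrow> real" where
  "hermite_dfun i n x = x $ i * hermite_fun n x - sqrt (2 * real (n $ i) + 2) * hermite_fun (n + axis i 1) x"

lemma hermite_dfun_split:
  assumes "\<And>j. j \<noteq> i \<Longrightarrow> y $ j = x $ j"
  shows "hermite_dfun i n y =
    (y $ i * hermite_fun1 (n $ i) (y $ i) - sqrt (2 * real (n $ i) + 2) * hermite_fun1 (Suc (n $ i)) (y $ i))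
    * (\<Prod>j\<in>UNIV - {i}. hermite_fun1 (n $ j) (x $ j))"
proof -
  have "hermite_fun n y = hermite_fun1 (n $ i) (y $ i) * (\<Prod>j\<in>UNIV - {i}. hermite_fun1 (n $ j) (x $ j))"
    by (rule hermite_fun_split') (use assms in auto)
  moreover have "hermite_fun (n + axis i 1) y
    = hermite_fun1 ((n + axis i 1) $ i) (y $ i) * (\<Prod>j\<in>UNIV - {i}. hermite_fun1 (n $ j) (x $ j))"
    by (rule hermite_fun_split') (use assms in \<open>auto simp: axis_def\<close>)
  ultimately show ?thesis by (simp add: hermite_dfun_def axis_def algebra_simps)
qed

lemma has_real_derivative_shift:
  "(f has_real_derivative D) (at (c + s)) \<Longrightarrow> ((\<lambda>s. f (c + s)) has_real_derivative D) (at s)"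
  using DERIV_shift[of f D s c] by (simp add: add.commute)

lemma has_real_derivative_hermite_fun:
  "((\<lambda>s. hermite_fun n (x + s *\<^sub>R axis i 1)) has_real_derivative hermite_dfun i n (x + s *\<^sub>R axis i 1)) (at s)"
proof -
  define R where "R = (\<Prod>j\<in>UNIV - {i}. hermite_fun1 (n $ j) (x $ j))"
  have line: "hermite_fun n (x + s *\<^sub>R axis i 1) = hermite_fun1 (n $ i) (x $ i + s) * R" for s
    unfolding R_def by (subst hermite_fun_split'[where i=i and n=n and x=x]) (auto simp: axis_def)
  have dline: "hermite_dfun i n (x + s *\<^sub>R axis i 1) =
    ((x $ i + s) * hermite_fun1 (n $ i) (x $ i + s) - sqrt (2 * real (n $ i) + 2) * hermite_fun1 (Suc (n $ i)) (x $ i + s)) * R"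
    unfolding R_def by (subst hermite_dfun_split[where x=x]) (auto simp: axis_def)
  show ?thesis unfolding line dline
    by (intro DERIV_cmult_right has_real_derivative_shift has_real_derivative_hermite_fun1)
qed

lemma has_real_derivative_hermite_dfun:
  "((\<lambda>s. hermite_dfun i n (x + s *\<^sub>R axis i 1)) has_real_derivative
     (((x + s *\<^sub>R axis i 1) $ i)\<^sup>2 - 2 * real (n $ i) - 1) * hermite_fun n (x + s *\<^sub>R axis i 1)) (at s)"
proof -
  define R where "R = (\<Prod>j\<in>UNIV - {i}. hermite_fun1 (n $ j) (x $ j))"
  have line: "hermite_fun n (x + s *\<^sub>R axis i 1) = hermite_fun1 (n $ i) (x $ i + s) * R" for s
    unfolding R_def by (subst hermite_fun_split'[where i=i and n=n and x=x]) (auto simp: axis_def)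
  have dline: "hermite_dfun i n (x + s *\<^sub>R axis i 1) =
    ((x $ i + s) * hermite_fun1 (n $ i) (x $ i + s) - sqrt (2 * real (n $ i) + 2) * hermite_fun1 (Suc (n $ i)) (x $ i + s)) * R" for s
    unfolding R_def by (subst hermite_dfun_split[where x=x]) (auto simp: axis_def)
  have "((\<lambda>s. (x $ i + s) * hermite_fun1 (n $ i) (x $ i + s) - sqrt (2 * real (n $ i) + 2) * hermite_fun1 (Suc (n $ i)) (x $ i + s))
     has_real_derivative ((x $ i + s)\<^sup>2 - 2 * real (n $ i) - 1) * hermite_fun1 (n $ i) (x $ i + s)) (at s)"
    using has_real_derivative_hermite_fun1'[of "n $ i" "x $ i + s"]
    by (rule has_real_derivative_shift)
  from DERIV_cmult_right[OF this, of R] show ?thesis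
    unfolding line dline by (simp add: axis_def mult.assoc)
qed

lemma delta_adj_hermite_fun:
  "delta_adj i (hermite_fun n) x = sqrt (2 * real (n $ i) + 2) * hermite_fun (n + axis i 1) x"
proof -
  have "partial_deriv i (hermite_fun n) x = hermite_dfun i n x"
    unfolding partial_deriv_def
    using has_real_derivative_hermite_fun[of n x i 0] by (intro DERIV_imp_deriv) simp
  then show ?thesis by (simp add: delta_adj_def hermite_dfun_def)
qed

text \<open>If \<open>n $ i = 0\<close>, the truncated index \<open>n - axis i 1\<close> is
  \<open>n\<close> itself, but its coefficient is 0.\<close>

lemma hermite_fun_three_term:
  "2 * x $ i * hermite_fun n x = sqrt (2 * real (n $ i) + 2) * hermite_fun (n + axis i 1) x
     + sqrt (2 * real (n $ i)) * hermite_fun (n - axis i 1) x"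
proof -
  define R where "R = (\<Prod>j\<in>UNIV - {i}. hermite_fun1 (n $ j) (x $ j))"
  have "hermite_fun n x = hermite_fun1 (n $ i) (x $ i) * R"
    unfolding R_def by (rule hermite_fun_split)
  moreover have "hermite_fun (n + axis i 1) x = hermite_fun1 (Suc (n $ i)) (x $ i) * R"
    unfolding R_def by (subst hermite_fun_split'[where i=i and n=n and x=x]) (auto simp: axis_def)
  moreover have "hermite_fun (n - axis i 1) x = hermite_fun1 (n $ i - 1) (x $ i) * R"
    unfolding R_def by (subst hermite_fun_split'[where i=i and n=n and x=x]) (auto simp: axis_def)
  moreover have "(2 * x $ i * hermite_fun1 (n $ i) (x $ i)) * R
      = (sqrt (2 * real (n $ i) + 2) * hermite_fun1 (Suc (n $ i)) (x $ i) + sqrt (2 * real (n $ i)) * hermite_fun1 (n $ i - 1) (x $ i)) * R"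
    by (simp only: hermite_fun1_three_term)
  ultimately show ?thesis by (simp only: distrib_right mult.assoc)
qed

section \<open>Gaussian majorants and orthonormality\<close>

definition gauss :: "real ^ 'd::finite \<Rightarrow> real" where
  "gauss x = exp (- (norm x)\<^sup>2 / 4)"

lemma gauss_pos [simp]: "0 < gauss x" "0 \<le> gauss x" by (auto simp: gauss_def)

lemma gauss_le_1: "gauss x \<le> 1" by (simp add: gauss_def)

lemma norm_square_vec: "(norm (x :: real ^ 'd::finite))\<^sup>2 = (\<Sum>i\<in>UNIV. (x $ i)\<^sup>2)"
  by (simp add: norm_vec_def L2_set_def sum_nonneg)

lemma integrable_exp_neg_norm_square:
  assumes "c > 0"
  shows "integrable lborel (\<lambda>x::real^'d::finite. exp (- c * (norm x)\<^sup>2))"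
proof -
  have "(\<lambda>x::real^'d. exp (- c * (norm x)\<^sup>2)) = (\<lambda>x. \<Prod>i\<in>UNIV. exp (- c * (x $ i)\<^sup>2))"
    by (simp add: norm_square_vec sum_distrib_left exp_sum flip: sum_negf)
  then show ?thesis
    using integral_prod_coordinates(1)[of "\<lambda>i x. exp (- c * x\<^sup>2)"] integrable_exp_neg_square[OF assms]
    by simp
qed

lemma integrable_gauss: "integrable lborel (gauss :: real ^ 'd::finite \<Rightarrow> real)"
  using integrable_exp_neg_norm_square[of "1/4"] by (simp add: gauss_def[abs_def])

text \<open>Expanding \<open>|x / 2 + s e|^2 \<ge> 0\<close> gives
  \<open>|x + s e|^2 \<ge> |x|^2 / 2 - s^2\<close>. The square on the left fits the use: the Bellman
  terms are at least quadratic in the flows, hence bounded by a multiple of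
  \<open>(gauss x)\<^sup>2\<close>.\<close>

lemma gauss_translate:
  fixes e :: "real ^ 'd::finite"
  assumes "norm e = 1" "\<bar>s\<bar> < 1"
  shows "(gauss (x + s *\<^sub>R e))\<^sup>2 \<le> exp (1 / 2) * gauss x"
proof -
  have s: "s\<^sup>2 \<le> 1" using assms by (simp add: abs_square_le_1)
  have "0 \<le> (norm ((1/2) *\<^sub>R x + s *\<^sub>R e))\<^sup>2" by simp
  also have "\<dots> = (norm x)\<^sup>2 / 4 + s * (x \<bullet> e) + s\<^sup>2"
    using assms(1) unfolding power2_norm_eq_inner norm_eq_1
    by (simp add: inner_add_left inner_add_right inner_commute power2_eq_square)
  finally have 1: "0 \<le> (norm x)\<^sup>2 / 4 + s * (x \<bullet> e) + s\<^sup>2" .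
  have "(norm (x + s *\<^sub>R e))\<^sup>2 = (norm x)\<^sup>2 + 2 * s * (x \<bullet> e) + s\<^sup>2"
    using assms(1) unfolding power2_norm_eq_inner norm_eq_1
    by (simp add: inner_add_left inner_add_right inner_commute power2_eq_square)
  with 1 s have "- (norm (x + s *\<^sub>R e))\<^sup>2 / 2 \<le> 1 / 2 + - (norm x)\<^sup>2 / 4" by simp
  moreover have "(gauss (x + s *\<^sub>R e))\<^sup>2 = exp (- (norm (x + s *\<^sub>R e))\<^sup>2 / 2)"
    by (simp add: gauss_def power2_eq_square flip: exp_add)
  ultimately show ?thesis by (simp add: gauss_def flip: exp_add)
qed

lemma hermite_fun_bound: "\<exists>C\<ge>0. \<forall>x. \<bar>hermite_fun n x\<bar> \<le> C * exp (- 3 / 8 * (norm x)\<^sup>2)"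
proof -
  obtain C where C: "\<And>k x. \<bar>hermite_fun1 k x\<bar> \<le> C k * exp (- 3 / 8 * x\<^sup>2)"
    using hermite_fun1_bound by metis
  have nn: "C k \<ge> 0" for k using C[of k 0] by simp
  have "\<bar>hermite_fun n x\<bar> \<le> (\<Prod>i\<in>UNIV. C (n $ i)) * exp (- 3 / 8 * (norm x)\<^sup>2)" for x
  proof -
    have "\<bar>hermite_fun n x\<bar> \<le> (\<Prod>i\<in>UNIV. C (n $ i) * exp (- 3 / 8 * (x $ i)\<^sup>2))"
      unfolding hermite_fun_def abs_prod by (intro prod_mono) (use C in auto)
    also have "\<dots> = (\<Prod>i\<in>UNIV. C (n $ i)) * exp (\<Sum>i\<in>UNIV. - 3 / 8 * (x $ i)\<^sup>2)"
      by (simp add: prod.distrib exp_sum)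
    also have "(\<Sum>i\<in>UNIV. - 3 / 8 * (x $ i)\<^sup>2) = - 3 / 8 * (norm x)\<^sup>2"
      by (simp only: norm_square_vec sum_distrib_left)
    finally show ?thesis .
  qed
  then show ?thesis using nn by (intro exI[of _ "\<Prod>i\<in>UNIV. C (n $ i)"]) (simp add: prod_nonneg)
qed

lemma exp_bounds_gauss:
  fixes x :: "real ^ 'd::finite"
  shows "exp (- 3 / 8 * (norm x)\<^sup>2) \<le> gauss x"
    and "\<bar>x $ i\<bar> * exp (- 3 / 8 * (norm x)\<^sup>2) \<le> 9 * gauss x"
    and "(x $ i)\<^sup>2 * exp (- 3 / 8 * (norm x)\<^sup>2) \<le> 9 * gauss x"
proof -
  show 1: "exp (- 3 / 8 * (norm x)\<^sup>2) \<le> gauss x" by (simp add: gauss_def)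
  have "(x $ i)\<^sup>2 \<le> (norm x)\<^sup>2" 
    using member_le_sum[of i UNIV "\<lambda>i. (x $ i)\<^sup>2"] by (simp add: norm_square_vec)
  \<comment> \<open>With \<open>y = (norm x)\<^sup>2\<close> one has
    \<open>1 + y \<le> 9 * (1 + y / 8)\<close>; this is where 9 comes from.\<close>
  then have "1 + (x $ i)\<^sup>2 \<le> 9 * exp ((norm x)\<^sup>2 / 8)"
    using exp_ge_add_one_self[of "(norm x)\<^sup>2 / 8"] zero_le_power2[of "norm x"] by linarith
  then have "(1 + (x $ i)\<^sup>2) * exp (- 3 / 8 * (norm x)\<^sup>2) \<le> 9 * exp ((norm x)\<^sup>2 / 8) * exp (- 3 / 8 * (norm x)\<^sup>2)"
    by (intro mult_right_mono) auto
  also have "\<dots> = 9 * gauss x" by (simp add: gauss_def flip: exp_add)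
  finally have *: "(1 + (x $ i)\<^sup>2) * exp (- 3 / 8 * (norm x)\<^sup>2) \<le> 9 * gauss x" .
  have a: "\<bar>x $ i\<bar> \<le> 1 + (x $ i)\<^sup>2" using sum_squares_bound[of 1 "\<bar>x $ i\<bar>"] by (simp add: power2_eq_square)
  show "\<bar>x $ i\<bar> * exp (- 3 / 8 * (norm x)\<^sup>2) \<le> 9 * gauss x"
    by (rule order_trans[OF mult_right_mono[OF a] *]) simp
  show "(x $ i)\<^sup>2 * exp (- 3 / 8 * (norm x)\<^sup>2) \<le> 9 * gauss x"
    by (rule order_trans[OF mult_right_mono *]) auto
qed

lemma hermite_fun_gauss_bounds:
  fixes n :: "nat ^ 'd"
  shows "\<exists>C\<ge>0. \<forall>x. \<bar>hermite_fun n x\<bar> \<le> C * gauss x \<and> (\<forall>i. \<bar>hermite_dfun i n x\<bar> \<le> C * gauss x)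
     \<and> (\<forall>i. \<bar>((x $ i)\<^sup>2 - 2 * real (n $ i) - 1) * hermite_fun n x\<bar> \<le> C * gauss x)"
proof -
  have "\<forall>m :: nat ^ 'd. \<exists>C. 0 \<le> C \<and> (\<forall>x. \<bar>hermite_fun m x\<bar> \<le> C * exp (- 3 / 8 * (norm x)\<^sup>2))"
    using hermite_fun_bound by blast
  from choice[OF this] obtain C where C: "\<And>(m :: nat ^ 'd) x. \<bar>hermite_fun m x\<bar> \<le> C m * exp (- 3 / 8 * (norm x)\<^sup>2)"
    "\<And>m. C m \<ge> 0" by blast
  define s where "s i = sqrt (2 * real (n $ i) + 2)" for i
  define D where "D i = 9 * C n + s i * C (n + axis i 1) + (2 * real (n $ i) + 1) * C n" for i
  have D0: "D i \<ge> 0" for i using C(2) by (simp add: D_def s_def)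
  have h: "\<bar>hermite_fun m x\<bar> \<le> C m * gauss x" for m x
    using order_trans[OF C(1) mult_left_mono[OF exp_bounds_gauss(1) C(2)]] .
  have hx: "\<bar>x $ i\<bar> * \<bar>hermite_fun n x\<bar> \<le> 9 * C n * gauss x" for i x
    using mult_left_mono[OF C(1)[of n x], of "\<bar>x $ i\<bar>"] mult_left_mono[OF exp_bounds_gauss(2)[of x i] C(2)[of n]]
    by (simp add: algebra_simps)
  have hxx: "(x $ i)\<^sup>2 * \<bar>hermite_fun n x\<bar> \<le> 9 * C n * gauss x" for i x
    using mult_left_mono[OF C(1)[of n x], of "(x $ i)\<^sup>2"] mult_left_mono[OF exp_bounds_gauss(3)[of x i] C(2)[of n]]
    by (simp add: algebra_simps)
  have d: "\<bar>hermite_dfun i n x\<bar> \<le> D i * gauss x" for i x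
  proof -
    have "\<bar>hermite_dfun i n x\<bar> \<le> \<bar>x $ i\<bar> * \<bar>hermite_fun n x\<bar> + s i * \<bar>hermite_fun (n + axis i 1) x\<bar>"
      unfolding hermite_dfun_def s_def by (rule order_trans[OF abs_triangle_ineq4]) (simp add: abs_mult)
    also have "\<dots> \<le> 9 * C n * gauss x + s i * (C (n + axis i 1) * gauss x)"
      by (intro add_mono hx mult_left_mono h) (simp add: s_def)
    also have "\<dots> \<le> D i * gauss x"
      using C(2)[of n] by (simp add: D_def algebra_simps)
    finally show ?thesis .
  qed
  have dd: "\<bar>((x $ i)\<^sup>2 - 2 * real (n $ i) - 1) * hermite_fun n x\<bar> \<le> D i * gauss x" for i x
  proof -
    have "\<bar>((x $ i)\<^sup>2 - 2 * real (n $ i) - 1) * hermite_fun n x\<bar>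
      \<le> ((x $ i)\<^sup>2 + (2 * real (n $ i) + 1)) * \<bar>hermite_fun n x\<bar>"
      unfolding abs_mult
      by (rule mult_right_mono) (use zero_le_power2[of "x $ i"] in \<open>simp_all add: abs_le_iff\<close>)
    also have "\<dots> \<le> 9 * C n * gauss x + (2 * real (n $ i) + 1) * (C n * gauss x)"
      by (rule order_trans[OF eq_refl[OF distrib_right]]) (intro add_mono hxx mult_left_mono h, simp)
    also have "\<dots> \<le> D i * gauss x"
      using C(2)[of "n + axis i 1"] by (simp add: D_def s_def algebra_simps)
    finally show ?thesis .
  qed
  define E where "E = C n + (\<Sum>i\<in>UNIV. D i)"
  have E: "C n \<le> E" "D i \<le> E" for i
  proof -
    show "C n \<le> E" using D0 by (simp add: E_def sum_nonneg)
    have "D i \<le> (\<Sum>i\<in>UNIV. D i)" by (rule member_le_sum) (use D0 in auto)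
    then show "D i \<le> E" using C(2)[of n] by (simp add: E_def)
  qed
  have "E \<ge> 0" using E(1) C(2)[of n] by simp
  then show ?thesis
    by (intro exI[of _ E] conjI allI order_trans[OF h mult_right_mono[OF E(1)]]
        order_trans[OF d mult_right_mono[OF E(2)]] order_trans[OF dd mult_right_mono[OF E(2)]]) auto
qed

lemma continuous_on_hermite_fun: "continuous_on UNIV (hermite_fun n)"
proof -
  have "continuous_on UNIV (\<lambda>x::real^'a. hermite_fun1 (n $ i) (x $ i))" for i
    by (rule continuous_on_compose2[OF continuous_on_hermite_fun1]) (auto intro!: continuous_intros)
  then show ?thesis unfolding hermite_fun_def[abs_def] by (intro continuous_on_prod) auto
qed

lemma borel_measurable_hermite_fun [measurable]: "hermite_fun n \<in> borel_measurable borel"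
  by (rule borel_measurable_continuous_onI[OF continuous_on_hermite_fun])

lemma hermite_fun_orthonormal:
  "integrable lborel (\<lambda>x. hermite_fun m x * hermite_fun n x)"
  "(LINT x|lborel. hermite_fun m x * hermite_fun n x) = (if m = n then 1 else 0)"
proof -
  have eq: "(\<lambda>x. hermite_fun m x * hermite_fun n x)
    = (\<lambda>x. \<Prod>i\<in>UNIV. (\<lambda>i x. hermite_fun1 (m $ i) x * hermite_fun1 (n $ i) x) i (x $ i))"
    by (simp add: hermite_fun_def prod.distrib)
  show "integrable lborel (\<lambda>x. hermite_fun m x * hermite_fun n x)"
    unfolding eq by (rule integral_prod_coordinates(1)) (rule integrable_hermite_fun1_mult)
  have "(LINT x|lborel. hermite_fun m x * hermite_fun n x) = (\<Prod>i\<in>UNIV. if m $ i = n $ i then 1 else 0)"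
    unfolding eq by (subst integral_prod_coordinates(2)) (simp_all add: integrable_hermite_fun1_mult hermite_fun1_orthonormal)
  also have "\<dots> = (if m = n then 1 else 0)"
    by (auto simp: vec_eq_iff)
  finally show "(LINT x|lborel. hermite_fun m x * hermite_fun n x) = (if m = n then 1 else 0)" .
qed

subsection \<open>The Bellman function\<close>

text \<open>
  A smooth variant of the Nazarov--Treil function. The parameter \<open>e > 0\<close> keeps the arguments of
  the powers away from \<open>0\<close>; the limit \<open>e \<rightarrow> 0\<close> is taken after integration. The arguments
  of \<open>\<Phi>\<close> are the squared norms of the two vectors. Any \<open>K\<close> with \<open>8 \<le> Q (Q - 1) (K - 1)\<close> and
  \<open>2 (K + 2) \<le> 36 (P - 1)\<close> would do.
\<close>

locale bellman =
  fixes P e :: real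
  assumes P: "2 \<le> P" and e: "0 < e"
begin

definition "Q = P / (P - 1)"
definition "\<theta> = 1 - 2 / P"
definition "K = 8 * P"

definition "\<rho> m n = (m + e) powr (P / 2) + (n + e) powr (Q / 2)"
definition "\<rho>1 m = P / 2 * (m + e) powr (P / 2 - 1)"
definition "\<rho>2 n = Q / 2 * (n + e) powr (Q / 2 - 1)"
definition "\<rho>11 m = P / 2 * (P / 2 - 1) * (m + e) powr (P / 2 - 2)"
definition "\<rho>22 n = Q / 2 * (Q / 2 - 1) * (n + e) powr (Q / 2 - 2)"

text \<open>As e tends to 0, the first summand becomes
  \<open>|u|^2 * (|u|^P + |v|^Q)^\<theta>\<close>. It behaves like \<open>|u|^P\<close> where that
  power dominates and, since \<open>\<theta> * Q = 2 - Q\<close>, like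
  \<open>|u|^2 * |v|^(2 - Q)\<close> where \<open>|v|^Q\<close> dominates: the two branches of the
  Nazarov--Treil function, joined smoothly. The multiple of \<open>|v|^Q\<close> supplies the
  convexity in \<open>v\<close> that the first summand lacks; the constant
  \<open>e powr (Q / 2)\<close> normalizes \<open>\<Phi> 0 0\<close> to 0.\<close>

definition "\<Phi> m n = m * \<rho> m n powr \<theta> + K * ((n + e) powr (Q / 2) - e powr (Q / 2))"
definition "\<Phi>1 m n = \<rho> m n powr \<theta> + m * (\<theta> * \<rho> m n powr (\<theta> - 1) * \<rho>1 m)"
definition "\<Phi>2 m n = m * (\<theta> * \<rho> m n powr (\<theta> - 1) * \<rho>2 n) + K * \<rho>2 n"
definition "\<Phi>11 m n = 2 * (\<theta> * \<rho> m n powr (\<theta> - 1) * \<rho>1 m)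
  + m * (\<theta> * ((\<theta> - 1) * \<rho> m n powr (\<theta> - 2) * \<rho>1 m * \<rho>1 m + \<rho> m n powr (\<theta> - 1) * \<rho>11 m))"
definition "\<Phi>12 m n = \<theta> * \<rho> m n powr (\<theta> - 1) * \<rho>2 n
  + m * (\<theta> * ((\<theta> - 1) * \<rho> m n powr (\<theta> - 2) * \<rho>1 m * \<rho>2 n))"
definition "\<Phi>22 m n = m * (\<theta> * ((\<theta> - 1) * \<rho> m n powr (\<theta> - 2) * \<rho>2 n * \<rho>2 n + \<rho> m n powr (\<theta> - 1) * \<rho>22 n))
  + K * \<rho>22 n"

lemma Q: "1 < Q" "Q \<le> 2" and Q_eqs: "Q / P = Q - 1" "\<theta> * Q = 2 - Q"
  and th: "0 \<le> \<theta>" "\<theta> \<le> 1" "1 - \<theta> = 2 / P" and Q_K: "8 \<le> (Q - 1) * Q * (K - 1)" and K: "16 \<le> K"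
proof -
  show "1 < Q" "Q \<le> 2" "Q / P = Q - 1" "\<theta> * Q = 2 - Q" "0 \<le> \<theta>" "\<theta> \<le> 1" "1 - \<theta> = 2 / P" "16 \<le> K"
    using P by (auto simp: Q_def \<theta>_def K_def field_simps)
  have "(Q - 1) * Q * (K - 1) = P * (8 * P - 1) / (P - 1)\<^sup>2"
    using P by (simp add: Q_def K_def field_simps power2_eq_square)
  moreover have "8 * (P - 1)\<^sup>2 \<le> P * (8 * P - 1)" using P by (simp add: power2_eq_square algebra_simps)
  ultimately show "8 \<le> (Q - 1) * Q * (K - 1)" using P by (simp add: le_divide_eq)
qed

section \<open>Derivatives of the Bellman function along a curve\<close>

context
  fixes m n :: "real \<Rightarrow> real" and m' n' s :: real
  assumes d: "(m has_real_derivative m') (at s)" "(n has_real_derivative n') (at s)"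
    and nn: "0 \<le> m s" "0 \<le> n s"
begin

lemma powr_deriv:
  "((\<lambda>s. (m s + e) powr c) has_real_derivative c * (m s + e) powr (c - 1) * m') (at s)"
  "((\<lambda>s. (n s + e) powr c) has_real_derivative c * (n s + e) powr (c - 1) * n') (at s)"
  using DERIV_fun_powr[of "\<lambda>s. m s + e" m' s c] DERIV_fun_powr[of "\<lambda>s. n s + e" n' s c] d nn e
  by (auto intro!: derivative_eq_intros)

lemma \<rho>_deriv: "((\<lambda>s. \<rho> (m s) (n s)) has_real_derivative \<rho>1 (m s) * m' + \<rho>2 (n s) * n') (at s)"
  unfolding \<rho>_def \<rho>1_def \<rho>2_def by (rule DERIV_add[OF powr_deriv, THEN DERIV_cong]) simp

lemma \<rho>12_deriv: "((\<lambda>s. \<rho>1 (m s)) has_real_derivative \<rho>11 (m s) * m') (at s)"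
  "((\<lambda>s. \<rho>2 (n s)) has_real_derivative \<rho>22 (n s) * n') (at s)"
  unfolding \<rho>1_def \<rho>2_def \<rho>11_def \<rho>22_def
  by (rule DERIV_cmult[OF powr_deriv(1), THEN DERIV_cong], simp)
     (rule DERIV_cmult[OF powr_deriv(2), THEN DERIV_cong], simp)

lemma \<rho>_powr_deriv: "((\<lambda>s. \<rho> (m s) (n s) powr c) has_real_derivative
   c * \<rho> (m s) (n s) powr (c - 1) * (\<rho>1 (m s) * m' + \<rho>2 (n s) * n')) (at s)"
proof -
  have "0 < \<rho> (m s) (n s)" unfolding \<rho>_def using nn e by (intro add_pos_pos) auto
  from DERIV_fun_powr[OF \<rho>_deriv this, of c] show ?thesis by simp
qed

lemma \<Phi>_deriv: "((\<lambda>s. \<Phi> (m s) (n s)) has_real_derivative \<Phi>1 (m s) (n s) * m' + \<Phi>2 (m s) (n s) * n') (at s)"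
proof -
  note D = d \<rho>_powr_deriv[of \<theta>] powr_deriv(2)[of "Q/2"]
  show ?thesis unfolding \<Phi>_def
    by (rule DERIV_cong, (rule D derivative_intros)+)
       (simp add: \<Phi>1_def \<Phi>2_def \<rho>2_def algebra_simps)
qed

lemma \<Phi>1_deriv: "((\<lambda>s. \<Phi>1 (m s) (n s)) has_real_derivative \<Phi>11 (m s) (n s) * m' + \<Phi>12 (m s) (n s) * n') (at s)"
proof -
  note D = d \<rho>_powr_deriv[of \<theta>] \<rho>_powr_deriv[of "\<theta> - 1"] \<rho>12_deriv
  show ?thesis unfolding \<Phi>1_def
    by (rule DERIV_cong, (rule D derivative_intros)+)
       (simp add: \<Phi>11_def \<Phi>12_def algebra_simps)
qed

lemma \<Phi>2_deriv: "((\<lambda>s. \<Phi>2 (m s) (n s)) has_real_derivative \<Phi>12 (m s) (n s) * m' + \<Phi>22 (m s) (n s) * n') (at s)"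
proof -
  note D = d \<rho>_powr_deriv[of "\<theta> - 1"] \<rho>12_deriv
  show ?thesis unfolding \<Phi>2_def
    by (rule DERIV_cong, (rule D derivative_intros)+)
       (simp add: \<Phi>22_def \<Phi>12_def algebra_simps)
qed

end

text \<open>A regularization of \<open>|v|^(2 - Q)\<close>, the value of the factor
  \<open>\<rho> powr \<theta>\<close> where \<open>v\<close> dominates. In the Hessian bound it
  balances the squared velocity of \<open>u\<close> against that of \<open>v\<close>.\<close>

definition "wt n = (n + e) powr (1 - Q / 2)"

section \<open>Signs and sizes of the partial derivatives\<close>

context
  fixes m n :: real
  assumes m: "0 \<le> m" and n: "0 \<le> n"
begin

lemma a: "0 < m + e" "m \<le> m + e" and b: "0 < n + e" "n \<le> n + e"
  using m n e by auto

lemma \<rho>_bounds: "(m + e) powr (P / 2) \<le> \<rho> m n" "(n + e) powr (Q / 2) \<le> \<rho> m n" "0 < \<rho> m n"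
  using a b by (auto simp: \<rho>_def intro: add_pos_pos)

lemma \<rho>12: "0 \<le> \<rho>1 m" "0 \<le> \<rho>2 n" "0 \<le> \<rho>11 m" "(n + e) * \<rho>22 n = (Q / 2 - 1) * \<rho>2 n"
  "(m + e) * \<rho>1 m = P / 2 * (m + e) powr (P / 2)" "(n + e) * \<rho>2 n = Q / 2 * (n + e) powr (Q / 2)"
  "\<rho>22 n \<le> 0"
proof -
  show "0 \<le> \<rho>1 m" "0 \<le> \<rho>2 n" "0 \<le> \<rho>11 m" using P Q by (auto simp: \<rho>1_def \<rho>2_def \<rho>11_def)
  have "(n + e) * (n + e) powr (Q / 2 - 2) = (n + e) powr (1 + (Q / 2 - 2))"
    using b by (simp add: powr_mult_base)
  then show "(n + e) * \<rho>22 n = (Q / 2 - 1) * \<rho>2 n" by (simp add: \<rho>22_def \<rho>2_def)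
  have "(m + e) * (m + e) powr (P / 2 - 1) = (m + e) powr (1 + (P / 2 - 1))"
    using a by (simp add: powr_mult_base)
  then show "(m + e) * \<rho>1 m = P / 2 * (m + e) powr (P / 2)" by (simp add: \<rho>1_def)
  have "(n + e) * (n + e) powr (Q / 2 - 1) = (n + e) powr (1 + (Q / 2 - 1))"
    using b by (simp add: powr_mult_base)
  then show "(n + e) * \<rho>2 n = Q / 2 * (n + e) powr (Q / 2)" by (simp add: \<rho>2_def)
  show "\<rho>22 n \<le> 0" unfolding \<rho>22_def using Q
    by (intro mult_nonpos_nonneg mult_nonneg_nonpos) auto
qed

text \<open>Together with \<open>1 - \<theta> = 2 / P\<close> this bounds
  \<open>(1 - \<theta>) * (m * \<rho>1 m / \<rho> m n)\<close> by 1. That quantity is the loss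
  caused by the negative exponent \<open>\<theta> - 1\<close>, and it decides the signs of
  \<open>\<Phi>11\<close> and \<open>\<Phi>12\<close>.\<close>

lemma m_\<rho>1: "m * \<rho>1 m \<le> P / 2 * \<rho> m n"
proof -
  have "m * \<rho>1 m \<le> (m + e) * \<rho>1 m" using a \<rho>12 by (intro mult_right_mono) auto
  also have "\<dots> \<le> P / 2 * \<rho> m n" using \<rho>12(5) \<rho>_bounds(1) P by simp
  finally show ?thesis .
qed

lemma \<rho>_powr_2: "\<rho> m n powr (\<theta> - 2) = \<rho> m n powr (\<theta> - 1) / \<rho> m n"
proof -
  have "\<rho> m n powr (\<theta> - 2) = \<rho> m n powr ((\<theta> - 1) - 1)" by simp
  also have "\<dots> = \<rho> m n powr (\<theta> - 1) / \<rho> m n"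
    using \<rho>_bounds(3) by (subst powr_diff) (simp add: powr_one)
  finally show ?thesis .
qed

lemma \<Phi>11_nonneg: "0 \<le> \<Phi>11 m n"
proof -
  have "\<Phi>11 m n = \<theta> * \<rho> m n powr (\<theta> - 1) * (2 * \<rho>1 m + m * \<rho>11 m - (1 - \<theta>) * (m * \<rho>1 m / \<rho> m n) * \<rho>1 m)"
    unfolding \<Phi>11_def \<rho>_powr_2 by (simp add: algebra_simps diff_divide_distrib)
  moreover have "(1 - \<theta>) * (m * \<rho>1 m / \<rho> m n) * \<rho>1 m \<le> 1 * \<rho>1 m"
    using m_\<rho>1 \<rho>12 P \<rho>_bounds unfolding th(3) by (intro mult_right_mono) (auto simp: field_simps)
  ultimately show ?thesis using th \<rho>12 m by (auto intro!: mult_nonneg_nonneg add_nonneg_nonneg simp: add_increasing2)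
qed

lemma \<Phi>12_bounds: "0 \<le> \<Phi>12 m n" "\<Phi>12 m n \<le> \<theta> * (\<rho> m n powr (\<theta> - 1) * \<rho>2 n)"
proof -
  have eq: "\<Phi>12 m n = \<theta> * (\<rho> m n powr (\<theta> - 1) * \<rho>2 n) * (1 - (1 - \<theta>) * (m * \<rho>1 m / \<rho> m n))"
    unfolding \<Phi>12_def \<rho>_powr_2 by (simp add: algebra_simps diff_divide_distrib)
  have 1: "(1 - \<theta>) * (m * \<rho>1 m / \<rho> m n) \<le> 1"
    using m_\<rho>1 \<rho>12 P \<rho>_bounds unfolding th(3) by (auto simp: field_simps)
  have 2: "0 \<le> (1 - \<theta>) * (m * \<rho>1 m / \<rho> m n)" unfolding th(3) using m \<rho>12 P \<rho>_bounds by auto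
  have 3: "0 \<le> \<theta> * (\<rho> m n powr (\<theta> - 1) * \<rho>2 n)" using th \<rho>12 by auto
  show "0 \<le> \<Phi>12 m n" unfolding eq using 1 by (intro mult_nonneg_nonneg[OF 3]) simp
  show "\<Phi>12 m n \<le> \<theta> * (\<rho> m n powr (\<theta> - 1) * \<rho>2 n)" unfolding eq
    using 2 3 by (intro mult_left_le) auto
qed

lemma wt_pos: "0 < wt n" using b by (simp add: wt_def)

lemma wt_le: "wt n \<le> \<rho> m n powr \<theta>"
proof -
  have "wt n = ((n + e) powr (Q / 2)) powr \<theta>"
  proof -
    have "1 - Q / 2 = Q / 2 * \<theta>" using Q_eqs(2) by (simp add: algebra_simps)
    then show ?thesis by (simp only: wt_def powr_powr)
  qed
  also have "\<dots> \<le> \<rho> m n powr \<theta>" using \<rho>_bounds th by (intro powr_mono2) auto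
  finally show ?thesis .
qed

lemma \<rho>2_wt: "\<rho>2 n = Q / 2 / wt n"
proof -
  have "(n + e) powr (Q / 2 - 1) * wt n = 1" unfolding wt_def using b by (simp flip: powr_add)
  then show ?thesis using wt_pos by (simp add: \<rho>2_def field_simps)
qed

lemma m_\<rho>_powr: "m * \<rho> m n powr (\<theta> - 1) \<le> 1"
proof -
  have "m \<le> ((m + e) powr (P / 2)) powr (2 / P)" using a P by (simp add: powr_powr)
  also have "\<dots> \<le> \<rho> m n powr (2 / P)" using \<rho>_bounds P by (intro powr_mono2) auto
  finally have "m * \<rho> m n powr (\<theta> - 1) \<le> \<rho> m n powr (2 / P) * \<rho> m n powr (\<theta> - 1)" by (intro mult_right_mono) auto
  also have "\<dots> = 1" using \<rho>_bounds by (simp add: \<theta>_def flip: powr_add)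
  finally show ?thesis .
qed

text \<open>A scaling count. Bounding \<open>sqrt m\<close> by
  \<open>\<rho> m n powr (1 / P)\<close> leaves the negative power
  \<open>\<rho> m n powr (- (1 / P))\<close>, in which \<open>\<rho> m n\<close> may be replaced by
  its summand \<open>(n + e) powr (Q / 2)\<close>. Since \<open>Q / P = Q - 1\<close>, the powers of
  \<open>n + e\<close> then cancel exactly.\<close>

lemma cross_bound: "sqrt m * sqrt n * (\<rho> m n powr (\<theta> - 1) * \<rho>2 n) \<le> Q / 2"
proof -
  have "sqrt m \<le> sqrt (m + e)" using e by simp
  also have "\<dots> = ((m + e) powr (P / 2)) powr (1 / P)" using a P by (simp add: powr_powr powr_half_sqrt)
  also have "\<dots> \<le> \<rho> m n powr (1 / P)" using \<rho>_bounds P by (intro powr_mono2) auto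
  finally have 1: "sqrt m \<le> \<rho> m n powr (1 / P)" .
  have "sqrt n * \<rho>2 n \<le> sqrt (n + e) * \<rho>2 n" using e \<rho>12 by (intro mult_right_mono) auto
  also have "\<dots> = Q / 2 * (n + e) powr (Q / 2 - 1 / 2)"
    using b by (simp add: \<rho>2_def flip: powr_half_sqrt powr_add)
  finally have 2: "sqrt n * \<rho>2 n \<le> Q / 2 * (n + e) powr (Q / 2 - 1 / 2)" .
  have "\<rho> m n powr (1 / P) * \<rho> m n powr (\<theta> - 1) = \<rho> m n powr (- (1 / P))"
    by (simp add: \<theta>_def flip: powr_add)
  also have "\<dots> \<le> ((n + e) powr (Q / 2)) powr (- (1 / P))"
    using \<rho>_bounds P b by (intro powr_mono2') auto
  also have "\<dots> = (n + e) powr (- (Q / 2 - 1 / 2))"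
  proof -
    have "Q / 2 * - (1 / P) = - ((Q / P) / 2)" by simp
    also have "\<dots> = - (Q / 2 - 1 / 2)" unfolding Q_eqs(1) by (simp add: field_simps)
    finally show ?thesis by (simp only: powr_powr)
  qed
  finally have 3: "\<rho> m n powr (1 / P) * \<rho> m n powr (\<theta> - 1) \<le> (n + e) powr (- (Q / 2 - 1 / 2))" .
  have "sqrt m * sqrt n * (\<rho> m n powr (\<theta> - 1) * \<rho>2 n) = (sqrt m * \<rho> m n powr (\<theta> - 1)) * (sqrt n * \<rho>2 n)" by simp
  also have "\<dots> \<le> (\<rho> m n powr (1 / P) * \<rho> m n powr (\<theta> - 1)) * (Q / 2 * (n + e) powr (Q / 2 - 1 / 2))"
    by (rule mult_mono[OF mult_right_mono[OF 1] 2]) (use n m \<rho>12 in simp_all)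
  also have "\<dots> \<le> (n + e) powr (- (Q / 2 - 1 / 2)) * (Q / 2 * (n + e) powr (Q / 2 - 1 / 2))"
    using 3 Q by (intro mult_right_mono) auto
  also have "\<dots> = Q / 2 * ((n + e) powr (- (Q / 2 - 1 / 2)) * (n + e) powr (Q / 2 - 1 / 2))" by simp
  also have "\<dots> = Q / 2" using b by (subst powr_add[symmetric]) simp
  finally show ?thesis .
qed

text \<open>\<open>\<Phi>22\<close> is not positive, so the worst second derivative in
  \<open>v\<close> has \<open>n'\<^sup>2\<close> close to \<open>4 * n * Y\<^sup>2\<close>, which
  produces this combination. All its terms become multiples of \<open>\<rho>2 n\<close>, because
  \<open>(n + e) * \<rho>22 n\<close> is one, and they add up to at least
  \<open>2 * (Q - 1) * (K - w) * \<rho>2 n\<close> with \<open>w \<le> 1\<close>. The size of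
  \<open>K\<close> is dictated here.\<close>

lemma \<Phi>22_lower: "8 / wt n \<le> 4 * (n + e) * \<Phi>22 m n + 2 * \<Phi>2 m n"
proof -
  define w where "w = m * (\<theta> * \<rho> m n powr (\<theta> - 1))"
  have w: "0 \<le> w" using m th by (simp add: w_def)
  have "w = \<theta> * (m * \<rho> m n powr (\<theta> - 1))" by (simp add: w_def)
  also have "\<dots> \<le> 1 * 1" using m_\<rho>_powr th m by (intro mult_mono) auto
  finally have w1: "w \<le> 1" by simp
  have r: "(n + e) * \<rho>2 n / \<rho> m n \<le> Q / 2"
    using \<rho>12(6) \<rho>_bounds Q by (simp add: divide_le_eq)
  have "4 * (n + e) * \<Phi>22 m n + 2 * \<Phi>2 m n
    = w * (- 4 * (1 - \<theta>) * ((n + e) * \<rho>2 n / \<rho> m n) * \<rho>2 n + 4 * ((n + e) * \<rho>22 n)) + 4 * K * ((n + e) * \<rho>22 n) + 2 * (w + K) * \<rho>2 n"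
    unfolding \<Phi>22_def \<Phi>2_def \<rho>_powr_2 w_def by (simp add: algebra_simps)
  also have "\<dots> \<ge> w * (- 8 / P * (Q / 2) * \<rho>2 n + 4 * ((n + e) * \<rho>22 n)) + 4 * K * ((n + e) * \<rho>22 n) + 2 * (w + K) * \<rho>2 n"
    using mult_right_mono[OF mult_left_mono[OF r, of "8 / P"] \<rho>12(2)] P w unfolding th(3)
    by (intro add_right_mono mult_left_mono) auto
  also have "w * (- 8 / P * (Q / 2) * \<rho>2 n + 4 * ((n + e) * \<rho>22 n)) + 4 * K * ((n + e) * \<rho>22 n) + 2 * (w + K) * \<rho>2 n
    = w * (- 4 * (Q / P) * \<rho>2 n + 4 * ((Q / 2 - 1) * \<rho>2 n)) + 4 * K * ((Q / 2 - 1) * \<rho>2 n) + 2 * (w + K) * \<rho>2 n"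
    unfolding \<rho>12(4) by simp
  also have "\<dots> = 2 * (Q - 1) * (K - w) * \<rho>2 n"
    unfolding Q_eqs(1) by (simp add: algebra_simps)
  also have "\<dots> \<ge> 2 * (Q - 1) * (K - 1) * \<rho>2 n"
    using w1 Q \<rho>12 by (intro mult_right_mono mult_left_mono) auto
  also have "2 * (Q - 1) * (K - 1) * \<rho>2 n = (Q - 1) * Q * (K - 1) / wt n"
    unfolding \<rho>2_wt using wt_pos by (simp add: field_simps)
  also have "\<dots> \<ge> 8 / wt n" using Q_K wt_pos by (intro divide_right_mono) auto
  finally show ?thesis by simp
qed

lemma \<Phi>22_nonpos: "\<Phi>22 m n \<le> 0"
proof -
  have "0 \<le> m * (\<theta> * ((2 / P) * \<rho> m n powr (\<theta> - 2) * \<rho>2 n * \<rho>2 n + \<rho> m n powr (\<theta> - 1) * - \<rho>22 n)) + K * - \<rho>22 n"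
    using m th P \<rho>12 K by (intro add_nonneg_nonneg mult_nonneg_nonneg) auto
  then show ?thesis by (simp add: \<Phi>22_def \<theta>_def algebra_simps)
qed

text \<open>Lower bounds on the first derivatives serve the potential: the equations replace the
  summed second derivatives of a flow by \<open>|x|^2 + \<kappa>\<close> times the flow, and
  \<open>\<Phi>1\<close> and \<open>\<Phi>2\<close> turn this into the zero-order part of the
  energy.\<close>

lemma \<Phi>1_lower: "wt n \<le> \<Phi>1 m n"
  unfolding \<Phi>1_def using m th \<rho>12 wt_le by (intro order_trans[OF wt_le]) auto

lemma \<Phi>2_lower: "4 / wt n \<le> \<Phi>2 m n"
proof -
  have "4 / wt n \<le> K * Q / 2 / wt n"
    using K Q wt_pos mult_mono[of 16 K 1 Q] by (intro divide_right_mono) auto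
  also have "\<dots> = K * \<rho>2 n" by (simp add: \<rho>2_wt)
  also have "\<dots> \<le> \<Phi>2 m n" unfolding \<Phi>2_def using m th \<rho>12 by simp
  finally show ?thesis .
qed

lemma \<Phi>_nonneg: "0 \<le> \<Phi> m n"
  unfolding \<Phi>_def using m n e K Q by (intro add_nonneg_nonneg mult_nonneg_nonneg) (auto intro: powr_mono2)

text \<open>\<open>X\<close> and \<open>Y\<close> are the speeds of \<open>u\<close> and
  \<open>v\<close>. The pure terms yield \<open>2 * wt n * X\<^sup>2 + 8 / wt n * Y\<^sup>2\<close>.
  The mixed term costs at most \<open>4 * (X * Y)\<close>, as
  \<open>\<theta> * Q = 2 - Q \<le> 1\<close>, and by the arithmetic-geometric mean inequality this
  is at most half of that yield.\<close>

lemma hessian_lower: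
  assumes X: "0 \<le> X" and Y: "0 \<le> Y" and m': "\<bar>m'\<bar> \<le> 2 * sqrt m * X" and n': "\<bar>n'\<bar> \<le> 2 * sqrt n * Y"
  shows "wt n * X\<^sup>2 + 4 / wt n * Y\<^sup>2 \<le>
    \<Phi>11 m n * m'\<^sup>2 + 2 * \<Phi>12 m n * m' * n' + \<Phi>22 m n * n'\<^sup>2 + 2 * \<Phi>1 m n * X\<^sup>2 + 2 * \<Phi>2 m n * Y\<^sup>2"
proof -
  have 1: "0 \<le> \<Phi>11 m n * m'\<^sup>2" using \<Phi>11_nonneg by simp
  have 2: "- (4 * (X * Y)) \<le> 2 * \<Phi>12 m n * m' * n'"
  proof -
    have "\<bar>2 * \<Phi>12 m n * m' * n'\<bar> = 2 * \<Phi>12 m n * (\<bar>m'\<bar> * \<bar>n'\<bar>)"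
      using \<Phi>12_bounds(1) by (simp add: abs_mult)
    also have "\<dots> \<le> 2 * (\<theta> * (\<rho> m n powr (\<theta> - 1) * \<rho>2 n)) * ((2 * sqrt m * X) * (2 * sqrt n * Y))"
      using \<Phi>12_bounds m' n' m n X Y by (intro mult_mono) auto
    also have "\<dots> = 8 * \<theta> * (X * Y) * (sqrt m * sqrt n * (\<rho> m n powr (\<theta> - 1) * \<rho>2 n))" by simp
    also have "\<dots> \<le> 8 * \<theta> * (X * Y) * (Q / 2)"
      using cross_bound th X Y by (intro mult_left_mono) auto
    also have "\<dots> = 4 * (\<theta> * Q) * (X * Y)" by simp
    also have "\<dots> \<le> 4 * 1 * (X * Y)" 
    proof -
      have "\<theta> * Q \<le> 1" using Q_eqs(2) Q(1) by linarith
      then show ?thesis using X Y by (intro mult_right_mono mult_left_mono) simp_all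
    qed
    finally have "\<bar>2 * \<Phi>12 m n * m' * n'\<bar> \<le> 4 * 1 * (X * Y)" .
    from abs_le_D2[OF this] show ?thesis by linarith
  qed
  have "n'\<^sup>2 \<le> (2 * sqrt n * Y)\<^sup>2" using n' by (intro power2_le_iff_abs_le[THEN iffD2]) (use n Y in auto)
  also have "\<dots> = 4 * n * Y\<^sup>2" using n by (simp add: power_mult_distrib)
  also have "\<dots> \<le> 4 * (n + e) * Y\<^sup>2" using e by (intro mult_right_mono) auto
  finally have "\<Phi>22 m n * (4 * (n + e) * Y\<^sup>2) \<le> \<Phi>22 m n * n'\<^sup>2" using \<Phi>22_nonpos by (rule mult_left_mono_neg)
  moreover have "8 / wt n * Y\<^sup>2 \<le> (4 * (n + e) * \<Phi>22 m n + 2 * \<Phi>2 m n) * Y\<^sup>2"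
    using \<Phi>22_lower by (intro mult_right_mono) auto
  ultimately have 3: "8 / wt n * Y\<^sup>2 \<le> \<Phi>22 m n * n'\<^sup>2 + 2 * \<Phi>2 m n * Y\<^sup>2" by (simp add: algebra_simps)
  have 4: "2 * wt n * X\<^sup>2 \<le> 2 * \<Phi>1 m n * X\<^sup>2" using \<Phi>1_lower by (intro mult_right_mono) auto
  have 5: "4 * (X * Y) \<le> wt n * X\<^sup>2 + 4 / wt n * Y\<^sup>2"
  proof -
    have "0 \<le> (wt n * X - 2 * Y)\<^sup>2 / wt n" using wt_pos by simp
    also have "\<dots> = wt n * X\<^sup>2 + 4 / wt n * Y\<^sup>2 - 4 * (X * Y)"
      using wt_pos by (simp add: field_simps power2_eq_square)
    finally show ?thesis by simp
  qed
  have 6: "8 / wt n * Y\<^sup>2 = 2 * (4 / wt n * Y\<^sup>2)" by simp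
  from 1 2 3 4 5 6 show ?thesis by linarith
qed

end

end

section \<open>Composition with squared norms, and bounds on bounded sets\<close>

context bellman
begin

lemma bounded_on_box:
  fixes f :: "real \<Rightarrow> real \<Rightarrow> real"
  assumes "continuous_on ({0..M} \<times> {0..M}) (\<lambda>(m, n). f m n)"
  shows "\<exists>C. \<forall>m n. 0 \<le> m \<longrightarrow> m \<le> M \<longrightarrow> 0 \<le> n \<longrightarrow> n \<le> M \<longrightarrow> \<bar>f m n\<bar> \<le> C"
proof -
  have "compact ((\<lambda>(m, n). f m n) ` ({0..M} \<times> {0..M}))"
    by (intro compact_continuous_image assms compact_Times compact_Icc)
  then have "bounded ((\<lambda>(m, n). f m n) ` ({0..M} \<times> {0..M}))" by (rule compact_imp_bounded)
  then obtain C where "\<forall>y \<in> (\<lambda>(m, n). f m n) ` ({0..M} \<times> {0..M}). \<bar>y\<bar> \<le> C"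
    unfolding bounded_real by blast
  then have "\<bar>f m n\<bar> \<le> C" if "0 \<le> m" "m \<le> M" "0 \<le> n" "n \<le> M" for m n
    using that by (auto simp: image_iff)
  then show ?thesis by blast
qed

lemma derivatives_bounded:
  "\<exists>C\<ge>0. \<forall>m n. 0 \<le> m \<longrightarrow> m \<le> M \<longrightarrow> 0 \<le> n \<longrightarrow> n \<le> M \<longrightarrow>
     \<bar>\<Phi>1 m n\<bar> \<le> C \<and> \<bar>\<Phi>2 m n\<bar> \<le> C \<and> \<bar>\<Phi>11 m n\<bar> \<le> C \<and> \<bar>\<Phi>12 m n\<bar> \<le> C \<and> \<bar>\<Phi>22 m n\<bar> \<le> C"
proof -
  let ?B = "{0..M} \<times> {0..M}"
  have pos: "fst z + e \<noteq> 0" "snd z + e \<noteq> 0" "\<rho> (fst z) (snd z) \<noteq> 0" if "z \<in> ?B" for z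
    using that e \<rho>_bounds(3)[of "fst z" "snd z"] by auto
  have c: "continuous_on ?B (\<lambda>z. (fst z + e) powr c)" "continuous_on ?B (\<lambda>z. (snd z + e) powr c)" for c
    by (intro continuous_on_powr continuous_intros; use pos in blast)+
  have c\<rho>: "continuous_on ?B (\<lambda>z. \<rho> (fst z) (snd z))"
    unfolding \<rho>_def by (intro continuous_intros c)
  have c\<rho>p: "continuous_on ?B (\<lambda>z. \<rho> (fst z) (snd z) powr c)" for c
    by (intro continuous_on_powr c\<rho> continuous_intros; use pos in blast)
  have c\<rho>12: "continuous_on ?B (\<lambda>z. \<rho>1 (fst z))" "continuous_on ?B (\<lambda>z. \<rho>2 (snd z))"
    "continuous_on ?B (\<lambda>z. \<rho>11 (fst z))" "continuous_on ?B (\<lambda>z. \<rho>22 (snd z))"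
    unfolding \<rho>1_def \<rho>2_def \<rho>11_def \<rho>22_def by (intro continuous_intros c)+
  have "continuous_on ?B (\<lambda>(m, n). \<Phi>1 m n)" "continuous_on ?B (\<lambda>(m, n). \<Phi>2 m n)"
    "continuous_on ?B (\<lambda>(m, n). \<Phi>11 m n)" "continuous_on ?B (\<lambda>(m, n). \<Phi>12 m n)"
    "continuous_on ?B (\<lambda>(m, n). \<Phi>22 m n)"
    unfolding case_prod_beta \<Phi>1_def \<Phi>2_def \<Phi>11_def \<Phi>12_def \<Phi>22_def
    by (intro continuous_intros c\<rho>p c\<rho>12)+
  from this[THEN bounded_on_box] obtain C1 C2 C3 C4 C5 where
    C: "\<And>m n. 0 \<le> m \<Longrightarrow> m \<le> M \<Longrightarrow> 0 \<le> n \<Longrightarrow> n \<le> M \<Longrightarrow> \<bar>\<Phi>1 m n\<bar> \<le> C1"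
    "\<And>m n. 0 \<le> m \<Longrightarrow> m \<le> M \<Longrightarrow> 0 \<le> n \<Longrightarrow> n \<le> M \<Longrightarrow> \<bar>\<Phi>2 m n\<bar> \<le> C2"
    "\<And>m n. 0 \<le> m \<Longrightarrow> m \<le> M \<Longrightarrow> 0 \<le> n \<Longrightarrow> n \<le> M \<Longrightarrow> \<bar>\<Phi>11 m n\<bar> \<le> C3"
    "\<And>m n. 0 \<le> m \<Longrightarrow> m \<le> M \<Longrightarrow> 0 \<le> n \<Longrightarrow> n \<le> M \<Longrightarrow> \<bar>\<Phi>12 m n\<bar> \<le> C4"
    "\<And>m n. 0 \<le> m \<Longrightarrow> m \<le> M \<Longrightarrow> 0 \<le> n \<Longrightarrow> n \<le> M \<Longrightarrow> \<bar>\<Phi>22 m n\<bar> \<le> C5"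
    by blast
  define C where "C = \<bar>C1\<bar> + \<bar>C2\<bar> + \<bar>C3\<bar> + \<bar>C4\<bar> + \<bar>C5\<bar>"
  have "C1 \<le> C" "C2 \<le> C" "C3 \<le> C" "C4 \<le> C" "C5 \<le> C" "0 \<le> C" unfolding C_def by linarith+
  moreover from this have "\<bar>\<Phi>1 m n\<bar> \<le> C \<and> \<bar>\<Phi>2 m n\<bar> \<le> C \<and> \<bar>\<Phi>11 m n\<bar> \<le> C \<and> \<bar>\<Phi>12 m n\<bar> \<le> C \<and> \<bar>\<Phi>22 m n\<bar> \<le> C"
    if "0 \<le> m" "m \<le> M" "0 \<le> n" "n \<le> M" for m n
    using C(1)[OF that] C(2)[OF that] C(3)[OF that] C(4)[OF that] C(5)[OF that] by linarith
  ultimately show ?thesis by blast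
qed

text \<open>\<open>\<Phi> 0 0 = 0\<close> and the gradient is bounded on the box, so the mean value
  theorem along the segment from the origin gives linear growth. For squared norms of Gaussian size
  this makes \<open>bell\<close> integrable.\<close>

lemma \<Phi>_bounded: "\<exists>C\<ge>0. \<forall>m n. 0 \<le> m \<longrightarrow> m \<le> M \<longrightarrow> 0 \<le> n \<longrightarrow> n \<le> M \<longrightarrow> \<bar>\<Phi> m n\<bar> \<le> C * (m + n)"
proof -
  obtain C where C: "C \<ge> 0" "\<And>m n. 0 \<le> m \<Longrightarrow> m \<le> M \<Longrightarrow> 0 \<le> n \<Longrightarrow> n \<le> M \<Longrightarrow> \<bar>\<Phi>1 m n\<bar> \<le> C \<and> \<bar>\<Phi>2 m n\<bar> \<le> C"
    using derivatives_bounded[of M] by blast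
  have "\<bar>\<Phi> m n\<bar> \<le> C * (m + n)" if mn: "0 \<le> m" "m \<le> M" "0 \<le> n" "n \<le> M" for m n
  proof -
    let ?D = "\<lambda>s. \<Phi>1 (s * m) (s * n) * m + \<Phi>2 (s * m) (s * n) * n"
    have "norm (\<Phi> (1 * m) (1 * n) - \<Phi> (0 * m) (0 * n)) \<le> C * (m + n) * norm (1 - 0 :: real)"
    proof (rule field_differentiable_bound[of "{0..1}" "\<lambda>s. \<Phi> (s * m) (s * n)" ?D])
      fix s :: real assume s: "s \<in> {0..1}"
      have "((\<lambda>s. \<Phi> (s * m) (s * n)) has_real_derivative ?D s) (at s)"
        by (rule \<Phi>_deriv) (use s mn in \<open>auto intro!: derivative_eq_intros\<close>)
      then show "((\<lambda>s. \<Phi> (s * m) (s * n)) has_real_derivative ?D s) (at s within {0..1})"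
        by (rule has_field_derivative_at_within)
      have box: "0 \<le> s * m" "s * m \<le> M" "0 \<le> s * n" "s * n \<le> M"
        using s mn mult_mono[of s 1 m M] mult_mono[of s 1 n M] by auto
      have "\<bar>?D s\<bar> \<le> \<bar>\<Phi>1 (s * m) (s * n)\<bar> * m + \<bar>\<Phi>2 (s * m) (s * n)\<bar> * n"
        using mn by (intro order_trans[OF abs_triangle_ineq]) (simp add: abs_mult)
      also have "\<dots> \<le> C * m + C * n"
        using C(2)[OF box] mn by (intro add_mono mult_right_mono) auto
      finally show "norm (?D s) \<le> C * (m + n)" by (simp add: algebra_simps)
    qed auto
    then show ?thesis by (simp add: \<Phi>_def)
  qed
  with C(1) show ?thesis by blast
qed

definition bell :: "'v::real_inner \<Rightarrow> 'w::real_inner \<Rightarrow> real" where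
  "bell u v = \<Phi> ((norm u)\<^sup>2) ((norm v)\<^sup>2)"

definition bell1 :: "'v::real_inner \<Rightarrow> 'w::real_inner \<Rightarrow> 'v \<Rightarrow> 'w \<Rightarrow> real" where
  "bell1 u v u' v' = \<Phi>1 ((norm u)\<^sup>2) ((norm v)\<^sup>2) * (2 * (u \<bullet> u')) + \<Phi>2 ((norm u)\<^sup>2) ((norm v)\<^sup>2) * (2 * (v \<bullet> v'))"

text \<open>The second derivative of \<open>bell\<close> along a curve with velocity
  \<open>(u', v')\<close> and acceleration \<open>(u'', v'')\<close>.\<close>

definition bell2 :: "'v::real_inner \<Rightarrow> 'w::real_inner \<Rightarrow> 'v \<Rightarrow> 'w \<Rightarrow> 'v \<Rightarrow> 'w \<Rightarrow> real" where
  "bell2 u v u' v' u'' v'' =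
     (\<Phi>11 ((norm u)\<^sup>2) ((norm v)\<^sup>2) * (2 * (u \<bullet> u')) + \<Phi>12 ((norm u)\<^sup>2) ((norm v)\<^sup>2) * (2 * (v \<bullet> v'))) * (2 * (u \<bullet> u'))
     + (\<Phi>12 ((norm u)\<^sup>2) ((norm v)\<^sup>2) * (2 * (u \<bullet> u')) + \<Phi>22 ((norm u)\<^sup>2) ((norm v)\<^sup>2) * (2 * (v \<bullet> v'))) * (2 * (v \<bullet> v'))
     + \<Phi>1 ((norm u)\<^sup>2) ((norm v)\<^sup>2) * (2 * ((norm u')\<^sup>2 + u \<bullet> u''))
     + \<Phi>2 ((norm u)\<^sup>2) ((norm v)\<^sup>2) * (2 * ((norm v')\<^sup>2 + v \<bullet> v''))"

lemma inner_deriv: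
  assumes "(u has_vector_derivative u') (at s)" "(v has_vector_derivative v') (at s)"
  shows "((\<lambda>s. u s \<bullet> v s) has_real_derivative u s \<bullet> v' + u' \<bullet> v s) (at s)"
  unfolding has_real_derivative_iff_has_vector_derivative
  by (rule bounded_bilinear.has_vector_derivative[OF bounded_bilinear_inner assms])

lemma norm_square_deriv:
  assumes "(u has_vector_derivative u') (at s)"
  shows "((\<lambda>s. (norm (u s))\<^sup>2) has_real_derivative 2 * (u s \<bullet> u')) (at s)"
  using inner_deriv[OF assms assms] by (simp add: power2_norm_eq_inner inner_commute)

lemma bell_deriv:
  assumes "(u has_vector_derivative u') (at s)" "(v has_vector_derivative v') (at s)"
  shows "((\<lambda>s. bell (u s) (v s)) has_real_derivative bell1 (u s) (v s) u' v') (at s)"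
  unfolding bell_def bell1_def by (intro \<Phi>_deriv norm_square_deriv assms) auto

lemma bell1_deriv:
  assumes u: "(u has_vector_derivative u' s) (at s)" "(u' has_vector_derivative u'') (at s)"
    and v: "(v has_vector_derivative v' s) (at s)" "(v' has_vector_derivative v'') (at s)"
  shows "((\<lambda>s. bell1 (u s) (v s) (u' s) (v' s)) has_real_derivative
    bell2 (u s) (v s) (u' s) (v' s) u'' v'') (at s)"
proof -
  note D = \<Phi>1_deriv[OF norm_square_deriv[OF u(1)] norm_square_deriv[OF v(1)] zero_le_power2 zero_le_power2]
    \<Phi>2_deriv[OF norm_square_deriv[OF u(1)] norm_square_deriv[OF v(1)] zero_le_power2 zero_le_power2]
    inner_deriv[OF u] inner_deriv[OF v]
  show ?thesis unfolding bell1_def bell2_def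
    by (rule DERIV_cong, (rule D DERIV_add DERIV_mult DERIV_cmult)+)
       (simp add: power2_norm_eq_inner algebra_simps)
qed

text \<open>The acceleration terms are set apart because in a single direction they have no sign;
  only their sum over time and all coordinates is known from the equation.\<close>

lemma bell2_lower:
  "wt ((norm v)\<^sup>2) * (norm u')\<^sup>2 + 4 / wt ((norm v)\<^sup>2) * (norm v')\<^sup>2
    \<le> bell2 u v u' v' u'' v'' - 2 * \<Phi>1 ((norm u)\<^sup>2) ((norm v)\<^sup>2) * (u \<bullet> u'') - 2 * \<Phi>2 ((norm u)\<^sup>2) ((norm v)\<^sup>2) * (v \<bullet> v'')"
proof -
  have "wt ((norm v)\<^sup>2) * (norm u')\<^sup>2 + 4 / wt ((norm v)\<^sup>2) * (norm v')\<^sup>2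
    \<le> \<Phi>11 ((norm u)\<^sup>2) ((norm v)\<^sup>2) * (2 * (u \<bullet> u'))\<^sup>2
      + 2 * \<Phi>12 ((norm u)\<^sup>2) ((norm v)\<^sup>2) * (2 * (u \<bullet> u')) * (2 * (v \<bullet> v'))
      + \<Phi>22 ((norm u)\<^sup>2) ((norm v)\<^sup>2) * (2 * (v \<bullet> v'))\<^sup>2
      + 2 * \<Phi>1 ((norm u)\<^sup>2) ((norm v)\<^sup>2) * (norm u')\<^sup>2 + 2 * \<Phi>2 ((norm u)\<^sup>2) ((norm v)\<^sup>2) * (norm v')\<^sup>2"
    by (rule hessian_lower) (use Cauchy_Schwarz_ineq2[of u u'] Cauchy_Schwarz_ineq2[of v v'] in \<open>auto simp: abs_mult\<close>)
  then show ?thesis by (simp add: bell2_def power2_eq_square algebra_simps)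
qed

text \<open>Every summand is of degree at least 2 in the vectors, so vectors of size
  \<open>M * G\<close> with \<open>G \<le> 1\<close> give size \<open>G\<^sup>2\<close>. This square
  is what \<open>gauss_translate\<close> expects.\<close>

lemma bell_bounds:
  "\<exists>C\<ge>0. \<forall>G (u::'v::real_inner) (v::'w::real_inner) u' v' u'' v''. 0 \<le> G \<longrightarrow> G \<le> 1 \<longrightarrow>
     norm u \<le> M * G \<longrightarrow> norm v \<le> M * G \<longrightarrow> norm u' \<le> M * G \<longrightarrow> norm v' \<le> M * G \<longrightarrow>
     norm u'' \<le> M * G \<longrightarrow> norm v'' \<le> M * G \<longrightarrow>
     \<bar>bell u v\<bar> \<le> C * G\<^sup>2 \<and> \<bar>bell1 u v u' v'\<bar> \<le> C * G\<^sup>2 \<and> \<bar>bell2 u v u' v' u'' v''\<bar> \<le> C * G\<^sup>2"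
proof -
  obtain C where C: "C \<ge> 0" "\<And>m n. 0 \<le> m \<Longrightarrow> m \<le> M\<^sup>2 \<Longrightarrow> 0 \<le> n \<Longrightarrow> n \<le> M\<^sup>2 \<Longrightarrow>
     \<bar>\<Phi>1 m n\<bar> \<le> C \<and> \<bar>\<Phi>2 m n\<bar> \<le> C \<and> \<bar>\<Phi>11 m n\<bar> \<le> C \<and> \<bar>\<Phi>12 m n\<bar> \<le> C \<and> \<bar>\<Phi>22 m n\<bar> \<le> C"
    using derivatives_bounded[of "M\<^sup>2"] by blast
  obtain C' where C': "C' \<ge> 0" "\<And>m n. 0 \<le> m \<Longrightarrow> m \<le> M\<^sup>2 \<Longrightarrow> 0 \<le> n \<Longrightarrow> n \<le> M\<^sup>2 \<Longrightarrow> \<bar>\<Phi> m n\<bar> \<le> C' * (m + n)"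
    using \<Phi>_bounded[of "M\<^sup>2"] by blast
  define D where "D = 2 * C' * M\<^sup>2 + 4 * C * M\<^sup>2 + 16 * C * M\<^sup>2 * M\<^sup>2 + 8 * C * M\<^sup>2"
  have D0: "0 \<le> 2 * C' * M\<^sup>2" "0 \<le> 4 * C * M\<^sup>2" "0 \<le> 16 * C * M\<^sup>2 * M\<^sup>2"
    using C(1) C'(1) by auto
  have main: "\<bar>bell u v\<bar> \<le> D * G\<^sup>2 \<and> \<bar>bell1 u v u' v'\<bar> \<le> D * G\<^sup>2 \<and> \<bar>bell2 u v u' v' u'' v''\<bar> \<le> D * G\<^sup>2"
    if G: "0 \<le> G" "G \<le> 1" and n: "norm u \<le> M * G" "norm v \<le> M * G" "norm u' \<le> M * G" "norm v' \<le> M * G"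
      "norm u'' \<le> M * G" "norm v'' \<le> M * G"
    for G and u u' u'' :: 'v and v v' v'' :: 'w
  proof -
    define m n where "m = (norm u)\<^sup>2" and "n = (norm v)\<^sup>2"
    have G2: "G\<^sup>2 \<le> 1" using G by (simp add: power_le_one)
    have sq: "(norm x)\<^sup>2 \<le> M\<^sup>2 * G\<^sup>2" if "norm x \<le> M * G" for x :: "'x::real_inner"
      using power_mono[OF that, of 2] by (simp add: power_mult_distrib)
    have MG: "M\<^sup>2 * G\<^sup>2 \<le> M\<^sup>2" using G2 by (simp add: mult_left_le)
    have m: "0 \<le> m" "m \<le> M\<^sup>2 * G\<^sup>2" "m \<le> M\<^sup>2" and nn: "0 \<le> n" "n \<le> M\<^sup>2 * G\<^sup>2" "n \<le> M\<^sup>2"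
      using sq[OF n(1)] sq[OF n(2)] MG by (auto simp: m_def n_def)
    note B = C(2)[OF m(1,3) nn(1,3)]
    have ip: "\<bar>x \<bullet> y\<bar> \<le> M\<^sup>2 * G\<^sup>2" if "norm x \<le> M * G" "norm y \<le> M * G" for x y :: "'x::real_inner"
    proof -
      have "\<bar>x \<bullet> y\<bar> \<le> norm x * norm y" by (rule Cauchy_Schwarz_ineq2)
      also have "\<dots> \<le> (M * G) * (M * G)" using that order_trans[OF norm_ge_zero that(1)] by (intro mult_mono) auto
      finally show ?thesis by (simp add: power2_eq_square algebra_simps)
    qed
    have mul: "\<bar>x * (2 * y)\<bar> \<le> 2 * C * (M\<^sup>2 * G\<^sup>2)" if "\<bar>x\<bar> \<le> C" "\<bar>y\<bar> \<le> M\<^sup>2 * G\<^sup>2" for x y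
      using mult_mono[OF that] C(1) by (simp add: abs_mult)
    have "\<bar>bell u v\<bar> \<le> C' * (m + n)"
      unfolding bell_def m_def[symmetric] n_def[symmetric] using C'(2) m nn by auto
    also have "\<dots> \<le> C' * (M\<^sup>2 * G\<^sup>2 + M\<^sup>2 * G\<^sup>2)" using m nn C'(1) by (intro mult_left_mono add_mono) auto
    also have "\<dots> = (2 * C' * M\<^sup>2) * G\<^sup>2" by (simp add: algebra_simps)
    also have "\<dots> \<le> D * G\<^sup>2" unfolding D_def using D0 by (intro mult_right_mono) auto
    finally have b0: "\<bar>bell u v\<bar> \<le> D * G\<^sup>2" .
    have "\<bar>bell1 u v u' v'\<bar> \<le> 2 * C * (M\<^sup>2 * G\<^sup>2) + 2 * C * (M\<^sup>2 * G\<^sup>2)"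
      unfolding bell1_def m_def[symmetric] n_def[symmetric]
      by (intro order_trans[OF abs_triangle_ineq] add_mono mul) (use B ip n in auto)
    also have "\<dots> = (4 * C * M\<^sup>2) * G\<^sup>2" by (simp add: algebra_simps)
    also have "\<dots> \<le> D * G\<^sup>2" unfolding D_def using D0 by (intro mult_right_mono) auto
    finally have b1: "\<bar>bell1 u v u' v'\<bar> \<le> D * G\<^sup>2" .
    have quad: "\<bar>(x * (2 * y) + x' * (2 * y')) * (2 * y'')\<bar> \<le> (4 * C * (M\<^sup>2 * G\<^sup>2)) * (2 * (M\<^sup>2 * G\<^sup>2))"
      if "\<bar>x\<bar> \<le> C" "\<bar>x'\<bar> \<le> C" "\<bar>y\<bar> \<le> M\<^sup>2 * G\<^sup>2" "\<bar>y'\<bar> \<le> M\<^sup>2 * G\<^sup>2" "\<bar>y''\<bar> \<le> M\<^sup>2 * G\<^sup>2" for x x' y y' y''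
      unfolding abs_mult[of "x * (2 * y) + x' * (2 * y')"]
    proof (rule mult_mono)
      show "\<bar>x * (2 * y) + x' * (2 * y')\<bar> \<le> 4 * C * (M\<^sup>2 * G\<^sup>2)"
        using mul[OF that(1,3)] mul[OF that(2,4)] by linarith
    qed (use that C(1) in auto)
    have "\<bar>bell2 u v u' v' u'' v''\<bar> \<le> (4 * C * (M\<^sup>2 * G\<^sup>2)) * (2 * (M\<^sup>2 * G\<^sup>2)) + (4 * C * (M\<^sup>2 * G\<^sup>2)) * (2 * (M\<^sup>2 * G\<^sup>2))
       + 4 * C * (M\<^sup>2 * G\<^sup>2) + 4 * C * (M\<^sup>2 * G\<^sup>2)"
    proof -
      have lin: "\<bar>x * (2 * ((norm y')\<^sup>2 + y \<bullet> y''))\<bar> \<le> 4 * C * (M\<^sup>2 * G\<^sup>2)"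
        if "\<bar>x\<bar> \<le> C" "norm y \<le> M * G" "norm y' \<le> M * G" "norm y'' \<le> M * G" for x and y y' y'' :: "'x::real_inner"
      proof -
        have "\<bar>x * (2 * ((norm y')\<^sup>2 + y \<bullet> y''))\<bar> \<le> \<bar>x * (2 * (norm y')\<^sup>2)\<bar> + \<bar>x * (2 * (y \<bullet> y''))\<bar>"
          unfolding distrib_left by (rule abs_triangle_ineq)
        also have "\<dots> \<le> 2 * C * (M\<^sup>2 * G\<^sup>2) + 2 * C * (M\<^sup>2 * G\<^sup>2)"
          by (intro add_mono mul that(1)) (use sq[OF that(3)] ip[OF that(2,4)] in auto)
        also have "\<dots> = 4 * C * (M\<^sup>2 * G\<^sup>2)" by simp
        finally show ?thesis .
      qed
      show ?thesis
        unfolding bell2_def m_def[symmetric] n_def[symmetric]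
        by (intro order_trans[OF abs_triangle_ineq] add_mono quad lin) (use B ip n in auto)
    qed
    also have "\<dots> = 16 * C * M\<^sup>2 * M\<^sup>2 * (G\<^sup>2 * G\<^sup>2) + 8 * C * M\<^sup>2 * G\<^sup>2" by (simp add: algebra_simps)
    also have "16 * C * M\<^sup>2 * M\<^sup>2 * (G\<^sup>2 * G\<^sup>2) \<le> 16 * C * M\<^sup>2 * M\<^sup>2 * (1 * G\<^sup>2)"
      using G2 C(1) by (intro mult_left_mono mult_right_mono) auto
    finally have "\<bar>bell2 u v u' v' u'' v''\<bar> \<le> (16 * C * M\<^sup>2 * M\<^sup>2 + 8 * C * M\<^sup>2) * G\<^sup>2"
      by (simp add: algebra_simps)
    also have "\<dots> \<le> D * G\<^sup>2" unfolding D_def using D0 by (intro mult_right_mono) auto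
    finally have b2: "\<bar>bell2 u v u' v' u'' v''\<bar> \<le> D * G\<^sup>2" .
    from b0 b1 b2 show ?thesis by blast
  qed
  have "D \<ge> 0" unfolding D_def using C(1) C'(1) by auto
  then show ?thesis by (intro exI[of _ D] conjI[of "0 \<le> D"] allI impI) (assumption | rule main; assumption)+
qed

end

subsection \<open>Poisson semigroups\<close>

text \<open>
  The semigroup generated by the square root of \<open>- \<Delta> + |x|\<^sup>2 + \<kappa>\<close>, acting on the finite
  Hermite expansion with coefficients \<open>c n\<close>, \<open>n \<in> N\<close>.
\<close>

definition freq :: "real \<Rightarrow> nat ^ 'd \<Rightarrow> real" where
  "freq \<kappa> n = sqrt (2 * real (\<Sum>i\<in>UNIV. n $ i) + real CARD('d) + \<kappa>)"

definition flow :: "real \<Rightarrow> (nat ^ 'd) set \<Rightarrow> (nat ^ 'd \<Rightarrow> 'v::euclidean_space) \<Rightarrow> real ^ 'd::finite \<Rightarrow> real \<Rightarrow> 'v" where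
  "flow \<kappa> N c x t = (\<Sum>n\<in>N. (exp (- t * freq \<kappa> n) * hermite_fun n x) *\<^sub>R c n)"

definition flow_t :: "real \<Rightarrow> (nat ^ 'd) set \<Rightarrow> (nat ^ 'd \<Rightarrow> 'v::euclidean_space) \<Rightarrow> real ^ 'd::finite \<Rightarrow> real \<Rightarrow> 'v" where
  "flow_t \<kappa> N c x t = (\<Sum>n\<in>N. (- freq \<kappa> n * exp (- t * freq \<kappa> n) * hermite_fun n x) *\<^sub>R c n)"

definition flow_tt :: "real \<Rightarrow> (nat ^ 'd) set \<Rightarrow> (nat ^ 'd \<Rightarrow> 'v::euclidean_space) \<Rightarrow> real ^ 'd::finite \<Rightarrow> real \<Rightarrow> 'v" where
  "flow_tt \<kappa> N c x t = (\<Sum>n\<in>N. ((freq \<kappa> n)\<^sup>2 * exp (- t * freq \<kappa> n) * hermite_fun n x) *\<^sub>R c n)"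

definition flow_x :: "'d \<Rightarrow> real \<Rightarrow> (nat ^ 'd) set \<Rightarrow> (nat ^ 'd \<Rightarrow> 'v::euclidean_space) \<Rightarrow> real ^ 'd::finite \<Rightarrow> real \<Rightarrow> 'v" where
  "flow_x i \<kappa> N c x t = (\<Sum>n\<in>N. (exp (- t * freq \<kappa> n) * hermite_dfun i n x) *\<^sub>R c n)"

definition flow_xx :: "'d \<Rightarrow> real \<Rightarrow> (nat ^ 'd) set \<Rightarrow> (nat ^ 'd \<Rightarrow> 'v::euclidean_space) \<Rightarrow> real ^ 'd::finite \<Rightarrow> real \<Rightarrow> 'v" where
  "flow_xx i \<kappa> N c x t = (\<Sum>n\<in>N. (exp (- t * freq \<kappa> n) * (((x $ i)\<^sup>2 - 2 * real (n $ i) - 1) * hermite_fun n x)) *\<^sub>R c n)"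

lemma has_vector_derivative_sum_scaleR:
  assumes "\<And>n. n \<in> N \<Longrightarrow> (w n has_real_derivative w' n) (at s)"
  shows "((\<lambda>s. \<Sum>n\<in>N. w n s *\<^sub>R c n) has_vector_derivative (\<Sum>n\<in>N. w' n *\<^sub>R c n)) (at s)"
  by (rule has_vector_derivative_sum)
     (use has_vector_derivative_scaleR[OF assms has_vector_derivative_const] in auto)

lemma flow_derivs:
  "((\<lambda>t. flow \<kappa> N c x t) has_vector_derivative flow_t \<kappa> N c x t) (at t)"
  "((\<lambda>t. flow_t \<kappa> N c x t) has_vector_derivative flow_tt \<kappa> N c x t) (at t)"
  "((\<lambda>s. flow \<kappa> N c (x + s *\<^sub>R axis i 1) t) has_vector_derivative flow_x i \<kappa> N c (x + s *\<^sub>R axis i 1) t) (at s)"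
  "((\<lambda>s. flow_x i \<kappa> N c (x + s *\<^sub>R axis i 1) t) has_vector_derivative flow_xx i \<kappa> N c (x + s *\<^sub>R axis i 1) t) (at s)"
  unfolding flow_def flow_t_def flow_tt_def flow_x_def flow_xx_def
  by (rule has_vector_derivative_sum_scaleR;
      (intro DERIV_cmult has_real_derivative_hermite_fun has_real_derivative_hermite_dfun
       | auto intro!: derivative_eq_intros simp: power2_eq_square))+

text \<open>By the Hermite equation the second space derivatives multiply mode \<open>n\<close> by
  \<open>|x|^2 - 2 |n| - d\<close>. The squared frequency adds \<open>2 |n| + d + \<kappa>\<close>,
  and \<open>n\<close> drops out.\<close>

lemma flow_pde:
  fixes c :: "nat ^ 'd::finite \<Rightarrow> 'v::euclidean_space"
  assumes "0 \<le> \<kappa>"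
  shows "flow_tt \<kappa> N c x t + (\<Sum>i\<in>UNIV. flow_xx i \<kappa> N c x t) = ((norm x)\<^sup>2 + \<kappa>) *\<^sub>R flow \<kappa> N c x t"
proof -
  have w: "(freq \<kappa> n)\<^sup>2 + (\<Sum>i\<in>UNIV. (x $ i)\<^sup>2 - 2 * real (n $ i) - 1) = (norm x)\<^sup>2 + \<kappa>" for n :: "nat ^ 'd"
  proof -
    have "(freq \<kappa> n)\<^sup>2 = 2 * real (\<Sum>i\<in>UNIV. n $ i) + real CARD('d) + \<kappa>"
      unfolding freq_def using assms by (subst real_sqrt_pow2) (auto intro!: add_nonneg_nonneg sum_nonneg)
    then show ?thesis
      by (simp add: sum_subtractf norm_square_vec sum_distrib_left)
  qed
  have "flow_tt \<kappa> N c x t + (\<Sum>i\<in>UNIV. flow_xx i \<kappa> N c x t)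
    = (\<Sum>n\<in>N. (((freq \<kappa> n)\<^sup>2 + (\<Sum>i\<in>UNIV. (x $ i)\<^sup>2 - 2 * real (n $ i) - 1)) * (exp (- t * freq \<kappa> n) * hermite_fun n x)) *\<^sub>R c n)"
    unfolding flow_tt_def flow_xx_def
  proof (subst sum.swap, unfold sum.distrib[symmetric], rule sum.cong[OF refl])
    fix n
    have "(\<Sum>i\<in>UNIV. (exp (- t * freq \<kappa> n) * (((x $ i)\<^sup>2 - 2 * real (n $ i) - 1) * hermite_fun n x)) *\<^sub>R c n)
      = (\<Sum>i\<in>UNIV. ((x $ i)\<^sup>2 - 2 * real (n $ i) - 1) * (exp (- t * freq \<kappa> n) * hermite_fun n x)) *\<^sub>R c n"
      unfolding scaleR_sum_left by (intro sum.cong) (simp_all add: mult_ac)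
    then show "((freq \<kappa> n)\<^sup>2 * exp (- t * freq \<kappa> n) * hermite_fun n x) *\<^sub>R c n +
        (\<Sum>i\<in>UNIV. (exp (- t * freq \<kappa> n) * (((x $ i)\<^sup>2 - 2 * real (n $ i) - 1) * hermite_fun n x)) *\<^sub>R c n)
      = (((freq \<kappa> n)\<^sup>2 + (\<Sum>i\<in>UNIV. (x $ i)\<^sup>2 - 2 * real (n $ i) - 1)) * (exp (- t * freq \<kappa> n) * hermite_fun n x)) *\<^sub>R c n"
      by (simp only: sum_distrib_right[symmetric] distrib_right scaleR_add_left mult.assoc)
  qed
  also have "\<dots> = ((norm x)\<^sup>2 + \<kappa>) *\<^sub>R flow \<kappa> N c x t"
    unfolding w flow_def by (simp add: scaleR_sum_right)
  finally show ?thesis .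
qed

lemma norm_sum_scaleR_bound:
  assumes "\<And>n. n \<in> N \<Longrightarrow> \<bar>w n\<bar> \<le> C n * G"
  shows "norm (\<Sum>n\<in>N. w n *\<^sub>R c n) \<le> (\<Sum>n\<in>N. C n * norm (c n)) * G"
proof -
  have "norm (\<Sum>n\<in>N. w n *\<^sub>R c n) \<le> (\<Sum>n\<in>N. \<bar>w n\<bar> * norm (c n))"
    by (rule order_trans[OF norm_sum]) simp
  also have "\<dots> \<le> (\<Sum>n\<in>N. (C n * G) * norm (c n))"
    by (intro sum_mono mult_right_mono assms) auto
  also have "\<dots> = (\<Sum>n\<in>N. C n * norm (c n)) * G"
    unfolding sum_distrib_right by (intro sum.cong) (simp_all add: mult_ac)
  finally show ?thesis .
qed

text \<open>Times down to -1 are included so that 0 is an interior point when the integrals over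
  space are differentiated in \<open>t\<close>.\<close>

lemma flow_bounds:
  fixes c :: "nat ^ 'd::finite \<Rightarrow> 'v::euclidean_space"
  assumes "0 \<le> \<kappa>"
  shows "\<exists>M\<ge>0. \<forall>x t. - 1 \<le> t \<longrightarrow>
    norm (flow \<kappa> N c x t) \<le> M * gauss x \<and> norm (flow_t \<kappa> N c x t) \<le> M * gauss x
    \<and> norm (flow_tt \<kappa> N c x t) \<le> M * gauss x
    \<and> (\<forall>i. norm (flow_x i \<kappa> N c x t) \<le> M * gauss x \<and> norm (flow_xx i \<kappa> N c x t) \<le> M * gauss x)"
proof -
  have "\<forall>n :: nat ^ 'd. \<exists>C. 0 \<le> C \<and> (\<forall>x. \<bar>hermite_fun n x\<bar> \<le> C * gauss x \<and> (\<forall>i. \<bar>hermite_dfun i n x\<bar> \<le> C * gauss x)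
     \<and> (\<forall>i. \<bar>((x $ i)\<^sup>2 - 2 * real (n $ i) - 1) * hermite_fun n x\<bar> \<le> C * gauss x))"
    using hermite_fun_gauss_bounds by blast
  from choice[OF this] obtain C where C: "\<And>n :: nat ^ 'd. 0 \<le> C n"
    "\<And>n x. \<bar>hermite_fun n x\<bar> \<le> C n * gauss x" "\<And>n x i. \<bar>hermite_dfun i n x\<bar> \<le> C n * gauss x"
    "\<And>n x i. \<bar>((x $ i)\<^sup>2 - 2 * real (n $ i) - 1) * hermite_fun n x\<bar> \<le> C n * gauss x" by blast
  define E where "E n = exp \<bar>freq \<kappa> n\<bar>" for n :: "nat ^ 'd"
  have E: "0 < E n" "\<bar>freq \<kappa> n\<bar> \<le> E n" for n
    using exp_ge_add_one_self[of "\<bar>freq \<kappa> n\<bar>"] by (simp_all add: E_def, linarith)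
  define D where "D n = (1 + E n + (E n)\<^sup>2) * E n * C n" for n
  define M where "M = (\<Sum>n\<in>N. D n * norm (c n))"
  have main: "\<bar>exp (- t * freq \<kappa> n)\<bar> \<le> (1 + E n + (E n)\<^sup>2) * E n"
     "\<bar>- freq \<kappa> n * exp (- t * freq \<kappa> n)\<bar> \<le> (1 + E n + (E n)\<^sup>2) * E n"
     "\<bar>(freq \<kappa> n)\<^sup>2 * exp (- t * freq \<kappa> n)\<bar> \<le> (1 + E n + (E n)\<^sup>2) * E n"
    if t: "- 1 \<le> t" for t n
  proof -
    have f: "0 \<le> freq \<kappa> n" using assms unfolding freq_def
      by (intro real_sqrt_ge_zero add_nonneg_nonneg) (auto intro: sum_nonneg)
    have e: "exp (- t * freq \<kappa> n) \<le> E n"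
      using mult_right_mono[OF t f] f by (simp add: E_def)
    have "1 * exp (- t * freq \<kappa> n) \<le> (1 + E n + (E n)\<^sup>2) * E n"
      using e E[of n] by (intro mult_mono) auto
    then show "\<bar>exp (- t * freq \<kappa> n)\<bar> \<le> (1 + E n + (E n)\<^sup>2) * E n" by simp
    have "\<bar>freq \<kappa> n\<bar> \<le> 1 + E n + (E n)\<^sup>2"
      using E(2)[of n] zero_le_power2[of "E n"] by linarith
    then have "\<bar>freq \<kappa> n\<bar> * exp (- t * freq \<kappa> n) \<le> (1 + E n + (E n)\<^sup>2) * E n"
      using e E[of n] by (intro mult_mono) auto
    then show "\<bar>- freq \<kappa> n * exp (- t * freq \<kappa> n)\<bar> \<le> (1 + E n + (E n)\<^sup>2) * E n" by (simp add: abs_mult)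
    have "(freq \<kappa> n)\<^sup>2 \<le> (E n)\<^sup>2" using E[of n] by (intro power2_le_iff_abs_le[THEN iffD2]) auto
    then have "(freq \<kappa> n)\<^sup>2 * exp (- t * freq \<kappa> n) \<le> (1 + E n + (E n)\<^sup>2) * E n"
      using e E[of n] by (intro mult_mono) auto
    then show "\<bar>(freq \<kappa> n)\<^sup>2 * exp (- t * freq \<kappa> n)\<bar> \<le> (1 + E n + (E n)\<^sup>2) * E n" by (simp add: abs_mult)
  qed
  have bound: "norm (\<Sum>n\<in>N. (a n * b n) *\<^sub>R c n) \<le> M * gauss x"
    if "\<And>n. \<bar>a n\<bar> \<le> (1 + E n + (E n)\<^sup>2) * E n" "\<And>n. \<bar>b n\<bar> \<le> C n * gauss x" for a b and x :: "real ^ 'd"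
    unfolding M_def
  proof (rule norm_sum_scaleR_bound)
    fix n
    have "\<bar>a n * b n\<bar> \<le> ((1 + E n + (E n)\<^sup>2) * E n) * (C n * gauss x)"
      unfolding abs_mult using that[of n] by (intro mult_mono) auto
    then show "\<bar>a n * b n\<bar> \<le> D n * gauss x" by (simp add: D_def)
  qed
  have "0 \<le> D n" for n
    unfolding D_def using C(1)[of n] E(1)[of n] by simp
  then have "0 \<le> M" unfolding M_def by (intro sum_nonneg) auto
  then show ?thesis
    unfolding flow_def flow_t_def flow_tt_def flow_x_def flow_xx_def
    by (intro exI[of _ M] conjI[of "0 \<le> M"] allI impI) (assumption | intro conjI allI bound main C(2-4); assumption)+
qed

text \<open>A positive slope anywhere would by convexity force linear growth against the upper
  bound, so \<open>G\<close> decreases. Then \<open>G 0\<close> lies above all later values, hence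
  above those of the minorant \<open>k\<close>, which tend to 0.\<close>

lemma convex_bounded_nonneg:
  fixes G G' G'' k :: "real \<Rightarrow> real"
  assumes G: "\<And>t. 0 \<le> t \<Longrightarrow> (G has_real_derivative G' t) (at t)"
    and G': "\<And>t. 0 \<le> t \<Longrightarrow> (G' has_real_derivative G'' t) (at t)"
    and G'': "\<And>t. 0 \<le> t \<Longrightarrow> 0 \<le> G'' t"
    and bound: "\<And>t. 0 \<le> t \<Longrightarrow> G t \<le> B"
    and k: "\<And>t. 0 \<le> t \<Longrightarrow> k t \<le> G t" "(k \<longlongrightarrow> 0) at_top"
  shows "0 \<le> G 0"
proof -
  have mono: "G' s \<le> G' t" if "0 \<le> s" "s \<le> t" for s t
    by (rule DERIV_nonneg_imp_nondecreasing[OF that(2)]) (meson G' G'' that(1) order_trans)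
  have neg: "G' s \<le> 0" if s: "0 \<le> s" for s
  proof (rule ccontr)
    assume "\<not> G' s \<le> 0"
    then have pos: "0 < G' s" by simp
    have lin: "G s + G' s * r \<le> G (s + r)" if "0 \<le> r" for r
    proof -
      have "G s - G' s * (s - s) \<le> G (s + r) - G' s * ((s + r) - s)"
        by (rule DERIV_nonneg_imp_nondecreasing[where f = "\<lambda>t. G t - G' s * (t - s)"])
           (use that s mono in \<open>auto intro!: exI[of _ "G' _ - G' s"] derivative_eq_intros G\<close>)
      then show ?thesis by simp
    qed
    define r where "r = (\<bar>B - G s\<bar> + 1) / G' s"
    have "0 \<le> r" using pos by (simp add: r_def)
    moreover have "G' s * r = \<bar>B - G s\<bar> + 1" using pos by (simp add: r_def)
    ultimately have "G s + (\<bar>B - G s\<bar> + 1) \<le> B" using lin[of r] bound[of "s + r"] s by auto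
    then show False by linarith
  qed
  have dec: "G t \<le> G 0" if "0 \<le> t" for t
    by (rule DERIV_nonpos_imp_nonincreasing[OF that]) (use G neg in force)
  have "\<forall>\<^sub>F t in at_top. k t \<le> G 0"
    using eventually_ge_at_top[of "0::real"] by eventually_elim (use k(1) dec in force)
  then show ?thesis using k(2) by (intro tendsto_upperbound[of k 0 at_top]) auto
qed

text \<open>The energy density of the operator. The potential term belongs to it because
  \<open>- \<partial>\<^sub>i u + x\<^sub>i u\<close> is controlled by the derivative and by
  \<open>|x| |u|\<close> together.\<close>

definition grad_sq :: "real \<Rightarrow> (nat ^ 'd) set \<Rightarrow> (nat ^ 'd \<Rightarrow> 'v::euclidean_space) \<Rightarrow> real ^ 'd::finite \<Rightarrow> real \<Rightarrow> real" where
  "grad_sq \<kappa> N c x t = (norm (flow_t \<kappa> N c x t))\<^sup>2 + (\<Sum>i\<in>UNIV. (norm (flow_x i \<kappa> N c x t))\<^sup>2)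
     + (norm x)\<^sup>2 * (norm (flow \<kappa> N c x t))\<^sup>2"

lemma grad_sq_nonneg: "0 \<le> grad_sq \<kappa> N c x t"
  unfolding grad_sq_def by (intro add_nonneg_nonneg sum_nonneg mult_nonneg_nonneg) auto

lemma borel_measurable_flow [measurable]: "(\<lambda>x. flow \<kappa> N c x t) \<in> borel_measurable borel"
  unfolding flow_def by (intro borel_measurable_sum borel_measurable_scaleR borel_measurable_times) auto

context bellman
begin

text \<open>Summed over time and all coordinates, the acceleration terms become
  \<open>|x|^2 + \<kappa>\<close> times the squared norms of the flows. They enter with a good sign,
  and the part with \<open>|x|^2\<close> supplies the potential term of
  \<open>grad_sq\<close>.\<close>

lemma bell_subharmonic:
  fixes c :: "nat ^ 'd::finite \<Rightarrow> 'v::euclidean_space" and c' :: "nat ^ 'd \<Rightarrow> 'w::euclidean_space"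
  assumes \<kappa>: "0 \<le> \<kappa>" "0 \<le> \<kappa>'"
  shows "4 * (sqrt (grad_sq \<kappa> N c x t) * sqrt (grad_sq \<kappa>' N' c' x t)) \<le>
    bell2 (flow \<kappa> N c x t) (flow \<kappa>' N' c' x t) (flow_t \<kappa> N c x t) (flow_t \<kappa>' N' c' x t) (flow_tt \<kappa> N c x t) (flow_tt \<kappa>' N' c' x t)
    + (\<Sum>i\<in>UNIV. bell2 (flow \<kappa> N c x t) (flow \<kappa>' N' c' x t) (flow_x i \<kappa> N c x t) (flow_x i \<kappa>' N' c' x t) (flow_xx i \<kappa> N c x t) (flow_xx i \<kappa>' N' c' x t))"
proof -
  define u v where "u = flow \<kappa> N c" and "v = flow \<kappa>' N' c'"
  define m n where "m = (norm (u x t))\<^sup>2" and "n = (norm (v x t))\<^sup>2"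
  have mn: "0 \<le> m" "0 \<le> n" by (auto simp: m_def n_def)
  define z where "z = wt n"
  have z: "0 < z" unfolding z_def by (rule wt_pos[OF mn])
  define A A' where "A = \<Phi>1 m n" and "A' = \<Phi>2 m n"
  have A: "z \<le> A" "4 / z \<le> A'" unfolding A_def A'_def z_def using \<Phi>1_lower[OF mn] \<Phi>2_lower[OF mn] by auto
  have A0: "0 \<le> A" "0 \<le> A'" using A z by (auto intro: order_trans[rotated])
  note L = bell2_lower[of "v x t" _ _ "u x t", folded m_def n_def, folded z_def A_def A'_def]
  let ?T = "bell2 (u x t) (v x t) (flow_t \<kappa> N c x t) (flow_t \<kappa>' N' c' x t) (flow_tt \<kappa> N c x t) (flow_tt \<kappa>' N' c' x t)"
  let ?X = "\<lambda>i. bell2 (u x t) (v x t) (flow_x i \<kappa> N c x t) (flow_x i \<kappa>' N' c' x t) (flow_xx i \<kappa> N c x t) (flow_xx i \<kappa>' N' c' x t)"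
  have "z * (norm (flow_t \<kappa> N c x t))\<^sup>2 + 4 / z * (norm (flow_t \<kappa>' N' c' x t))\<^sup>2
      + (\<Sum>i\<in>UNIV. z * (norm (flow_x i \<kappa> N c x t))\<^sup>2 + 4 / z * (norm (flow_x i \<kappa>' N' c' x t))\<^sup>2)
    \<le> (?T - 2 * A * (u x t \<bullet> flow_tt \<kappa> N c x t) - 2 * A' * (v x t \<bullet> flow_tt \<kappa>' N' c' x t))
      + (\<Sum>i\<in>UNIV. ?X i - 2 * A * (u x t \<bullet> flow_xx i \<kappa> N c x t) - 2 * A' * (v x t \<bullet> flow_xx i \<kappa>' N' c' x t))"
    by (intro add_mono sum_mono L)
  also have "\<dots> = ?T + (\<Sum>i\<in>UNIV. ?X i)
      - 2 * A * (u x t \<bullet> (flow_tt \<kappa> N c x t + (\<Sum>i\<in>UNIV. flow_xx i \<kappa> N c x t)))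
      - 2 * A' * (v x t \<bullet> (flow_tt \<kappa>' N' c' x t + (\<Sum>i\<in>UNIV. flow_xx i \<kappa>' N' c' x t)))"
    by (simp add: sum_subtractf sum.distrib inner_add_right inner_sum_right sum_distrib_left algebra_simps)
  also have "\<dots> = ?T + (\<Sum>i\<in>UNIV. ?X i) - 2 * A * (((norm x)\<^sup>2 + \<kappa>) * m) - 2 * A' * (((norm x)\<^sup>2 + \<kappa>') * n)"
    unfolding flow_pde[OF \<kappa>(1)] flow_pde[OF \<kappa>(2)] u_def[symmetric] v_def[symmetric] m_def n_def
    by (simp add: power2_norm_eq_inner)
  finally have 1: "z * (norm (flow_t \<kappa> N c x t))\<^sup>2 + 4 / z * (norm (flow_t \<kappa>' N' c' x t))\<^sup>2
      + (\<Sum>i\<in>UNIV. z * (norm (flow_x i \<kappa> N c x t))\<^sup>2 + 4 / z * (norm (flow_x i \<kappa>' N' c' x t))\<^sup>2)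
      + 2 * A * (((norm x)\<^sup>2 + \<kappa>) * m) + 2 * A' * (((norm x)\<^sup>2 + \<kappa>') * n) \<le> ?T + (\<Sum>i\<in>UNIV. ?X i)"
    by linarith
  have 2: "z * ((norm x)\<^sup>2 * m) \<le> 2 * A * (((norm x)\<^sup>2 + \<kappa>) * m)"
    by (rule mult_mono) (use A(1) A0 mn \<kappa> in \<open>auto intro!: mult_right_mono\<close>)
  have 3: "4 / z * ((norm x)\<^sup>2 * n) \<le> 2 * A' * (((norm x)\<^sup>2 + \<kappa>') * n)"
    by (rule mult_mono) (use A(2) A0 mn \<kappa> in \<open>auto intro!: mult_right_mono\<close>)
  let ?U = "grad_sq \<kappa> N c x t" and ?V = "grad_sq \<kappa>' N' c' x t"
  have 4: "z * ?U + 4 / z * ?V \<le> ?T + (\<Sum>i\<in>UNIV. ?X i)"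
  proof -
    have "z * ?U + 4 / z * ?V = z * (norm (flow_t \<kappa> N c x t))\<^sup>2 + 4 / z * (norm (flow_t \<kappa>' N' c' x t))\<^sup>2
      + (\<Sum>i\<in>UNIV. z * (norm (flow_x i \<kappa> N c x t))\<^sup>2 + 4 / z * (norm (flow_x i \<kappa>' N' c' x t))\<^sup>2)
      + z * ((norm x)\<^sup>2 * m) + 4 / z * ((norm x)\<^sup>2 * n)"
      unfolding grad_sq_def m_def n_def u_def v_def sum.distrib sum_distrib_left[symmetric] by (simp only: distrib_left add_ac)
    with 1 2 3 show ?thesis by linarith
  qed
  have "0 \<le> (z * sqrt ?U - 2 * sqrt ?V)\<^sup>2 / z" using z by simp
  also have "\<dots> = z * (sqrt ?U)\<^sup>2 + 4 / z * (sqrt ?V)\<^sup>2 - 4 * (sqrt ?U * sqrt ?V)"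
  proof -
    have "(z * p - 2 * q)\<^sup>2 / z = z * p\<^sup>2 + 4 / z * q\<^sup>2 - 4 * (p * q)" for p q
      using z by (simp add: field_simps power2_eq_square)
    then show ?thesis .
  qed
  also have "\<dots> = z * ?U + 4 / z * ?V - 4 * (sqrt ?U * sqrt ?V)"
    by (simp add: grad_sq_nonneg)
  finally show ?thesis using 4 unfolding u_def v_def by linarith
qed

text \<open>The density \<open>\<iota>\<close> is abstract because the two flows enter the Bellman
  function in either order. Integrating \<open>bell_subharmonic\<close> over space removes the pure
  second space derivatives, whose integrals vanish, and leaves a second derivative in time that is
  at least twice the integral of \<open>\<iota>\<close>.\<close>

lemma bell_energy:
  fixes c :: "nat ^ 'd::finite \<Rightarrow> 'v::euclidean_space" and c' :: "nat ^ 'd \<Rightarrow> 'w::euclidean_space"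
    and \<iota> :: "real ^ 'd \<Rightarrow> real \<Rightarrow> real"
  assumes \<kappa>: "0 \<le> \<kappa>" "0 \<le> \<kappa>'"
    and \<iota>: "\<And>t. 0 \<le> t \<Longrightarrow> integrable lborel (\<lambda>x. \<iota> x t)"
      "\<And>x t. 2 * \<iota> x t \<le> 4 * (sqrt (grad_sq \<kappa> N c x t) * sqrt (grad_sq \<kappa>' N' c' x t))"
    and J: "\<And>t. (J has_real_derivative J' t) (at t)" "\<And>t. (J' has_real_derivative (LINT x|lborel. \<iota> x t)) (at t)"
      "\<And>t. 0 \<le> t \<Longrightarrow> \<bar>J t\<bar> \<le> B" "(J \<longlongrightarrow> 0) at_top"
  shows "integrable lborel (\<lambda>x. bell (flow \<kappa> N c x 0) (flow \<kappa>' N' c' x 0))"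
    and "2 * J 0 \<le> (LINT x|lborel. bell (flow \<kappa> N c x 0) (flow \<kappa>' N' c' x 0))"
proof -
  obtain M1 where M1: "0 \<le> M1" "\<And>x t. - 1 \<le> t \<Longrightarrow>
    norm (flow \<kappa> N c x t) \<le> M1 * gauss x \<and> norm (flow_t \<kappa> N c x t) \<le> M1 * gauss x
    \<and> norm (flow_tt \<kappa> N c x t) \<le> M1 * gauss x
    \<and> (\<forall>i. norm (flow_x i \<kappa> N c x t) \<le> M1 * gauss x \<and> norm (flow_xx i \<kappa> N c x t) \<le> M1 * gauss x)"
    using flow_bounds[OF \<kappa>(1), of N c] by blast
  obtain M2 where M2: "0 \<le> M2" "\<And>x t. - 1 \<le> t \<Longrightarrow>
    norm (flow \<kappa>' N' c' x t) \<le> M2 * gauss x \<and> norm (flow_t \<kappa>' N' c' x t) \<le> M2 * gauss x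
    \<and> norm (flow_tt \<kappa>' N' c' x t) \<le> M2 * gauss x
    \<and> (\<forall>i. norm (flow_x i \<kappa>' N' c' x t) \<le> M2 * gauss x \<and> norm (flow_xx i \<kappa>' N' c' x t) \<le> M2 * gauss x)"
    using flow_bounds[OF \<kappa>(2), of N' c'] by blast
  define M where "M = M1 + M2"
  have le: "M1 * gauss x \<le> M * gauss x" "M2 * gauss x \<le> M * gauss x" for x :: "real ^ 'd"
    using M1(1) M2(1) by (auto simp: M_def intro: mult_right_mono)
  obtain C where C: "0 \<le> C" "\<And>G (u::'v) (v::'w) u' v' u'' v''. 0 \<le> G \<Longrightarrow> G \<le> 1 \<Longrightarrow>
     norm u \<le> M * G \<Longrightarrow> norm v \<le> M * G \<Longrightarrow> norm u' \<le> M * G \<Longrightarrow> norm v' \<le> M * G \<Longrightarrow>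
     norm u'' \<le> M * G \<Longrightarrow> norm v'' \<le> M * G \<Longrightarrow>
     \<bar>bell u v\<bar> \<le> C * G\<^sup>2 \<and> \<bar>bell1 u v u' v'\<bar> \<le> C * G\<^sup>2 \<and> \<bar>bell2 u v u' v' u'' v''\<bar> \<le> C * G\<^sup>2"
    using bell_bounds[of M, where ?'v='v and ?'w='w] by blast
  define b where "b t x = bell (flow \<kappa> N c x t) (flow \<kappa>' N' c' x t)" for t x
  define bt where "bt t x = bell1 (flow \<kappa> N c x t) (flow \<kappa>' N' c' x t) (flow_t \<kappa> N c x t) (flow_t \<kappa>' N' c' x t)" for t x
  define btt where "btt t x = bell2 (flow \<kappa> N c x t) (flow \<kappa>' N' c' x t) (flow_t \<kappa> N c x t) (flow_t \<kappa>' N' c' x t)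
     (flow_tt \<kappa> N c x t) (flow_tt \<kappa>' N' c' x t)" for t x
  define bx where "bx i t x = bell1 (flow \<kappa> N c x t) (flow \<kappa>' N' c' x t) (flow_x i \<kappa> N c x t) (flow_x i \<kappa>' N' c' x t)" for i t x
  define bxx where "bxx i t x = bell2 (flow \<kappa> N c x t) (flow \<kappa>' N' c' x t) (flow_x i \<kappa> N c x t) (flow_x i \<kappa>' N' c' x t)
     (flow_xx i \<kappa> N c x t) (flow_xx i \<kappa>' N' c' x t)" for i t x
  define w where "w x = C * gauss x" for x :: "real ^ 'd"
  have sq: "(gauss x)\<^sup>2 \<le> gauss x" for x :: "real ^ 'd"
    using mult_right_mono[OF gauss_le_1[of x], of "gauss x"] by (simp add: power2_eq_square)
  have Cw: "y \<le> C * (gauss x)\<^sup>2 \<Longrightarrow> y \<le> w x" for x y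
    using mult_left_mono[OF sq C(1), of x] by (simp add: w_def)
  have w_int: "integrable lborel w" unfolding w_def[abs_def] by (simp add: integrable_gauss)
  have bd: "\<bar>b t x\<bar> \<le> C * (gauss x)\<^sup>2" "\<bar>bt t x\<bar> \<le> C * (gauss x)\<^sup>2" "\<bar>btt t x\<bar> \<le> C * (gauss x)\<^sup>2"
    "\<bar>bx i t x\<bar> \<le> C * (gauss x)\<^sup>2" "\<bar>bxx i t x\<bar> \<le> C * (gauss x)\<^sup>2" if t: "- 1 \<le> t" for t x i
  proof -
    note m = M1(2)[OF t, of x] M2(2)[OF t, of x]
    have n: "norm (flow \<kappa> N c x t) \<le> M * gauss x" "norm (flow \<kappa>' N' c' x t) \<le> M * gauss x"
      "norm (flow_t \<kappa> N c x t) \<le> M * gauss x" "norm (flow_t \<kappa>' N' c' x t) \<le> M * gauss x"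
      "norm (flow_tt \<kappa> N c x t) \<le> M * gauss x" "norm (flow_tt \<kappa>' N' c' x t) \<le> M * gauss x"
      "norm (flow_x i \<kappa> N c x t) \<le> M * gauss x" "norm (flow_x i \<kappa>' N' c' x t) \<le> M * gauss x"
      "norm (flow_xx i \<kappa> N c x t) \<le> M * gauss x" "norm (flow_xx i \<kappa>' N' c' x t) \<le> M * gauss x"
      by (rule order_trans[OF _ le(1)] order_trans[OF _ le(2)]; use m in blast)+
    show "\<bar>b t x\<bar> \<le> C * (gauss x)\<^sup>2" "\<bar>bt t x\<bar> \<le> C * (gauss x)\<^sup>2" "\<bar>btt t x\<bar> \<le> C * (gauss x)\<^sup>2"
      unfolding b_def bt_def btt_def using C(2)[OF gauss_pos(2) gauss_le_1 n(1-6)] by auto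
    show "\<bar>bx i t x\<bar> \<le> C * (gauss x)\<^sup>2" "\<bar>bxx i t x\<bar> \<le> C * (gauss x)\<^sup>2"
      unfolding bx_def bxx_def using C(2)[OF gauss_pos(2) gauss_le_1 n(1,2,7-10)] by auto
  qed
  have b_meas: "b t \<in> borel_measurable borel" for t
    unfolding b_def[abs_def] bell_def \<Phi>_def \<rho>_def by measurable
  have b_int: "integrable lborel (b t)" if "- 1 \<le> t" for t
    by (rule Bochner_Integration.integrable_bound[OF w_int])
       (use b_meas Cw[OF bd(1)[OF that]] in \<open>auto intro!: AE_I2 order_trans[OF _ abs_ge_self]\<close>)
  have S: "open {-1::real<..}" "convex {-1::real<..}" by (auto intro: convex_real_interval)
  have d1: "((\<lambda>t. b t x) has_real_derivative bt t x) (at t)" for t x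
    unfolding b_def bt_def by (intro bell_deriv flow_derivs)
  have d2: "((\<lambda>t. bt t x) has_real_derivative btt t x) (at t)" for t x
    unfolding bt_def btt_def by (intro bell1_deriv flow_derivs)
  have d3: "((\<lambda>s. b t (x + s *\<^sub>R axis i 1)) has_real_derivative bx i t (x + s *\<^sub>R axis i 1)) (at s)" for i t x s
    unfolding b_def bx_def by (intro bell_deriv flow_derivs)
  have d4: "((\<lambda>s. bx i t (x + s *\<^sub>R axis i 1)) has_real_derivative bxx i t (x + s *\<^sub>R axis i 1)) (at s)" for i t x s
    unfolding bx_def bxx_def by (intro bell1_deriv flow_derivs)
  have F1: "integrable lborel (bt t)" "((\<lambda>t. LINT x|lborel. b t x) has_real_derivative (LINT x|lborel. bt t x)) (at t)"
    if "- 1 < t" for t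
    using has_real_derivative_integral[OF S, of t lborel b bt w] that b_int d1 w_int Cw[OF bd(2)] by auto
  have F2: "integrable lborel (btt t)" "((\<lambda>t. LINT x|lborel. bt t x) has_real_derivative (LINT x|lborel. btt t x)) (at t)"
    if "- 1 < t" for t
    using has_real_derivative_integral[OF S, of t lborel bt btt w] that F1(1) d2 w_int Cw[OF bd(3)] by auto
  \<comment> \<open>The space derivatives are integrated along \<open>x + s e\<close>, so they need
    a majorant that is also valid at the shifted points.\<close>
  define w' where "w' x = C * (exp (1 / 2) * gauss x)" for x :: "real ^ 'd"
  have w'_int: "integrable lborel w'" unfolding w'_def[abs_def] by (simp add: integrable_gauss)
  have w': "C * (gauss (x + s *\<^sub>R axis i 1))\<^sup>2 \<le> w' x" if "\<bar>s\<bar> < 1" for x s i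
    unfolding w'_def by (intro mult_left_mono gauss_translate C(1)) (use that in auto)
  have X1: "integrable lborel (bx i t)" if "- 1 < t" for i t
  proof (rule integral_directional_derivative_eq_0(1)[OF b_int d3 w'_int])
    show "- 1 \<le> t" using that by simp
    then show "\<bar>bx i t (x + s *\<^sub>R axis i 1)\<bar> \<le> w' x" if "\<bar>s\<bar> < 1" for x s
      using order_trans[OF bd(4) w'[OF that]] by simp
  qed
  have X2: "integrable lborel (bxx i t)" "(LINT x|lborel. bxx i t x) = 0" if "- 1 < t" for i t
    using integral_directional_derivative_eq_0[OF X1 d4 w'_int, of t i] order_trans[OF bd(5) w'] that by auto
  have lower: "(LINT x|lborel. 2 * \<iota> x t) \<le> (LINT x|lborel. btt t x)" if t: "0 \<le> t" for t
  proof -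
    have t1: "- 1 < t" using t by simp
    have "(LINT x|lborel. 2 * \<iota> x t) \<le> (LINT x|lborel. btt t x + (\<Sum>i\<in>UNIV. bxx i t x))"
    proof (rule integral_mono)
      show "2 * \<iota> x t \<le> btt t x + (\<Sum>i\<in>UNIV. bxx i t x)" for x
        unfolding btt_def bxx_def by (rule order_trans[OF \<iota>(2) bell_subharmonic[OF \<kappa>]])
    qed (use \<iota>(1)[OF t] F2(1)[OF t1] X2(1)[OF t1] in auto)
    also have "\<dots> = (LINT x|lborel. btt t x) + (\<Sum>i\<in>UNIV. LINT x|lborel. bxx i t x)"
      using F2(1)[OF t1] X2(1)[OF t1] by (simp add: Bochner_Integration.integral_sum)
    finally show ?thesis using X2(2)[OF t1] by simp
  qed
  show "integrable lborel (\<lambda>x. bell (flow \<kappa> N c x 0) (flow \<kappa>' N' c' x 0))"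
    using b_int[of 0] by (simp add: b_def[abs_def])
  define F where "F t = (LINT x|lborel. b t x)" for t
  have F_nn: "0 \<le> F t" for t
    unfolding F_def by (rule integral_nonneg_AE) (auto simp: b_def bell_def intro!: \<Phi>_nonneg)
  have F_bd: "F t \<le> (LINT x|lborel. w x)" if "0 \<le> t" for t
    unfolding F_def by (rule integral_mono[OF b_int w_int]) (use that abs_le_D1[OF Cw[OF bd(1)]] in auto)
  have "0 \<le> F 0 - 2 * J 0"
  proof (rule convex_bounded_nonneg[where G = "\<lambda>t. F t - 2 * J t" and k = "\<lambda>t. - 2 * J t" and B = "(LINT x|lborel. w x) + 2 * B"])
    fix t :: real assume t: "0 \<le> t"
    show "((\<lambda>t. F t - 2 * J t) has_real_derivative ((LINT x|lborel. bt t x) - 2 * J' t)) (at t)"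
      unfolding F_def using t by (intro DERIV_diff DERIV_cmult J F1) auto
    show "((\<lambda>t. (LINT x|lborel. bt t x) - 2 * J' t) has_real_derivative ((LINT x|lborel. btt t x) - 2 * (LINT x|lborel. \<iota> x t))) (at t)"
      using t by (intro DERIV_diff DERIV_cmult J F2) auto
    show "0 \<le> (LINT x|lborel. btt t x) - 2 * (LINT x|lborel. \<iota> x t)"
      using lower[OF t] by simp
    show "F t - 2 * J t \<le> (LINT x|lborel. w x) + 2 * B" using F_bd[OF t] J(3)[OF t] by linarith
    show "- 2 * J t \<le> F t - 2 * J t" using F_nn[of t] by simp
  next
    show "((\<lambda>t. - 2 * J t) \<longlongrightarrow> 0) at_top" using tendsto_mult_right_zero[OF J(4), of "-2"] by simp
  qed
  then show "2 * J 0 \<le> (LINT x|lborel. bell (flow \<kappa> N c x 0) (flow \<kappa>' N' c' x 0))"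
    by (simp add: F_def b_def)
qed

end

subsection \<open>The bilinear estimate\<close>

lemma integrable_norm_powr_gauss:
  fixes F :: "real ^ 'd::finite \<Rightarrow> 'v::euclidean_space"
  assumes [measurable]: "F \<in> borel_measurable borel" and F: "\<And>x. norm (F x) \<le> M * gauss x" and p: "0 < p"
  shows "integrable lborel (\<lambda>x. norm (F x) powr p)"
proof -
  have M: "0 \<le> M"
    using order_trans[OF norm_ge_zero F] gauss_pos(1) by (metis linorder_not_le mult_less_0_iff less_le_not_le)
  have "integrable lborel (\<lambda>x::real^'d. M powr p * exp (- (p / 4) * (norm x)\<^sup>2))"
    by (intro integrable_mult_right integrable_exp_neg_norm_square) (use p in simp)
  then show ?thesis
  proof (rule Bochner_Integration.integrable_bound)
    have "norm (F x) powr p \<le> M powr p * exp (- (p / 4) * (norm x)\<^sup>2)" for x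
    proof -
      have "norm (F x) powr p \<le> (M * gauss x) powr p" using F p by (intro powr_mono2) auto
      also have "\<dots> = M powr p * exp (- (p / 4) * (norm x)\<^sup>2)"
        using M by (simp add: powr_mult gauss_def exp_powr_real)
      finally show ?thesis .
    qed
    then show "AE x in lborel. norm (norm (F x) powr p) \<le> norm (M powr p * exp (- (p / 4) * (norm x)\<^sup>2))"
      by (intro AE_I2) (simp add: abs_mult)
  qed measurable
qed

text \<open>For \<open>0 \<le> x \<le> a + b\<close> the ratio \<open>x / (a + b)\<close> is at most
  its own power with exponent \<open>s\<close>; this is added up for \<open>x = a\<close> and
  \<open>x = b\<close>.\<close>

lemma powr_add_le_add_powr:
  fixes a b s :: real
  assumes "0 \<le> a" "0 < b" "0 \<le> s" "s \<le> 1"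
  shows "(a + b) powr s \<le> a powr s + b powr s"
proof -
  have *: "x / (a + b) * (a + b) powr s \<le> x powr s" if "0 \<le> x" "x \<le> a + b" for x
  proof -
    have ab: "0 < a + b" using assms by simp
    have "x / (a + b) = (x / (a + b)) powr 1" using that ab by simp
    also have "\<dots> \<le> (x / (a + b)) powr s"
      using that ab assms by (intro powr_mono') auto
    also have "\<dots> = x powr s / (a + b) powr s" using that ab by (simp add: powr_divide)
    finally show ?thesis using ab by (simp add: field_simps)
  qed
  have "a / (a + b) + b / (a + b) = 1" using assms by (simp flip: add_divide_distrib)
  then have "(a + b) powr s = (a / (a + b) + b / (a + b)) * (a + b) powr s" by simp
  also have "\<dots> = a / (a + b) * (a + b) powr s + b / (a + b) * (a + b) powr s" by (rule distrib_right)
  also have "\<dots> \<le> a powr s + b powr s" using assms by (intro add_mono *) auto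
  finally show ?thesis .
qed

text \<open>Subadditivity of the power with exponent \<open>q / 2 \<le> 1\<close> bounds the second
  summand of the Bellman function by \<open>8 * P * norm (G x) powr q\<close> for every
  \<open>e\<close>, so only the first summand passes through dominated convergence. At
  \<open>e = 0\<close> the square of \<open>norm (F x)\<close> is at most
  \<open>r 0 x powr (2 / P)\<close>, so that summand is at most \<open>r 0 x\<close>, the sum of the
  two powers. This gives the coefficients 1 and \<open>8 * P + 1\<close>.\<close>

lemma bell_limit:
  fixes F :: "real ^ 'd::finite \<Rightarrow> 'v::euclidean_space" and G :: "real ^ 'd \<Rightarrow> 'w::euclidean_space"
  assumes P: "2 \<le> P"
    and [measurable]: "F \<in> borel_measurable borel" "G \<in> borel_measurable borel"
    and F: "\<And>x. norm (F x) \<le> M * gauss x" and G: "\<And>x. norm (G x) \<le> M * gauss x"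
    and X: "\<And>e. 0 < e \<Longrightarrow> integrable lborel (\<lambda>x. bellman.bell P e (F x) (G x)) \<and> X \<le> (LINT x|lborel. bellman.bell P e (F x) (G x))"
  shows "X \<le> (LINT x|lborel. norm (F x) powr P) + (8 * P + 1) * (LINT x|lborel. norm (G x) powr (P / (P - 1)))"
proof -
  define q where "q = P / (P - 1)"
  define \<tau> where "\<tau> = 1 - 2 / P"
  define r where "r e x = ((norm (F x))\<^sup>2 + e) powr (P / 2) + ((norm (G x))\<^sup>2 + e) powr (q / 2)" for e x
  define b where "b e x = (norm (F x))\<^sup>2 * r e x powr \<tau>" for e x
  have q: "1 < q" "q \<le> 2" and ta: "0 \<le> \<tau>" using P by (auto simp: q_def \<tau>_def field_simps)
  have FP: "integrable lborel (\<lambda>x. norm (F x) powr P)" and GQ: "integrable lborel (\<lambda>x. norm (G x) powr q)"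
    using P q by (auto intro: integrable_norm_powr_gauss[OF _ F] integrable_norm_powr_gauss[OF _ G])
  have F2: "integrable lborel (\<lambda>x. (norm (F x))\<^sup>2)"
    using integrable_norm_powr_gauss[OF _ F, of 2] by simp
  have M: "0 \<le> M"
    using order_trans[OF norm_ge_zero F] gauss_pos(1) by (metis linorder_not_le mult_less_0_iff less_le_not_le)
  have FM: "(norm (F x))\<^sup>2 \<le> M\<^sup>2" and GM: "(norm (G x))\<^sup>2 \<le> M\<^sup>2" for x
    using order_trans[OF F mult_left_le[OF gauss_le_1 M]] order_trans[OF G mult_left_le[OF gauss_le_1 M]]
    by (auto intro: power_mono)
  define C where "C = ((M\<^sup>2 + 1) powr (P / 2) + (M\<^sup>2 + 1) powr (q / 2)) powr \<tau>"
  have b_bd: "b e x \<le> C * (norm (F x))\<^sup>2" "0 \<le> b e x" if "0 \<le> e" "e \<le> 1" for e x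
  proof -
    have "r e x \<le> (M\<^sup>2 + 1) powr (P / 2) + (M\<^sup>2 + 1) powr (q / 2)"
      unfolding r_def using FM[of x] GM[of x] that P q by (intro add_mono powr_mono2) auto
    then have "r e x powr \<tau> \<le> C" unfolding C_def using ta by (intro powr_mono2) (auto simp: r_def)
    then show "b e x \<le> C * (norm (F x))\<^sup>2" unfolding b_def by (subst mult.commute) (rule mult_right_mono, auto)
    show "0 \<le> b e x" by (simp add: b_def)
  qed
  have b_meas [measurable]: "b e \<in> borel_measurable borel" for e
    unfolding b_def[abs_def] r_def[abs_def] by measurable
  have b_int: "integrable lborel (b e)" if "0 \<le> e" "e \<le> 1" for e
    by (rule Bochner_Integration.integrable_bound[OF integrable_mult_right[OF F2, of C]])
       (use b_bd[OF that] in \<open>auto intro!: AE_I2 order_trans[OF _ abs_ge_self]\<close>)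
  have step: "X \<le> (LINT x|lborel. b e x) + 8 * P * (LINT x|lborel. norm (G x) powr q)" if e01: "0 < e" "e \<le> 1" for e
  proof -
    interpret bellman P e using P e01 by unfold_locales
    have eqs: "Q = q" "\<theta> = \<tau>" by (simp_all add: Q_def q_def \<theta>_def \<tau>_def)
    have "bell (F x) (G x) \<le> b e x + 8 * P * norm (G x) powr q" for x
    proof -
      have "((norm (G x))\<^sup>2 + e) powr (q / 2) \<le> (norm (G x))\<^sup>2 powr (q / 2) + e powr (q / 2)"
        by (rule powr_add_le_add_powr) (use q e01 in auto)
      also have "(norm (G x))\<^sup>2 powr (q / 2) = norm (G x) powr q"
        by (simp add: powr_powr flip: powr_numeral)
      finally have "K * (((norm (G x))\<^sup>2 + e) powr (q / 2) - e powr (q / 2)) \<le> 8 * P * norm (G x) powr q"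
        unfolding K_def using P by simp
      then show ?thesis
        by (simp add: bell_def \<Phi>_def \<rho>_def b_def r_def eqs)
    qed
    then have "(LINT x|lborel. bell (F x) (G x)) \<le> (LINT x|lborel. b e x + 8 * P * norm (G x) powr q)"
      by (intro integral_mono) (use X[OF e01(1)] b_int[of e] e01 GQ in auto)
    also have "\<dots> = (LINT x|lborel. b e x) + 8 * P * (LINT x|lborel. norm (G x) powr q)"
      using b_int[of e] e01 GQ by simp
    finally show ?thesis using X[OF e01(1)] by simp
  qed
  define E where "E k = 1 / real (Suc k)" for k
  have E: "0 < E k" "E k \<le> 1" "E \<longlonglongrightarrow> 0" for k
    unfolding E_def using LIMSEQ_Suc[OF lim_1_over_n] by auto
  have "(\<lambda>k. LINT x|lborel. b (E k) x) \<longlonglongrightarrow> (LINT x|lborel. b 0 x)"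
  proof (rule integral_dominated_convergence[where w = "\<lambda>x. C * (norm (F x))\<^sup>2"])
    show "AE x in lborel. (\<lambda>k. b (E k) x) \<longlonglongrightarrow> b 0 x"
    proof (rule AE_I2)
      fix x
      have t: "(\<lambda>k. (a + E k) powr q) \<longlonglongrightarrow> a powr q" if "0 \<le> a" "0 < q" for a q
        using tendsto_powr'[OF tendsto_add[OF tendsto_const[of a] E(3)] tendsto_const[of q]] that E by (simp add: less_imp_le)
      have r: "(\<lambda>k. r (E k) x) \<longlonglongrightarrow> r 0 x"
        unfolding r_def using tendsto_add[OF t t, of "(norm (F x))\<^sup>2" "P/2" "(norm (G x))\<^sup>2" "q/2"] P q by simp
      show "(\<lambda>k. b (E k) x) \<longlonglongrightarrow> b 0 x"
      \<comment> \<open>If \<open>F x = 0\<close>, the base \<open>r 0 x\<close> may vanish, and at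
        base 0 \<open>powr\<close> is discontinuous for the exponent \<open>\<tau> = 0\<close> that
        occurs at \<open>P = 2\<close>; the factor \<open>(norm (F x))\<^sup>2\<close> settles this
        case.\<close>
      proof (cases "F x = 0")
        case True
        then show ?thesis by (simp add: b_def)
      next
        case False
        then have "0 < r 0 x" unfolding r_def by (intro add_pos_nonneg) auto
        then show ?thesis unfolding b_def by (intro tendsto_mult tendsto_const tendsto_powr r) auto
      qed
    qed
    show "AE x in lborel. norm (b (E k) x) \<le> C * (norm (F x))\<^sup>2" for k
      using b_bd[of "E k"] E(1,2)[of k] by (intro AE_I2) (simp add: less_imp_le)
  qed (use F2 in auto)
  then have "(\<lambda>k. (LINT x|lborel. b (E k) x) + 8 * P * (LINT x|lborel. norm (G x) powr q))
      \<longlonglongrightarrow> (LINT x|lborel. b 0 x) + 8 * P * (LINT x|lborel. norm (G x) powr q)"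
    by (intro tendsto_add tendsto_const)
  then have "X \<le> (LINT x|lborel. b 0 x) + 8 * P * (LINT x|lborel. norm (G x) powr q)"
    by (rule LIMSEQ_le_const) (use step E(1,2) in auto)
  also have "(LINT x|lborel. b 0 x) \<le> (LINT x|lborel. norm (F x) powr P + norm (G x) powr q)"
  proof (rule integral_mono)
    show "b 0 x \<le> norm (F x) powr P + norm (G x) powr q" for x
    proof -
      have r0: "r 0 x = norm (F x) powr P + norm (G x) powr q"
        by (simp add: r_def powr_powr flip: powr_numeral)
      have "(norm (F x))\<^sup>2 = (norm (F x) powr P) powr (2 / P)"
        using P by (simp add: powr_powr)
      also have "\<dots> \<le> r 0 x powr (2 / P)" using P by (intro powr_mono2) (auto simp: r0)
      finally have "b 0 x \<le> r 0 x powr (2 / P) * r 0 x powr \<tau>" unfolding b_def by (intro mult_right_mono) auto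
      also have "\<dots> = r 0 x" by (simp add: \<tau>_def r0 flip: powr_add)
      finally show ?thesis by (simp add: r0)
    qed
  qed (use b_int FP GQ in auto)
  also have "\<dots> = (LINT x|lborel. norm (F x) powr P) + (LINT x|lborel. norm (G x) powr q)"
    using FP GQ by simp
  finally show ?thesis by (simp add: q_def algebra_simps)
qed

section \<open>Finite Hermite expansions and their pairing\<close>

definition hexp :: "(nat ^ 'd) set \<Rightarrow> (nat ^ 'd \<Rightarrow> 'v::euclidean_space) \<Rightarrow> real ^ 'd::finite \<Rightarrow> 'v" where
  "hexp N c x = (\<Sum>n\<in>N. hermite_fun n x *\<^sub>R c n)"

definition riesz_hexp :: "(nat ^ 'd) set \<Rightarrow> (nat ^ 'd \<Rightarrow> real) \<Rightarrow> real ^ 'd::finite \<Rightarrow> real ^ 'd" where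
  "riesz_hexp N c x = (\<chi> i. \<Sum>n\<in>N. eigval n powr (- 1 / 2) * c n * (sqrt (2 * real (n $ i) + 2) * hermite_fun (n + axis i 1) x))"

lemma hexp_gauss_bound:
  fixes c :: "nat ^ 'd::finite \<Rightarrow> 'v::euclidean_space"
  shows "\<exists>M\<ge>0. \<forall>x. norm (hexp N c x) \<le> M * gauss x"
proof -
  have "flow 0 N c x 0 = hexp N c x" for x by (simp add: flow_def hexp_def)
  moreover obtain M where "0 \<le> M" and M: "\<And>x t. - 1 \<le> t \<Longrightarrow> norm (flow 0 N c x t) \<le> M * gauss x"
    using flow_bounds[OF order_refl, of N c] by blast
  moreover have "norm (flow 0 N c x 0) \<le> M * gauss x" for x by (rule M) simp
  ultimately show ?thesis by auto
qed

lemma borel_measurable_hexp [measurable]: "hexp N c \<in> borel_measurable borel"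
  unfolding hexp_def[abs_def] by (intro borel_measurable_sum borel_measurable_scaleR) auto

lemma freq_shift:
  fixes n :: "nat ^ 'd::finite"
  shows "freq (2 * real CARD('d)) n = sqrt (eigval n)"
    and "freq (2 * real CARD('d) - 2) (n + axis i 1) = sqrt (eigval n)"
    and "0 < sqrt (eigval n)"
    and "eigval n powr (- 1 / 2) = 1 / sqrt (eigval n)"
proof -
  have pos: "0 < eigval n" unfolding eigval_def by (intro add_nonneg_pos) (auto intro: sum_nonneg)
  show "freq (2 * real CARD('d)) n = sqrt (eigval n)" by (simp add: freq_def eigval_def)
  have "(\<Sum>j\<in>UNIV. (n + axis i 1) $ j) = (\<Sum>j\<in>UNIV. n $ j) + 1"
    by (simp add: sum.distrib axis_def)
  then show "freq (2 * real CARD('d) - 2) (n + axis i 1) = sqrt (eigval n)" by (simp add: freq_def eigval_def)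
  show "0 < sqrt (eigval n)" using pos by simp
  show "eigval n powr (- 1 / 2) = 1 / sqrt (eigval n)"
    using pos by (simp add: powr_minus_divide powr_half_sqrt)
qed

text \<open>The coefficients of the bilinear form \<open>\<langle>\<delta>\<^sup>* f, g\<rangle>\<close> in the Hermite basis.\<close>

definition pair_coeff :: "(nat ^ 'd) set \<Rightarrow> (nat ^ 'd \<Rightarrow> real) \<Rightarrow> (nat ^ 'd \<Rightarrow> real ^ 'd) \<Rightarrow> nat ^ 'd::finite \<Rightarrow> 'd \<Rightarrow> real" where
  "pair_coeff N' c g n i = (if n + axis i 1 \<in> N' then sqrt (2 * real (n $ i) + 2) * c n * g (n + axis i 1) $ i else 0)"

text \<open>The weights \<open>w\<close> and \<open>w'\<close> are free so that one computation
  serves both the pairing with the Riesz transform and the density at time \<open>t\<close>.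
  Orthonormality keeps only the pairs \<open>m = n + axis i 1\<close>.\<close>

lemma integral_pair:
  fixes w :: "nat ^ 'd::finite \<Rightarrow> real" and w' :: "nat ^ 'd \<Rightarrow> real"
  assumes N: "finite N" "finite N'"
  shows "integrable lborel (\<lambda>x. \<Sum>i\<in>UNIV. (\<Sum>n\<in>N. w n * (c n * (sqrt (2 * real (n $ i) + 2) * hermite_fun (n + axis i 1) x)))
       * (\<Sum>m\<in>N'. w' m * (hermite_fun m x * g m $ i)))"
    (is "integrable _ ?f")
    and "(LINT x|lborel. (\<Sum>i\<in>UNIV. (\<Sum>n\<in>N. w n * (c n * (sqrt (2 * real (n $ i) + 2) * hermite_fun (n + axis i 1) x)))
       * (\<Sum>m\<in>N'. w' m * (hermite_fun m x * g m $ i))))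
     = (\<Sum>n\<in>N. \<Sum>i\<in>UNIV. w n * w' (n + axis i 1) * pair_coeff N' c g n i)"
proof -
  have eq: "?f = (\<lambda>x. \<Sum>i\<in>UNIV. \<Sum>n\<in>N. \<Sum>m\<in>N'. (w n * c n * sqrt (2 * real (n $ i) + 2) * w' m * g m $ i) * (hermite_fun (n + axis i 1) x * hermite_fun m x))"
    unfolding sum_product by (intro ext sum.cong refl) (simp only: mult_ac)
  show "integrable lborel ?f" unfolding eq
    by (intro Bochner_Integration.integrable_sum integrable_mult_right hermite_fun_orthonormal(1))
  have "(LINT x|lborel. ?f x) = (\<Sum>i\<in>UNIV. \<Sum>n\<in>N. \<Sum>m\<in>N'. (w n * c n * sqrt (2 * real (n $ i) + 2) * w' m * g m $ i)
     * (if n + axis i 1 = m then 1 else 0))"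
    unfolding eq
    by (simp add: Bochner_Integration.integral_sum hermite_fun_orthonormal Bochner_Integration.integrable_sum)
  also have "\<dots> = (\<Sum>i\<in>UNIV. \<Sum>n\<in>N. w n * w' (n + axis i 1) * pair_coeff N' c g n i)"
  proof (intro sum.cong refl)
    fix i :: 'd and n
    show "(\<Sum>m\<in>N'. (w n * c n * sqrt (2 * real (n $ i) + 2) * w' m * g m $ i) * (if n + axis i 1 = m then 1 else 0))
      = w n * w' (n + axis i 1) * pair_coeff N' c g n i"
      using N(2) by (simp add: pair_coeff_def if_distrib[of "(*) _"] sum.delta' cong: if_cong)
  qed
  also have "\<dots> = (\<Sum>n\<in>N. \<Sum>i\<in>UNIV. w n * w' (n + axis i 1) * pair_coeff N' c g n i)" by (rule sum.swap)
  finally show "(LINT x|lborel. ?f x) = (\<Sum>n\<in>N. \<Sum>i\<in>UNIV. w n * w' (n + axis i 1) * pair_coeff N' c g n i)" .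
qed

lemma pairing_eq:
  assumes "finite N" "finite N'"
  shows "integrable lborel (\<lambda>x. riesz_hexp N c x \<bullet> hexp N' g x)"
    and "(LINT x|lborel. riesz_hexp N c x \<bullet> hexp N' g x)
      = (\<Sum>n\<in>N. \<Sum>i\<in>UNIV. 1 / sqrt (eigval n) * pair_coeff N' c g n i)"
proof -
  have eq: "riesz_hexp N c x \<bullet> hexp N' g x = (\<Sum>i\<in>UNIV.
      (\<Sum>n\<in>N. (1 / sqrt (eigval n)) * (c n * (sqrt (2 * real (n $ i) + 2) * hermite_fun (n + axis i 1) x)))
       * (\<Sum>m\<in>N'. 1 * (hermite_fun m x * g m $ i)))" for x
    unfolding inner_vec_def riesz_hexp_def freq_shift(4) by (simp add: hexp_def mult.assoc)
  show "integrable lborel (\<lambda>x. riesz_hexp N c x \<bullet> hexp N' g x)"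
    unfolding eq by (rule integral_pair(1)[OF assms])
  show "(LINT x|lborel. riesz_hexp N c x \<bullet> hexp N' g x)
      = (\<Sum>n\<in>N. \<Sum>i\<in>UNIV. 1 / sqrt (eigval n) * pair_coeff N' c g n i)"
    unfolding eq by (subst integral_pair(2)[OF assms]) simp
qed

text \<open>
  The two flows use \<open>\<kappa> = 2 d\<close> for \<open>L'\<close> and \<open>\<kappa> = 2 d - 2\<close> for \<open>L' - 2\<close>, so that the frequencies of
  \<open>n\<close> and \<open>n + axis i 1\<close> agree.
\<close>

definition cross_density :: "(nat ^ 'd) set \<Rightarrow> (nat ^ 'd \<Rightarrow> real) \<Rightarrow> (nat ^ 'd) set \<Rightarrow> (nat ^ 'd \<Rightarrow> real ^ 'd) \<Rightarrow> real ^ 'd::finite \<Rightarrow> real \<Rightarrow> real" where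
  "cross_density N c N' g x t = - ((\<chi> i. x $ i * flow (2 * real CARD('d)) N c x t - flow_x i (2 * real CARD('d)) N c x t)
     \<bullet> flow_t (2 * real CARD('d) - 2) N' g x t)"

text \<open>By \<open>(a - b)\<^sup>2 \<le> 2 * (a\<^sup>2 + b\<^sup>2)\<close> the raised gradient
  \<open>D\<close> satisfies \<open>(norm D)\<^sup>2 \<le> 2 * U\<close> for the energy
  \<open>U\<close> of the first flow. This is relaxed to \<open>4 * U\<close>, as
  \<open>norm D \<le> 2 * sqrt U\<close> already matches the factor 4 of
  \<open>bell_subharmonic\<close>.\<close>

lemma cross_density_le:
  fixes c :: "nat ^ 'd::finite \<Rightarrow> real"
  shows "2 * cross_density N c N' g x t \<le> 4 * (sqrt (grad_sq (2 * real CARD('d)) N c x t) * sqrt (grad_sq (2 * real CARD('d) - 2) N' g x t))"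
proof -
  let ?\<kappa> = "2 * real CARD('d)"
  define D where "D = (\<chi> i. x $ i * flow ?\<kappa> N c x t - flow_x i ?\<kappa> N c x t)"
  let ?U = "grad_sq ?\<kappa> N c x t" and ?V = "grad_sq (?\<kappa> - 2) N' g x t"
  have "(norm D)\<^sup>2 = (\<Sum>i\<in>UNIV. (x $ i * flow ?\<kappa> N c x t - flow_x i ?\<kappa> N c x t)\<^sup>2)"
    by (simp add: norm_square_vec D_def)
  also have "\<dots> \<le> (\<Sum>i\<in>UNIV. 2 * ((x $ i)\<^sup>2 * (flow ?\<kappa> N c x t)\<^sup>2 + (flow_x i ?\<kappa> N c x t)\<^sup>2))"
  proof (rule sum_mono)
    have "(a - b)\<^sup>2 \<le> 2 * (a\<^sup>2 + b\<^sup>2)" for a b :: real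
      using zero_le_power2[of "a + b"] by (simp add: power2_eq_square algebra_simps)
    then show "(x $ i * flow ?\<kappa> N c x t - flow_x i ?\<kappa> N c x t)\<^sup>2
      \<le> 2 * ((x $ i)\<^sup>2 * (flow ?\<kappa> N c x t)\<^sup>2 + (flow_x i ?\<kappa> N c x t)\<^sup>2)" for i
      by (simp add: flip: power_mult_distrib)
  qed
  also have "\<dots> = 2 * ((norm x)\<^sup>2 * (norm (flow ?\<kappa> N c x t))\<^sup>2 + (\<Sum>i\<in>UNIV. (norm (flow_x i ?\<kappa> N c x t))\<^sup>2))"
    by (simp add: norm_square_vec sum.distrib sum_distrib_right flip: sum_distrib_left)
  also have "\<dots> \<le> 2\<^sup>2 * ?U"
    unfolding grad_sq_def using sum_nonneg[of UNIV "\<lambda>i. (norm (flow_x i ?\<kappa> N c x t))\<^sup>2"] by simp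
  also have "2\<^sup>2 * ?U = (2 * sqrt ?U)\<^sup>2"
    by (simp only: power_mult_distrib real_sqrt_pow2[OF grad_sq_nonneg])
  finally have "norm D \<le> 2 * sqrt ?U"
    by (rule power2_le_imp_le) (simp add: grad_sq_nonneg)
  moreover have "(norm (flow_t (?\<kappa> - 2) N' g x t))\<^sup>2 \<le> ?V"
    unfolding grad_sq_def by (simp add: sum_nonneg)
  then have "norm (flow_t (?\<kappa> - 2) N' g x t) \<le> sqrt ?V" by (rule real_le_rsqrt)
  ultimately have "norm D * norm (flow_t (?\<kappa> - 2) N' g x t) \<le> (2 * sqrt ?U) * sqrt ?V"
    by (intro mult_mono) (auto simp: grad_sq_nonneg)
  moreover have "cross_density N c N' g x t \<le> norm D * norm (flow_t (?\<kappa> - 2) N' g x t)"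
    unfolding cross_density_def D_def[symmetric]
    using Cauchy_Schwarz_ineq2[of D "flow_t (?\<kappa> - 2) N' g x t"] by simp
  ultimately show ?thesis by simp
qed

text \<open>Modes \<open>n\<close> and \<open>n + axis i 1\<close> of the two flows decay at the
  same rate, so each term carries a single exponential in \<open>t\<close> and has an explicit
  second primitive.\<close>

lemma integral_cross_density:
  fixes c :: "nat ^ 'd::finite \<Rightarrow> real"
  assumes "finite N" "finite N'"
  shows "integrable lborel (\<lambda>x. cross_density N c N' g x t)"
    and "(LINT x|lborel. cross_density N c N' g x t)
      = (\<Sum>n\<in>N. \<Sum>i\<in>UNIV. pair_coeff N' c g n i * sqrt (eigval n) * exp (- 2 * t * sqrt (eigval n)))"
proof -
  let ?\<mu> = "freq (2 * real CARD('d) - 2) :: nat ^ 'd \<Rightarrow> real"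
  have eq: "cross_density N c N' g x t = (\<Sum>i\<in>UNIV.
      (\<Sum>n\<in>N. exp (- t * sqrt (eigval n)) * (c n * (sqrt (2 * real (n $ i) + 2) * hermite_fun (n + axis i 1) x)))
       * (\<Sum>m\<in>N'. (?\<mu> m * exp (- t * ?\<mu> m)) * (hermite_fun m x * g m $ i)))" for x
  proof -
    have "x $ i * flow (2 * real CARD('d)) N c x t - flow_x i (2 * real CARD('d)) N c x t
      = (\<Sum>n\<in>N. exp (- t * sqrt (eigval n)) * (c n * (sqrt (2 * real (n $ i) + 2) * hermite_fun (n + axis i 1) x)))" for i
      unfolding flow_def flow_x_def freq_shift(1) hermite_dfun_def sum_distrib_left sum_subtractf[symmetric]
      by (intro sum.cong) (simp_all add: algebra_simps)
    moreover have "flow_t (2 * real CARD('d) - 2) N' g x t $ i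
      = - (\<Sum>m\<in>N'. (?\<mu> m * exp (- t * ?\<mu> m)) * (hermite_fun m x * g m $ i))" for i
      unfolding flow_t_def by (simp add: sum_negf mult.assoc)
    ultimately show ?thesis unfolding cross_density_def inner_vec_def by (simp add: sum_negf)
  qed
  show "integrable lborel (\<lambda>x. cross_density N c N' g x t)"
    unfolding eq by (rule integral_pair(1)[OF assms])
  have e: "exp (- t * s) * (s * exp (- t * s)) * p = p * s * exp (- 2 * t * s)" for s p :: real
  proof -
    have "exp (- 2 * t * s) = exp (- t * s) * exp (- t * s)" by (simp flip: exp_add)
    then show ?thesis by simp
  qed
  show "(LINT x|lborel. cross_density N c N' g x t)
      = (\<Sum>n\<in>N. \<Sum>i\<in>UNIV. pair_coeff N' c g n i * sqrt (eigval n) * exp (- 2 * t * sqrt (eigval n)))"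
    unfolding eq integral_pair(2)[OF assms] freq_shift(2) by (intro sum.cong refl e)
qed

text \<open>The first argument of the Bellman function carries the exponent
  \<open>P \<ge> 2\<close>. Putting either expansion there covers exponents above and below
  2.\<close>

lemma riesz_bilinear_bound:
  fixes c :: "nat ^ 'd::finite \<Rightarrow> real"
  assumes N: "finite N" "finite N'" and P: "2 \<le> P"
  shows "(LINT x|lborel. riesz_hexp N c x \<bullet> hexp N' g x)
      \<le> 2 * (LINT x|lborel. norm (hexp N c x) powr P) + 2 * (8 * P + 1) * (LINT x|lborel. norm (hexp N' g x) powr (P / (P - 1)))"
    and "(LINT x|lborel. riesz_hexp N c x \<bullet> hexp N' g x)
      \<le> 2 * (LINT x|lborel. norm (hexp N' g x) powr P) + 2 * (8 * P + 1) * (LINT x|lborel. norm (hexp N c x) powr (P / (P - 1)))"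
proof -
  let ?\<kappa> = "2 * real CARD('d)"
  \<comment> \<open>\<open>L' - 2\<close> has the constant \<open>2 d - 2\<close>, nonnegative
    because the dimension is at least 1.\<close>
  have \<kappa>: "0 \<le> ?\<kappa>" "0 \<le> ?\<kappa> - 2"
    using one_le_card_finite[where 'a='d] by auto
  define s where "s n = sqrt (eigval n)" for n :: "nat ^ 'd"
  have s: "0 < s n" for n unfolding s_def by (rule freq_shift(3))
  have s0: "s n \<noteq> 0" for n using s[of n] by simp
  define a where "a = pair_coeff N' c g"
  \<comment> \<open>Integrating \<open>s * exp (- 2 * t * s)\<close> twice in \<open>t\<close>, with
    decay at infinity, gives \<open>exp (- 2 * t * s) / (4 * s)\<close>. At \<open>t = 0\<close>
    this is a quarter of \<open>1 / s\<close>, the multiplier in the Riesz transform.\<close>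
  define J where "J t = (\<Sum>n\<in>N. \<Sum>i\<in>UNIV. a n i * (exp (- 2 * t * s n) / (4 * s n)))" for t
  define J' where "J' t = (\<Sum>n\<in>N. \<Sum>i\<in>UNIV. a n i * (- exp (- 2 * t * s n) / 2))" for t
  have d: "(J has_real_derivative J' t) (at t)"
    "(J' has_real_derivative (LINT x|lborel. cross_density N c N' g x t)) (at t)" for t
  proof -
    show "(J has_real_derivative J' t) (at t)" unfolding J_def J'_def
      by (intro DERIV_sum DERIV_cmult) (use s0 in \<open>auto intro!: derivative_eq_intros\<close>)
    have "(J' has_real_derivative (\<Sum>n\<in>N. \<Sum>i\<in>UNIV. a n i * (s n * exp (- 2 * t * s n)))) (at t)"
      unfolding J'_def by (intro DERIV_sum DERIV_cmult) (auto intro!: derivative_eq_intros)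
    then show "(J' has_real_derivative (LINT x|lborel. cross_density N c N' g x t)) (at t)"
      by (simp only: integral_cross_density(2)[OF N] s_def a_def mult.assoc)
  qed
  have Jb: "\<bar>J t\<bar> \<le> (\<Sum>n\<in>N. \<Sum>i\<in>UNIV. \<bar>a n i\<bar> * (1 / (4 * s n)))" if "0 \<le> t" for t
    unfolding J_def
  proof (intro order_trans[OF sum_abs] sum_mono)
    fix n i
    have "exp (- 2 * t * s n) \<le> 1" using that s[of n] by simp
    then have "exp (- 2 * t * s n) / (4 * s n) \<le> 1 / (4 * s n)" using s[of n] by (intro divide_right_mono) auto
    then show "\<bar>a n i * (exp (- 2 * t * s n) / (4 * s n))\<bar> \<le> \<bar>a n i\<bar> * (1 / (4 * s n))"
      unfolding abs_mult using s[of n] by (intro mult_left_mono) auto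
  qed
  have J0: "(J \<longlongrightarrow> 0) at_top"
  proof -
    have e: "((\<lambda>t. exp (- 2 * t * s n)) \<longlongrightarrow> 0) at_top" for n
    proof (rule filterlim_compose[OF exp_at_bot])
      have "filterlim (\<lambda>t. (- 2 * s n) * t) at_bot at_top"
        by (rule filterlim_tendsto_neg_mult_at_bot[OF tendsto_const]) (use s[of n] in \<open>auto simp: filterlim_ident\<close>)
      then show "filterlim (\<lambda>t. - 2 * t * s n) at_bot at_top" by (simp add: mult_ac)
    qed
    have "(J \<longlongrightarrow> (\<Sum>n\<in>N. \<Sum>i\<in>(UNIV :: 'd set). a n i * (0 / (4 * s n)))) at_top"
      unfolding J_def by (intro tendsto_sum tendsto_mult tendsto_const tendsto_divide e) (use s0 in simp)
    then show ?thesis by simp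
  qed
  have pairing: "(LINT x|lborel. riesz_hexp N c x \<bullet> hexp N' g x) = 4 * J 0"
    unfolding pairing_eq(2)[OF N] J_def sum_distrib_left s_def a_def by (intro sum.cong refl) simp
  have f0: "flow ?\<kappa> N c x 0 = hexp N c x" "flow (?\<kappa> - 2) N' g x 0 = hexp N' g x" for x
    by (simp_all add: flow_def hexp_def)
  obtain M1 where M1: "\<And>x. norm (hexp N c x) \<le> M1 * gauss x" using hexp_gauss_bound[of N c] by blast
  obtain M2 where M2: "\<And>x. norm (hexp N' g x) \<le> M2 * gauss x" using hexp_gauss_bound[of N' g] by blast
  have M': "norm (hexp N c x) \<le> max M1 M2 * gauss x" "norm (hexp N' g x) \<le> max M1 M2 * gauss x" for x
    by (rule order_trans[OF M1 mult_right_mono] order_trans[OF M2 mult_right_mono]; simp)+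
  have "2 * J 0 \<le> (LINT x|lborel. norm (hexp N c x) powr P) + (8 * P + 1) * (LINT x|lborel. norm (hexp N' g x) powr (P / (P - 1)))"
  proof (rule bell_limit[OF P borel_measurable_hexp borel_measurable_hexp M'])
    fix e :: real assume "0 < e"
    then interpret bellman P e using P by unfold_locales
    show "integrable lborel (\<lambda>x. bell (hexp N c x) (hexp N' g x)) \<and> 2 * J 0 \<le> (LINT x|lborel. bell (hexp N c x) (hexp N' g x))"
      using bell_energy[OF \<kappa> integral_cross_density(1)[OF N] cross_density_le d Jb J0] by (simp only: f0)
  qed
  then show "(LINT x|lborel. riesz_hexp N c x \<bullet> hexp N' g x)
      \<le> 2 * (LINT x|lborel. norm (hexp N c x) powr P) + 2 * (8 * P + 1) * (LINT x|lborel. norm (hexp N' g x) powr (P / (P - 1)))"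
    unfolding pairing by linarith
  have "2 * J 0 \<le> (LINT x|lborel. norm (hexp N' g x) powr P) + (8 * P + 1) * (LINT x|lborel. norm (hexp N c x) powr (P / (P - 1)))"
  proof (rule bell_limit[OF P borel_measurable_hexp borel_measurable_hexp M'(2,1)])
    fix e :: real assume "0 < e"
    then interpret bellman P e using P by unfold_locales
    have le: "2 * cross_density N c N' g x t \<le> 4 * (sqrt (grad_sq (?\<kappa> - 2) N' g x t) * sqrt (grad_sq ?\<kappa> N c x t))" for x t
      using cross_density_le[of N c N' g x t] by (simp add: mult.commute)
    show "integrable lborel (\<lambda>x. bell (hexp N' g x) (hexp N c x)) \<and> 2 * J 0 \<le> (LINT x|lborel. bell (hexp N' g x) (hexp N c x))"
      using bell_energy[OF \<kappa>(2,1) integral_cross_density(1)[OF N] le d Jb J0] by (simp only: f0)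
  qed
  then show "(LINT x|lborel. riesz_hexp N c x \<bullet> hexp N' g x)
      \<le> 2 * (LINT x|lborel. norm (hexp N' g x) powr P) + 2 * (8 * P + 1) * (LINT x|lborel. norm (hexp N c x) powr (P / (P - 1)))"
    unfolding pairing by linarith
qed

subsection \<open>Lebesgue spaces\<close>

text \<open>The power \<open>p\<close> of \<open>Lp_norm\<close>. It can be added and passed to
  limits under the integral without taking roots; \<open>Lp_norm_le_iff\<close> translates
  back.\<close>

definition Lp_int :: "real \<Rightarrow> ('a::euclidean_space \<Rightarrow> 'b::euclidean_space) \<Rightarrow> real" where
  "Lp_int p f = (LINT x|lebesgue. norm (f x) powr p)"

lemma Lp_int_nonneg: "0 \<le> Lp_int p f"
  unfolding Lp_int_def by (rule integral_nonneg_AE) simp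

lemma Lp_spaceD: "f \<in> Lp_space p \<Longrightarrow> f \<in> borel_measurable lebesgue"
  "f \<in> Lp_space p \<Longrightarrow> integrable lebesgue (\<lambda>x. norm (f x) powr p)"
  by (auto simp: Lp_space_def)

lemma Lp_norm_le_iff:
  assumes "0 < p" "0 \<le> C"
  shows "Lp_norm p f \<le> C * Lp_norm p g \<longleftrightarrow> Lp_int p f \<le> C powr p * Lp_int p g"
proof -
  have "Lp_norm p f \<le> C * Lp_norm p g \<longleftrightarrow> Lp_norm p f powr p \<le> (C * Lp_norm p g) powr p"
    using assms by (metis Lp_norm_def linorder_not_le mult_nonneg_nonneg powr_ge_zero powr_less_mono2 powr_mono2 order_less_imp_le)
  also have "\<dots> \<longleftrightarrow> Lp_int p f \<le> C powr p * Lp_int p g"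
    using assms Lp_int_nonneg[of p f] Lp_int_nonneg[of p g]
    by (simp add: powr_mult powr_powr Lp_norm_def Lp_int_def)
  finally show ?thesis .
qed

text \<open>
  Convexity of \<open>t \<mapsto> t\<^sup>p\<close> in a form whose integral replaces Minkowski's inequality: the infimum
  over \<open>s\<close> of the right hand side is \<open>(a + b)\<^sup>p\<close>.
\<close>

lemma powr_add_le_weighted:
  fixes a b s p :: real
  assumes "0 \<le> a" "0 \<le> b" "0 < s" "s < 1" "1 \<le> p"
  shows "(a + b) powr p \<le> (1 - s) powr (1 - p) * a powr p + s powr (1 - p) * b powr p"
proof (cases "a = 0 \<or> b = 0")
  case True
  have "1 \<le> s powr (1 - p)" "1 \<le> (1 - s) powr (1 - p)"
    using assms powr_mono2'[of "1 - p" s 1] powr_mono2'[of "1 - p" "1 - s" 1] by auto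
  then show ?thesis
    using True mult_right_mono[of 1 "s powr (1 - p)" "b powr p"] mult_right_mono[of 1 "(1 - s) powr (1 - p)" "a powr p"]
    by auto
next
  case False
  then have ab: "0 < a" "0 < b" using assms by auto
  have "((1 - s) *\<^sub>R (a / (1 - s)) + s *\<^sub>R (b / s)) powr p \<le> (1 - s) * (a / (1 - s)) powr p + s * (b / s) powr p"
    by (rule convex_onD[OF powr_convex[OF assms(5)]]) (use ab assms in auto)
  moreover have "(1 - s) * (a / (1 - s)) powr p = (1 - s) powr (1 - p) * a powr p"
    using ab assms by (simp add: powr_divide powr_diff)
  moreover have "s * (b / s) powr p = s powr (1 - p) * b powr p"
    using ab assms by (simp add: powr_divide powr_diff)
  ultimately show ?thesis using assms by simp
qed

lemma norm_powr_add_le: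
  fixes a b :: "'b::real_normed_vector"
  assumes "0 < s" "s < 1" "1 \<le> p"
  shows "norm (a + b) powr p \<le> (1 - s) powr (1 - p) * norm a powr p + s powr (1 - p) * norm b powr p"
  by (rule order_trans[OF powr_mono2 powr_add_le_weighted]) (use assms norm_triangle_ineq[of a b] in auto)

lemma Lp_space_add:
  assumes f: "f \<in> Lp_space p" and g: "g \<in> Lp_space p" and p: "1 \<le> p"
  shows "(\<lambda>x. f x + g x) \<in> Lp_space p"
    and "0 < s \<Longrightarrow> s < 1 \<Longrightarrow> Lp_int p (\<lambda>x. f x + g x) \<le> (1 - s) powr (1 - p) * Lp_int p f + s powr (1 - p) * Lp_int p g"
proof -
  note [measurable] = Lp_spaceD(1)[OF f] Lp_spaceD(1)[OF g]
  have i: "integrable lebesgue (\<lambda>x. (1 - s) powr (1 - p) * norm (f x) powr p + s powr (1 - p) * norm (g x) powr p)" for s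
    using Lp_spaceD(2)[OF f] Lp_spaceD(2)[OF g] by simp
  have bd: "norm (f x + g x) powr p \<le> (1 - s) powr (1 - p) * norm (f x) powr p + s powr (1 - p) * norm (g x) powr p"
    if "0 < s" "s < 1" for s x using norm_powr_add_le that p by blast
  have int: "integrable lebesgue (\<lambda>x. norm (f x + g x) powr p)"
    by (rule Bochner_Integration.integrable_bound[OF i[of "1/2"]])
       (use bd[of "1/2"] in \<open>auto intro!: AE_I2 order_trans[OF _ abs_ge_self]\<close>)
  then show "(\<lambda>x. f x + g x) \<in> Lp_space p" by (simp add: Lp_space_def)
  assume s: "0 < s" "s < 1"
  have "Lp_int p (\<lambda>x. f x + g x) \<le> (LINT x|lebesgue. (1 - s) powr (1 - p) * norm (f x) powr p + s powr (1 - p) * norm (g x) powr p)"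
    unfolding Lp_int_def by (rule integral_mono[OF int i bd[OF s]])
  also have "\<dots> = (1 - s) powr (1 - p) * Lp_int p f + s powr (1 - p) * Lp_int p g"
    unfolding Lp_int_def using Lp_spaceD(2)[OF f] Lp_spaceD(2)[OF g] by simp
  finally show "Lp_int p (\<lambda>x. f x + g x) \<le> (1 - s) powr (1 - p) * Lp_int p f + s powr (1 - p) * Lp_int p g" .
qed

lemma Lp_space_scaleR:
  assumes f: "f \<in> Lp_space p"
  shows "(\<lambda>x. c *\<^sub>R f x) \<in> Lp_space p" and "Lp_int p (\<lambda>x. c *\<^sub>R f x) = \<bar>c\<bar> powr p * Lp_int p f"
  using Lp_spaceD[OF f] by (auto simp: Lp_space_def Lp_int_def powr_mult)

lemma Lp_space_diff:
  assumes f: "f \<in> Lp_space p" and g: "g \<in> Lp_space p" and p: "1 \<le> p"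
  shows "(\<lambda>x. f x - g x) \<in> Lp_space p"
    and "Lp_int p (\<lambda>x. f x - g x) \<le> 2 powr (p - 1) * (Lp_int p f + Lp_int p g)"
proof -
  have g': "(\<lambda>x. - 1 *\<^sub>R g x) \<in> Lp_space p" "Lp_int p (\<lambda>x. - 1 *\<^sub>R g x) = Lp_int p g"
    using Lp_space_scaleR[OF g, of "-1"] by simp_all
  show "(\<lambda>x. f x - g x) \<in> Lp_space p" using Lp_space_add(1)[OF f g'(1) p] by simp
  have "(1 / 2 :: real) powr (1 - p) = 2 powr (p - 1)" by (simp add: powr_divide powr_diff)
  then show "Lp_int p (\<lambda>x. f x - g x) \<le> 2 powr (p - 1) * (Lp_int p f + Lp_int p g)"
    using Lp_space_add(2)[OF f g'(1) p, of "1/2"] g'(2) by (simp add: distrib_left)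
qed

lemma Lp_int_add_le:
  assumes "f \<in> Lp_space p" "g \<in> Lp_space p" "1 \<le> p"
  shows "Lp_int p (\<lambda>x. f x + g x) \<le> 2 powr (p - 1) * (Lp_int p f + Lp_int p g)"
  using Lp_space_diff(2)[OF assms(1) Lp_space_scaleR(1)[OF assms(2), of "-1"] assms(3)]
    Lp_space_scaleR(2)[OF assms(2), of "-1"] by simp

text \<open>The sum of the powers has finite integral, hence is finite almost everywhere and its
  terms tend to 0. Such pointwise limits carry the construction of the extension.\<close>

lemma AE_tendsto_0_of_summable_Lp_int:
  fixes w :: "nat \<Rightarrow> 'a::euclidean_space \<Rightarrow> 'b::euclidean_space"
  assumes w: "\<And>k. w k \<in> Lp_space p" and sum: "summable (\<lambda>k. Lp_int p (w k))" and p: "0 < p"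
  shows "AE x in lebesgue. (\<lambda>k. w k x) \<longlonglongrightarrow> 0"
proof -
  note [measurable] = Lp_spaceD(1)[OF w]
  have "(\<integral>\<^sup>+x. (\<Sum>k. ennreal (norm (w k x) powr p)) \<partial>lebesgue) = (\<Sum>k. \<integral>\<^sup>+x. ennreal (norm (w k x) powr p) \<partial>lebesgue)"
    by (rule nn_integral_suminf) measurable
  also have "\<dots> = (\<Sum>k. ennreal (Lp_int p (w k)))"
    unfolding Lp_int_def using Lp_spaceD(2)[OF w] by (intro suminf_cong nn_integral_eq_integral) auto
  also have "\<dots> = ennreal (\<Sum>k. Lp_int p (w k))"
    using sum Lp_int_nonneg by (intro suminf_ennreal2) auto
  finally have "(\<integral>\<^sup>+x. (\<Sum>k. ennreal (norm (w k x) powr p)) \<partial>lebesgue) \<noteq> \<infinity>" by simp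
  then have "AE x in lebesgue. (\<Sum>k. ennreal (norm (w k x) powr p)) \<noteq> \<infinity>"
    by (intro nn_integral_PInf_AE) measurable
  then show ?thesis
  proof eventually_elim
    case (elim x)
    then have "summable (\<lambda>k. norm (w k x) powr p)"
      by (intro summable_suminf_not_top) auto
    then have "(\<lambda>k. norm (w k x) powr p) \<longlonglongrightarrow> 0" by (rule summable_LIMSEQ_zero)
    then have "(\<lambda>k. (norm (w k x) powr p) powr (1 / p)) \<longlonglongrightarrow> 0 powr (1 / p)"
      using p by (intro tendsto_powr') auto
    then have "(\<lambda>k. norm (w k x)) \<longlonglongrightarrow> 0" using p by (simp add: powr_powr)
    then show ?case by (rule tendsto_norm_zero_cancel)
  qed
qed

lemma Lp_Fatou:
  fixes F :: "nat \<Rightarrow> 'a::euclidean_space \<Rightarrow> 'b::euclidean_space"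
  assumes F: "\<And>k. F k \<in> Lp_space p" and [measurable]: "f \<in> borel_measurable lebesgue"
    and lim: "AE x in lebesgue. (\<lambda>k. F k x) \<longlonglongrightarrow> f x"
    and bound: "\<And>k. Lp_int p (F k) \<le> B k" and B: "B \<longlonglongrightarrow> L" and p: "0 < p"
  shows "f \<in> Lp_space p" "Lp_int p f \<le> L"
proof -
  note [measurable] = Lp_spaceD(1)[OF F]
  have B0: "0 \<le> B k" for k using order_trans[OF Lp_int_nonneg bound] .
  have L0: "0 \<le> L" by (rule LIMSEQ_le_const[OF B]) (use B0 in auto)
  have "(\<integral>\<^sup>+x. ennreal (norm (f x) powr p) \<partial>lebesgue) = (\<integral>\<^sup>+x. liminf (\<lambda>k. ennreal (norm (F k x) powr p)) \<partial>lebesgue)"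
  proof (rule nn_integral_cong_AE, use lim in eventually_elim)
    case (elim x)
    then have "(\<lambda>k. norm (F k x) powr p) \<longlonglongrightarrow> norm (f x) powr p"
      using p by (intro tendsto_powr' tendsto_norm tendsto_const) auto
    then have "(\<lambda>k. ennreal (norm (F k x) powr p)) \<longlonglongrightarrow> ennreal (norm (f x) powr p)"
      by (rule tendsto_ennrealI)
    then show ?case using lim_imp_Liminf[OF sequentially_bot] by metis
  qed
  also have "\<dots> \<le> liminf (\<lambda>k. \<integral>\<^sup>+x. ennreal (norm (F k x) powr p) \<partial>lebesgue)"
    by (rule nn_integral_liminf) measurable
  also have "\<dots> \<le> liminf (\<lambda>k. ennreal (B k))"
  proof (rule Liminf_mono, rule always_eventually, rule allI)
    fix k
    have "(\<integral>\<^sup>+x. ennreal (norm (F k x) powr p) \<partial>lebesgue) = ennreal (Lp_int p (F k))"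
      unfolding Lp_int_def using Lp_spaceD(2)[OF F] by (intro nn_integral_eq_integral) auto
    then show "(\<integral>\<^sup>+x. ennreal (norm (F k x) powr p) \<partial>lebesgue) \<le> ennreal (B k)"
      using bound[of k] by (simp add: ennreal_leI)
  qed
  also have "\<dots> = ennreal L" by (rule lim_imp_Liminf) (auto intro: tendsto_ennrealI B)
  finally have le: "(\<integral>\<^sup>+x. ennreal (norm (f x) powr p) \<partial>lebesgue) \<le> ennreal L" .
  have int: "integrable lebesgue (\<lambda>x. norm (f x) powr p)"
    by (rule integrableI_bounded) (use le in \<open>auto simp: less_top[symmetric] top_unique\<close>)
  then show "f \<in> Lp_space p" by (simp add: Lp_space_def)
  have "ennreal (Lp_int p f) \<le> ennreal L"
    unfolding Lp_int_def using le nn_integral_eq_integral[OF int] by simp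
  then show "Lp_int p f \<le> L" using L0 by simp
qed

subsection \<open>Extension of densely defined operators\<close>

locale densely_defined_operator =
  fixes p :: real and D :: "('a::euclidean_space \<Rightarrow> real) set"
    and S :: "('a \<Rightarrow> real) \<Rightarrow> 'a \<Rightarrow> 'b::euclidean_space" and C :: real
  assumes p: "1 < p" and C: "0 \<le> C"
    and D_Lp: "D \<subseteq> Lp_space p"
    and D_add: "\<And>f g. f \<in> D \<Longrightarrow> g \<in> D \<Longrightarrow> (\<lambda>x. f x + g x) \<in> D"
    and D_scale: "\<And>c f. f \<in> D \<Longrightarrow> (\<lambda>x. c * f x) \<in> D"
    and S_Lp: "\<And>f. f \<in> D \<Longrightarrow> S f \<in> Lp_space p"
    and S_add: "\<And>f g. f \<in> D \<Longrightarrow> g \<in> D \<Longrightarrow> S (\<lambda>x. f x + g x) = (\<lambda>x. S f x + S g x)"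
    and S_scale: "\<And>c f. f \<in> D \<Longrightarrow> S (\<lambda>x. c * f x) = (\<lambda>x. c *\<^sub>R S f x)"
    and S_bound: "\<And>f. f \<in> D \<Longrightarrow> Lp_int p (S f) \<le> C powr p * Lp_int p f"
    and dense: "\<And>f \<epsilon>. f \<in> Lp_space p \<Longrightarrow> 0 < \<epsilon> \<Longrightarrow> \<exists>g\<in>D. Lp_int p (\<lambda>x. g x - f x) < \<epsilon>"
begin

lemma D_diff: "f \<in> D \<Longrightarrow> g \<in> D \<Longrightarrow> (\<lambda>x. f x - g x) \<in> D"
  using D_add[of f "\<lambda>x. - 1 * g x"] D_scale[of g "-1"] by simp

lemma S_diff: "f \<in> D \<Longrightarrow> g \<in> D \<Longrightarrow> S (\<lambda>x. f x - g x) = (\<lambda>x. S f x - S g x)"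
  using S_add[of f "\<lambda>x. - 1 * g x"] D_scale[of g "-1"] S_scale[of g "-1"] by simp

text \<open>
  The squared factor leaves room for the factor \<open>2\<^sup>k\<close> with which the differences of consecutive
  approximations are weighted below.
\<close>

definition \<delta> :: "nat \<Rightarrow> real" where "\<delta> k = (2 powr - p) ^ k * (2 powr - p) ^ k"

definition approx :: "('a \<Rightarrow> real) \<Rightarrow> nat \<Rightarrow> 'a \<Rightarrow> real" where
  "approx f k = (SOME g. g \<in> D \<and> Lp_int p (\<lambda>x. g x - f x) < \<delta> k)"

text \<open>Elements of \<open>Lp_space\<close> are functions, so the extension is taken as a
  pointwise limit along one chosen, rapidly converging sequence. On the null set where it may
  diverge, \<open>lim\<close> has some unspecified value.\<close>

definition ext :: "('a \<Rightarrow> real) \<Rightarrow> 'a \<Rightarrow> 'b" where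
  "ext f x = lim (\<lambda>k. S (approx f k) x)"

lemma \<delta>: "0 < \<delta> k" "\<delta> (Suc k) \<le> \<delta> k" "summable \<delta>" "summable (\<lambda>k. (2 ^ k) powr p * \<delta> k)" "\<delta> \<longlonglongrightarrow> 0"
proof -
  define q where "q = (2::real) powr - p"
  have q: "0 < q" "q < 1" using p powr_less_mono[of "-p" 0 "2::real"] by (auto simp: q_def)
  have d: "\<delta> k = (q * q) ^ k" for k by (simp add: \<delta>_def q_def power_mult_distrib)
  have qq: "0 < q * q" "q * q < 1" using q mult_strict_mono[of q 1 q 1] by auto
  show "0 < \<delta> k" using qq(1) by (simp add: d)
  show "\<delta> (Suc k) \<le> \<delta> k" using qq by (simp add: d mult_left_le_one_le)
  show s: "summable \<delta>" using summable_geometric[of "q * q"] qq by (simp add: d[abs_def])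
  have "(2 ^ k) powr p * \<delta> k = q ^ k" for k
  proof -
    have "q ^ k = 2 powr (- p * real k)" using q(1) by (simp add: q_def powr_powr flip: powr_realpow)
    moreover have "(2 ^ k :: real) powr p = 2 powr (real k * p)" by (simp add: powr_powr flip: powr_realpow)
    ultimately have "(2 ^ k) powr p * q ^ k = 1" by (simp add: mult.commute flip: powr_add)
    then show ?thesis unfolding \<delta>_def q_def[symmetric] by (simp flip: mult.assoc)
  qed
  then show "summable (\<lambda>k. (2 ^ k) powr p * \<delta> k)" using summable_geometric[of q] q by simp
  show "\<delta> \<longlonglongrightarrow> 0" by (rule summable_LIMSEQ_zero[OF s])
qed

lemma approx:
  assumes "f \<in> Lp_space p"
  shows "approx f k \<in> D" "Lp_int p (\<lambda>x. approx f k x - f x) \<le> \<delta> k"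
proof -
  have "\<exists>g. g \<in> D \<and> Lp_int p (\<lambda>x. g x - f x) < \<delta> k" using dense[OF assms \<delta>(1)] by blast
  from someI_ex[OF this] show "approx f k \<in> D" "Lp_int p (\<lambda>x. approx f k x - f x) \<le> \<delta> k"
    unfolding approx_def[symmetric] by auto
qed

text \<open>Two approximations of the same function differ by elements of size
  \<open>\<delta> k\<close>; their images then have the same limit almost everywhere. Linearity of
  \<open>ext\<close> and its agreement with \<open>S\<close> on \<open>D\<close> rest on
  this.\<close>

lemma S_null:
  assumes G: "\<And>k. G k \<in> D" and le: "\<And>k. Lp_int p (G k) \<le> B * \<delta> k"
  shows "AE x in lebesgue. (\<lambda>k. S (G k) x) \<longlonglongrightarrow> 0"
proof (rule AE_tendsto_0_of_summable_Lp_int)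
  show "S (G k) \<in> Lp_space p" for k using S_Lp G by blast
  show "summable (\<lambda>k. Lp_int p (S (G k)))"
  proof (rule summable_comparison_test)
    have "Lp_int p (S (G k)) \<le> C powr p * (B * \<delta> k)" for k
      by (rule order_trans[OF S_bound[OF G] mult_left_mono[OF le]]) simp
    then show "\<exists>N. \<forall>k\<ge>N. norm (Lp_int p (S (G k))) \<le> C powr p * (B * \<delta> k)"
      by (simp add: Lp_int_nonneg)
    show "summable (\<lambda>k. C powr p * (B * \<delta> k))" by (intro summable_mult \<delta>)
  qed
qed (use p in simp)

text \<open>Summability of the powers shows only that a sequence tends to 0 pointwise. Applied to
  the consecutive differences multiplied by \<open>2 ^ k\<close>, it makes these differences
  eventually smaller than \<open>(1 / 2) ^ k\<close>, so that their telescoping series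
  converges.\<close>

lemma ext_limit:
  assumes f: "f \<in> Lp_space p"
  shows "AE x in lebesgue. (\<lambda>k. S (approx f k) x) \<longlonglongrightarrow> ext f x"
proof -
  note aD = approx(1)[OF f] and aL = subsetD[OF D_Lp approx(1)[OF f]]
  define w where "w k = (\<lambda>x. 2 ^ k *\<^sub>R S (\<lambda>x. approx f (Suc k) x - approx f k x) x)" for k
  define B where "B = 2 powr (p - 1) * 2"
  have diff: "Lp_int p (\<lambda>x. approx f (Suc k) x - approx f k x) \<le> B * \<delta> k" for k
  proof -
    have "Lp_int p (\<lambda>x. (approx f (Suc k) x - f x) - (approx f k x - f x))
      \<le> 2 powr (p - 1) * (Lp_int p (\<lambda>x. approx f (Suc k) x - f x) + Lp_int p (\<lambda>x. approx f k x - f x))"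
      using p by (intro Lp_space_diff aL f) auto
    also have "\<dots> \<le> 2 powr (p - 1) * (\<delta> k + \<delta> k)"
      using approx(2)[OF f, of k] approx(2)[OF f, of "Suc k"] \<delta>(2)[of k] by (intro mult_left_mono) auto
    finally show ?thesis by (simp add: B_def)
  qed
  have "AE x in lebesgue. (\<lambda>k. w k x) \<longlonglongrightarrow> 0"
  proof (rule AE_tendsto_0_of_summable_Lp_int)
    have SL: "S (\<lambda>x. approx f (Suc k) x - approx f k x) \<in> Lp_space p" for k by (intro S_Lp D_diff aD)
    show "w k \<in> Lp_space p" for k unfolding w_def by (rule Lp_space_scaleR(1)[OF SL])
    show "summable (\<lambda>k. Lp_int p (w k))"
    proof (rule summable_comparison_test)
      have "Lp_int p (w k) \<le> (C powr p * B) * ((2 ^ k) powr p * \<delta> k)" for k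
      proof -
        have "Lp_int p (w k) \<le> (2 ^ k) powr p * (C powr p * (B * \<delta> k))"
          unfolding w_def Lp_space_scaleR(2)[OF SL] abs_of_pos[OF zero_less_power[OF zero_less_numeral]]
          by (intro mult_left_mono order_trans[OF S_bound[OF D_diff[OF aD aD]]] diff) auto
        then show ?thesis by (simp add: mult_ac)
      qed
      then show "\<exists>N. \<forall>k\<ge>N. norm (Lp_int p (w k)) \<le> (C powr p * B) * ((2 ^ k) powr p * \<delta> k)"
        by (simp add: Lp_int_nonneg)
      show "summable (\<lambda>k. (C powr p * B) * ((2 ^ k) powr p * \<delta> k))" by (intro summable_mult \<delta>)
    qed
  qed (use p in simp)
  then show ?thesis
  proof eventually_elim
    case (elim x)
    define u where "u k = S (approx f k) x" for k
    have w: "w k x = 2 ^ k *\<^sub>R (u (Suc k) - u k)" for k unfolding w_def u_def S_diff[OF aD aD] ..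
    from elim have "\<forall>\<^sub>F k in sequentially. norm (w k x) < 1"
      by (rule order_tendstoD(2)[OF tendsto_norm_zero zero_less_one])
    then obtain K where K: "\<And>k. k \<ge> K \<Longrightarrow> norm (w k x) < 1" unfolding eventually_sequentially by blast
    have "summable (\<lambda>k. u (Suc k) - u k)"
    proof (rule summable_comparison_test)
      have "norm (u (Suc k) - u k) \<le> (1 / 2) ^ k" if "k \<ge> K" for k
      proof -
        have "norm (w k x) = 2 ^ k * norm (u (Suc k) - u k)" unfolding w norm_scaleR by simp
        with K[OF that] show ?thesis by (simp add: power_divide field_simps)
      qed
      then show "\<exists>N. \<forall>k\<ge>N. norm (u (Suc k) - u k) \<le> (1 / 2) ^ k" by blast
      show "summable (\<lambda>k. (1 / 2 :: real) ^ k)" by (rule summable_geometric) simp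
    qed
    then have "convergent (\<lambda>n. \<Sum>k<n. u (Suc k) - u k)" by (simp add: summable_iff_convergent)
    then have "convergent (\<lambda>n. u n - u 0)" by (simp add: sum_lessThan_telescope)
    then obtain l where "(\<lambda>n. u n - u 0) \<longlonglongrightarrow> l" by (auto simp: convergent_def)
    from tendsto_add[OF this tendsto_const[of "u 0"]] have "convergent u" by (auto simp: convergent_def)
    then show ?case unfolding u_def ext_def by (rule convergent_LIMSEQ_iff[THEN iffD1])
  qed
qed

lemma ext_measurable: "f \<in> Lp_space p \<Longrightarrow> ext f \<in> borel_measurable lebesgue"
  unfolding ext_def[abs_def] by (intro borel_measurable_lim_metric Lp_spaceD(1)[OF S_Lp] approx)

text \<open>To preserve the constant \<open>C\<close>, the function
  \<open>f + (approx f k - f)\<close> is split with weights \<open>1 - s\<close> and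
  \<open>s\<close>. For fixed \<open>s\<close> the term with \<open>\<delta> k\<close> disappears as
  \<open>k\<close> grows, by Fatou; afterwards letting \<open>s\<close> tend to 0 removes the factor
  \<open>(1 - s) powr (1 - p)\<close>.\<close>

lemma ext_Lp:
  assumes f: "f \<in> Lp_space p"
  shows "ext f \<in> Lp_space p" "Lp_int p (ext f) \<le> C powr p * Lp_int p f"
proof -
  note aD = approx(1)[OF f] and aL = subsetD[OF D_Lp approx(1)[OF f]]
  have main: "ext f \<in> Lp_space p \<and> Lp_int p (ext f) \<le> C powr p * ((1 - s) powr (1 - p) * Lp_int p f)"
    if s: "0 < s" "s < 1" for s
  proof -
    have b: "Lp_int p (S (approx f k)) \<le> C powr p * ((1 - s) powr (1 - p) * Lp_int p f + s powr (1 - p) * \<delta> k)" for k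
    proof -
      have "Lp_int p (\<lambda>x. f x + (approx f k x - f x)) \<le> (1 - s) powr (1 - p) * Lp_int p f + s powr (1 - p) * Lp_int p (\<lambda>x. approx f k x - f x)"
        using p s by (intro Lp_space_add Lp_space_diff aL f) auto
      also have "\<dots> \<le> (1 - s) powr (1 - p) * Lp_int p f + s powr (1 - p) * \<delta> k"
        by (intro add_left_mono mult_left_mono approx f) auto
      finally show ?thesis
        by (intro order_trans[OF S_bound[OF aD]] mult_left_mono) auto
    qed
    have l: "(\<lambda>k. C powr p * ((1 - s) powr (1 - p) * Lp_int p f + s powr (1 - p) * \<delta> k))
       \<longlonglongrightarrow> C powr p * ((1 - s) powr (1 - p) * Lp_int p f + s powr (1 - p) * 0)"
      by (intro tendsto_intros \<delta>)
    show ?thesis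
      using Lp_Fatou[OF S_Lp[OF aD] ext_measurable[OF f] ext_limit[OF f] b l] p by simp
  qed
  from main[of "1/2"] show "ext f \<in> Lp_space p" by simp
  have l: "(\<lambda>k. C powr p * ((1 - inverse (real (Suc (Suc k)))) powr (1 - p) * Lp_int p f)) \<longlonglongrightarrow> C powr p * ((1 - 0) powr (1 - p) * Lp_int p f)"
    by (intro tendsto_intros LIMSEQ_Suc[OF LIMSEQ_inverse_real_of_nat]) auto
  have "Lp_int p (ext f) \<le> C powr p * ((1 - 0) powr (1 - p) * Lp_int p f)"
  proof (rule LIMSEQ_le_const[OF l], intro exI allI impI)
    fix k
    have "0 < inverse (real (Suc (Suc k)))" "inverse (real (Suc (Suc k))) < 1" by (auto simp: field_simps)
    then show "Lp_int p (ext f) \<le> C powr p * ((1 - inverse (real (Suc (Suc k)))) powr (1 - p) * Lp_int p f)"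
      using main by blast
  qed
  then show "Lp_int p (ext f) \<le> C powr p * Lp_int p f" by simp
qed

lemma ext_add:
  assumes f: "f \<in> Lp_space p" and g: "g \<in> Lp_space p"
  shows "AE x in lebesgue. ext (\<lambda>y. f y + g y) x = ext f x + ext g x"
proof -
  have h: "(\<lambda>y. f y + g y) \<in> Lp_space p" using Lp_space_add(1)[OF f g] p by simp
  let ?h = "\<lambda>y. f y + g y"
  define A where "A k = (\<lambda>x. approx f k x + approx g k x)" for k
  have A: "A k \<in> D" for k unfolding A_def by (intro D_add approx f g)
  define w where "w k = (\<lambda>x. approx ?h k x - A k x)" for k
  define B where "B = 2 powr (p - 1) * (1 + 2 powr (p - 1) * 2)"
  have "AE x in lebesgue. (\<lambda>k. S (w k) x) \<longlonglongrightarrow> 0"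
  proof (rule S_null)
    show "w k \<in> D" for k unfolding w_def by (intro D_diff approx h A)
    fix k
    have L: "(\<lambda>x. approx f k x - f x) \<in> Lp_space p" "(\<lambda>x. approx g k x - g x) \<in> Lp_space p" "(\<lambda>x. approx ?h k x - ?h x) \<in> Lp_space p"
      using p by (intro Lp_space_diff subsetD[OF D_Lp] approx f g h; simp)+
    \<comment> \<open>The target functions cancel: only the three approximation errors remain, each
      of size \<open>\<delta> k\<close>, and two quasi-triangle inequalities give the constant
      \<open>B\<close>.\<close>
    have "Lp_int p (\<lambda>x. (approx ?h k x - ?h x) - ((approx f k x - f x) + (approx g k x - g x)))
      \<le> 2 powr (p - 1) * (Lp_int p (\<lambda>x. approx ?h k x - ?h x) + Lp_int p (\<lambda>x. (approx f k x - f x) + (approx g k x - g x)))"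
      using p by (intro Lp_space_diff Lp_space_add L) auto
    also have "\<dots> \<le> 2 powr (p - 1) * (\<delta> k + 2 powr (p - 1) * (\<delta> k + \<delta> k))"
      using p by (intro mult_left_mono add_mono approx f g h order_trans[OF Lp_int_add_le[OF L(1,2)]]) auto
    finally show "Lp_int p (w k) \<le> B * \<delta> k"
      by (simp add: w_def A_def B_def algebra_simps)
  qed
  then show ?thesis using ext_limit[OF f] ext_limit[OF g] ext_limit[OF h]
  proof eventually_elim
    case (elim x)
    have "S (w k) x = S (approx ?h k) x - (S (approx f k) x + S (approx g k) x)" for k
      unfolding w_def S_diff[OF approx(1)[OF h] A] by (simp add: A_def S_add[OF approx(1)[OF f] approx(1)[OF g]])
    with elim(1) have "(\<lambda>k. S (approx ?h k) x - (S (approx f k) x + S (approx g k) x)) \<longlonglongrightarrow> 0" by simp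
    moreover have "(\<lambda>k. S (approx ?h k) x - (S (approx f k) x + S (approx g k) x)) \<longlonglongrightarrow> ext ?h x - (ext f x + ext g x)"
      by (intro tendsto_diff tendsto_add elim)
    ultimately show ?case using LIMSEQ_unique by fastforce
  qed
qed

lemma ext_scale:
  assumes f: "f \<in> Lp_space p"
  shows "AE x in lebesgue. ext (\<lambda>y. c * f y) x = c *\<^sub>R ext f x"
proof -
  let ?h = "\<lambda>y. c * f y"
  have h: "?h \<in> Lp_space p" using Lp_space_scaleR(1)[OF f, of c] by simp
  define w where "w k = (\<lambda>x. approx ?h k x - c * approx f k x)" for k
  define B where "B = 2 powr (p - 1) * (1 + \<bar>c\<bar> powr p)"
  have "AE x in lebesgue. (\<lambda>k. S (w k) x) \<longlonglongrightarrow> 0"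
  proof (rule S_null)
    show "w k \<in> D" for k unfolding w_def by (intro D_diff D_scale approx h f)
    fix k
    have L: "(\<lambda>x. approx f k x - f x) \<in> Lp_space p" "(\<lambda>x. approx ?h k x - ?h x) \<in> Lp_space p"
      using p by (intro Lp_space_diff subsetD[OF D_Lp] approx f h; simp)+
    have "Lp_int p (\<lambda>x. (approx ?h k x - ?h x) - c *\<^sub>R (approx f k x - f x))
      \<le> 2 powr (p - 1) * (Lp_int p (\<lambda>x. approx ?h k x - ?h x) + Lp_int p (\<lambda>x. c *\<^sub>R (approx f k x - f x)))"
      using p by (intro Lp_space_diff Lp_space_scaleR(1) L) auto
    also have "\<dots> \<le> 2 powr (p - 1) * (\<delta> k + \<bar>c\<bar> powr p * \<delta> k)"
      unfolding Lp_space_scaleR(2)[OF L(1)] by (intro mult_left_mono add_mono approx f h) auto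
    finally show "Lp_int p (w k) \<le> B * \<delta> k"
      by (simp add: w_def B_def algebra_simps)
  qed
  then show ?thesis using ext_limit[OF f] ext_limit[OF h]
  proof eventually_elim
    case (elim x)
    have "S (w k) x = S (approx ?h k) x - c *\<^sub>R S (approx f k) x" for k
      unfolding w_def S_diff[OF approx(1)[OF h] D_scale[OF approx(1)[OF f]]] S_scale[OF approx(1)[OF f]] ..
    with elim(1) have "(\<lambda>k. S (approx ?h k) x - c *\<^sub>R S (approx f k) x) \<longlonglongrightarrow> 0" by simp
    moreover have "(\<lambda>k. S (approx ?h k) x - c *\<^sub>R S (approx f k) x) \<longlonglongrightarrow> ext ?h x - c *\<^sub>R ext f x"
      by (intro tendsto_diff tendsto_scaleR tendsto_const elim)
    ultimately show ?case using LIMSEQ_unique by fastforce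
  qed
qed

lemma ext_extends:
  assumes f: "f \<in> D"
  shows "AE x in lebesgue. ext f x = S f x"
proof -
  have fL: "f \<in> Lp_space p" using f D_Lp by blast
  have "AE x in lebesgue. (\<lambda>k. S (\<lambda>x. approx f k x - f x) x) \<longlonglongrightarrow> 0"
    by (rule S_null[where B=1]) (use D_diff approx[OF fL] f in auto)
  then show ?thesis using ext_limit[OF fL]
  proof eventually_elim
    case (elim x)
    have "(\<lambda>k. S (approx f k) x - S f x) \<longlonglongrightarrow> 0"
      using elim(1) unfolding S_diff[OF approx(1)[OF fL] f] .
    from tendsto_add[OF this tendsto_const[of "S f x"]] have "(\<lambda>k. S (approx f k) x) \<longlonglongrightarrow> S f x" by simp
    with elim(2) show ?case by (rule LIMSEQ_unique)
  qed
qed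

lemma bounded_Lp_extension_ext: "bounded_Lp_extension p D S ext"
proof -
  have "\<forall>f\<in>Lp_space p. Lp_norm p (ext f) \<le> C * Lp_norm p f"
    using ext_Lp(2) Lp_norm_le_iff[of p C] p C by auto
  then show ?thesis
    unfolding bounded_Lp_extension_def using ext_Lp(1) ext_add ext_scale ext_extends by blast
qed

text \<open>Boundedness of \<open>T\<close> with any constant makes \<open>T\<close> of the
  approximation errors tend to 0 almost everywhere, because these errors were chosen summable; on
  the approximations themselves \<open>T\<close> is given by \<open>S\<close>.\<close>

lemma bounded_Lp_extension_unique:
  assumes T: "bounded_Lp_extension p D S T" and f: "f \<in> Lp_space p"
  shows "AE x in lebesgue. T f x = ext f x"
proof -
  from T obtain C0 where TL: "\<And>f. f \<in> Lp_space p \<Longrightarrow> T f \<in> Lp_space p"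
    and Tadd: "\<And>f g. f \<in> Lp_space p \<Longrightarrow> g \<in> Lp_space p \<Longrightarrow> AE x in lebesgue. T (\<lambda>y. f y + g y) x = T f x + T g x"
    and Tb: "\<And>f. f \<in> Lp_space p \<Longrightarrow> Lp_norm p (T f) \<le> C0 * Lp_norm p f"
    and TD: "\<And>f. f \<in> D \<Longrightarrow> AE x in lebesgue. T f x = S f x"
    unfolding bounded_Lp_extension_def by blast
  have Tb': "Lp_int p (T f) \<le> \<bar>C0\<bar> powr p * Lp_int p f" if "f \<in> Lp_space p" for f
  proof -
    have "C0 * Lp_norm p f \<le> \<bar>C0\<bar> * Lp_norm p f" by (intro mult_right_mono) (auto simp: Lp_norm_def)
    with Tb[OF that] have "Lp_norm p (T f) \<le> \<bar>C0\<bar> * Lp_norm p f" by simp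
    then show ?thesis using Lp_norm_le_iff[of p "\<bar>C0\<bar>"] p by auto
  qed
  define w where "w k = (\<lambda>x. f x - approx f k x)" for k
  have w: "w k \<in> Lp_space p" for k
    unfolding w_def using p by (intro Lp_space_diff f subsetD[OF D_Lp] approx) auto
  have wd: "Lp_int p (w k) \<le> \<delta> k" for k
    using approx(2)[OF f, of k] by (simp only: w_def Lp_int_def norm_minus_commute)
  have "AE x in lebesgue. (\<lambda>k. T (w k) x) \<longlonglongrightarrow> 0"
  proof (rule AE_tendsto_0_of_summable_Lp_int)
    show "summable (\<lambda>k. Lp_int p (T (w k)))"
    proof (rule summable_comparison_test)
      show "\<exists>N. \<forall>k\<ge>N. norm (Lp_int p (T (w k))) \<le> \<bar>C0\<bar> powr p * \<delta> k"
        using order_trans[OF Tb'[OF w] mult_left_mono[OF wd]] by (simp add: Lp_int_nonneg)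
      show "summable (\<lambda>k. \<bar>C0\<bar> powr p * \<delta> k)" by (intro summable_mult \<delta>)
    qed
  qed (use p TL w in auto)
  \<comment> \<open>Additivity of \<open>T\<close> and its agreement with \<open>S\<close> hold
    outside a null set depending on \<open>k\<close>; countably many of these are joined.\<close>
  moreover have "AE x in lebesgue. \<forall>k. T f x = T (w k) x + S (approx f k) x"
  proof (rule AE_all_countable[THEN iffD2], rule allI)
    fix k
    have "AE x in lebesgue. T (\<lambda>y. w k y + approx f k y) x = T (w k) x + T (approx f k) x"
      by (intro Tadd w subsetD[OF D_Lp] approx f)
    moreover have "(\<lambda>y. w k y + approx f k y) = f" by (simp add: w_def)
    ultimately have "AE x in lebesgue. T f x = T (w k) x + T (approx f k) x" by simp
    then show "AE x in lebesgue. T f x = T (w k) x + S (approx f k) x"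
      using TD[OF approx(1)[OF f, of k]] by eventually_elim simp
  qed
  ultimately show ?thesis using ext_limit[OF f]
  proof eventually_elim
    case (elim x)
    have "(\<lambda>k. T (w k) x + S (approx f k) x) \<longlonglongrightarrow> 0 + ext f x" by (intro tendsto_add elim)
    then have "(\<lambda>k. T f x) \<longlonglongrightarrow> ext f x" using elim(2) by simp
    then show ?case by (simp add: LIMSEQ_const_iff)
  qed
qed

end

subsection \<open>Density of the Hermite functions\<close>

lemma hermite_span_iff: "f \<in> hermite_span \<longleftrightarrow> (\<exists>N c. finite N \<and> f = hexp N (c :: nat ^ 'd \<Rightarrow> real))"
  for f :: "real ^ 'd::finite \<Rightarrow> real"
  by (simp add: hermite_span_def hexp_def[abs_def] mult.commute)

lemma hexp_extend:
  assumes "finite N'" "N \<subseteq> N'"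
  shows "hexp N c = hexp N' (\<lambda>n. if n \<in> N then c n else 0)"
  unfolding hexp_def[abs_def] using assms
  by (intro ext sum.mono_neutral_cong_left) auto

lemma hermite_span_common:
  fixes f g :: "real ^ 'd::finite \<Rightarrow> real"
  assumes "f \<in> hermite_span" "g \<in> hermite_span"
  obtains N c d where "finite N" "f = hexp N c" "g = hexp N d"
proof -
  from assms obtain N1 c1 N2 c2 where *: "finite N1" "f = hexp N1 c1" "finite N2" "g = hexp N2 c2"
    by (auto simp: hermite_span_iff)
  show ?thesis
    by (rule that[of "N1 \<union> N2"])
       (use * hexp_extend[of "N1 \<union> N2" N1 c1] hexp_extend[of "N1 \<union> N2" N2 c2] in auto)
qed

lemma hermite_span_add: "f \<in> hermite_span \<Longrightarrow> g \<in> hermite_span \<Longrightarrow> (\<lambda>x. f x + g x) \<in> hermite_span"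
proof -
  assume "f \<in> hermite_span" "g \<in> hermite_span"
  then obtain N c d where *: "finite N" "f = hexp N c" "g = hexp N d" by (rule hermite_span_common)
  then have "(\<lambda>x. f x + g x) = hexp N (\<lambda>n. c n + d n)"
    by (simp add: hexp_def[abs_def] sum.distrib distrib_left)
  then show ?thesis using *(1) by (auto simp: hermite_span_iff)
qed

lemma hermite_span_scale: "f \<in> hermite_span \<Longrightarrow> (\<lambda>x. a * f x) \<in> hermite_span"
proof -
  assume "f \<in> hermite_span"
  then obtain N c where *: "finite N" "f = hexp N c" by (auto simp: hermite_span_iff)
  then have "(\<lambda>x. a * f x) = hexp N (\<lambda>n. a * c n)"
    by (simp add: hexp_def[abs_def] sum_distrib_left mult_ac)
  then show ?thesis using *(1) by (auto simp: hermite_span_iff)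
qed

lemma hermite_fun_in_span: "hermite_fun n \<in> hermite_span"
proof -
  have "hermite_fun n = hexp {n} (\<lambda>_. 1)" by (simp add: hexp_def[abs_def])
  then show ?thesis unfolding hermite_span_iff by blast
qed

lemma hermite_span_sum:
  fixes f :: "'i \<Rightarrow> real ^ 'd::finite \<Rightarrow> real"
  assumes "finite A" "\<And>a. a \<in> A \<Longrightarrow> f a \<in> hermite_span"
  shows "(\<lambda>x. \<Sum>a\<in>A. f a x) \<in> hermite_span"
  using assms
proof (induction A rule: finite_induct)
  case empty
  have "(\<lambda>x::real^'d. 0) = hexp {} (\<lambda>_. 0)" by (simp add: hexp_def[abs_def])
  then show ?case unfolding hermite_span_iff by auto
next
  case (insert a A)
  then show ?case using hermite_span_add[of "f a" "\<lambda>x. \<Sum>a\<in>A. f a x"] by simp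
qed

text \<open>By the three-term relation. The span is thus closed under multiplication by polynomials,
  which admits Taylor polynomials of \<open>gauss\<close> as factors.\<close>

lemma hermite_span_mult_coordinate: "f \<in> hermite_span \<Longrightarrow> (\<lambda>x. x $ i * f x) \<in> hermite_span"
proof -
  assume "f \<in> hermite_span"
  then obtain N c where *: "finite N" "f = hexp N c" by (auto simp: hermite_span_iff)
  have "x $ i * f x = (\<Sum>n\<in>N. (c n * sqrt (2 * real (n $ i) + 2) / 2) * hermite_fun (n + axis i 1) x
      + (c n * sqrt (2 * real (n $ i)) / 2) * hermite_fun (n - axis i 1) x)" for x
    unfolding *(2) hexp_def sum_distrib_left
  proof (rule sum.cong[OF refl])
    fix n
    have "x $ i * hermite_fun n x *\<^sub>R c n = (2 * x $ i * hermite_fun n x) * (c n / 2)" by simp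
    also have "\<dots> = (c n * sqrt (2 * real (n $ i) + 2) / 2) * hermite_fun (n + axis i 1) x
      + (c n * sqrt (2 * real (n $ i)) / 2) * hermite_fun (n - axis i 1) x"
      unfolding hermite_fun_three_term by (simp add: algebra_simps)
    finally show "x $ i * hermite_fun n x *\<^sub>R c n = (c n * sqrt (2 * real (n $ i) + 2) / 2) * hermite_fun (n + axis i 1) x
      + (c n * sqrt (2 * real (n $ i)) / 2) * hermite_fun (n - axis i 1) x" .
  qed
  moreover have "(\<lambda>x. \<Sum>n\<in>N. (c n * sqrt (2 * real (n $ i) + 2) / 2) * hermite_fun (n + axis i 1) x
      + (c n * sqrt (2 * real (n $ i)) / 2) * hermite_fun (n - axis i 1) x) \<in> hermite_span"
    by (intro hermite_span_sum hermite_span_add hermite_span_scale hermite_fun_in_span *)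
  ultimately show ?thesis by simp
qed

lemma hermite_span_bound:
  fixes f :: "real ^ 'd::finite \<Rightarrow> real"
  assumes "f \<in> hermite_span"
  shows "\<exists>C\<ge>0. \<forall>x. \<bar>f x\<bar> \<le> C * exp (- 3 / 8 * (norm x)\<^sup>2)"
proof -
  obtain N c where *: "finite N" "f = hexp N c" using assms by (auto simp: hermite_span_iff)
  have "\<forall>m :: nat ^ 'd. \<exists>C. 0 \<le> C \<and> (\<forall>x. \<bar>hermite_fun m x\<bar> \<le> C * exp (- 3 / 8 * (norm x)\<^sup>2))"
    using hermite_fun_bound by blast
  from choice[OF this] obtain C where C: "\<And>(m :: nat ^ 'd) x. \<bar>hermite_fun m x\<bar> \<le> C m * exp (- 3 / 8 * (norm x)\<^sup>2)"
    "\<And>m. C m \<ge> 0" by blast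
  have "\<bar>f x\<bar> \<le> (\<Sum>n\<in>N. C n * norm (c n)) * exp (- 3 / 8 * (norm x)\<^sup>2)" for x
    using norm_sum_scaleR_bound[of N "\<lambda>n. hermite_fun n x" C "exp (- 3 / 8 * (norm x)\<^sup>2)" c] C(1)
    by (simp add: *(2) hexp_def)
  moreover have "0 \<le> (\<Sum>n\<in>N. C n * norm (c n))" by (intro sum_nonneg mult_nonneg_nonneg C) auto
  ultimately show ?thesis by blast
qed

lemma borel_measurable_hermite_span: "f \<in> hermite_span \<Longrightarrow> f \<in> borel_measurable borel"
  by (auto simp: hermite_span_iff)

lemma borel_imp_lebesgue_measurable: "f \<in> borel_measurable borel \<Longrightarrow> f \<in> borel_measurable lebesgue"
  by (simp add: measurable_completion)

lemma Lp_space_of_exp_bound: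
  fixes f :: "real ^ 'd::finite \<Rightarrow> 'b::euclidean_space"
  assumes f: "f \<in> borel_measurable borel" and b: "\<And>x. norm (f x) \<le> C * exp (- c * (norm x)\<^sup>2)"
    and c: "0 < c" and p: "0 < p"
  shows "f \<in> Lp_space p"
proof -
  note [measurable] = f borel_imp_lebesgue_measurable[OF f]
  have C: "0 \<le> C" using order_trans[OF norm_ge_zero b[of 0]] by simp
  have "integrable lborel (\<lambda>x::real^'d. C powr p * exp (- (p * c) * (norm x)\<^sup>2))"
    by (intro integrable_mult_right integrable_exp_neg_norm_square) (use c p in simp)
  then have "integrable lborel (\<lambda>x. norm (f x) powr p)"
  proof (rule Bochner_Integration.integrable_bound)
    have "norm (f x) powr p \<le> C powr p * exp (- (p * c) * (norm x)\<^sup>2)" for x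
    proof -
      have "norm (f x) powr p \<le> (C * exp (- c * (norm x)\<^sup>2)) powr p" using b p by (intro powr_mono2) auto
      also have "\<dots> = C powr p * exp (- (p * c) * (norm x)\<^sup>2)"
        using C by (simp add: powr_mult exp_powr_real mult_ac)
      finally show ?thesis .
    qed
    then show "AE x in lborel. norm (norm (f x) powr p) \<le> norm (C powr p * exp (- (p * c) * (norm x)\<^sup>2))"
      by (intro AE_I2) (simp add: abs_mult)
  qed measurable
  then have "integrable lebesgue (\<lambda>x. norm (f x) powr p)"
    by (subst integrable_completion) measurable
  then show ?thesis by (simp add: Lp_space_def)
qed

lemma hermite_span_Lp: "0 < p \<Longrightarrow> f \<in> hermite_span \<Longrightarrow> f \<in> Lp_space p"
proof -
  assume p: "0 < p" and f: "f \<in> hermite_span"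
  obtain C where "\<And>x. \<bar>f x\<bar> \<le> C * exp (- 3 / 8 * (norm x)\<^sup>2)" using hermite_span_bound[OF f] by blast
  then show ?thesis using p by (intro Lp_space_of_exp_bound[where c="3/8" and C=C] borel_measurable_hermite_span f) auto
qed

lemma Lp_int_tendsto_0:
  fixes F :: "nat \<Rightarrow> 'a::euclidean_space \<Rightarrow> 'b::euclidean_space"
  assumes F: "\<And>k. F k \<in> borel_measurable lebesgue" and f: "f \<in> borel_measurable lebesgue"
    and lim: "AE x in lebesgue. (\<lambda>k. F k x) \<longlonglongrightarrow> f x"
    and w: "w \<in> Lp_space p" "\<And>k x. norm (F k x - f x) \<le> norm (w x)" and p: "0 < p"
  shows "(\<lambda>k. Lp_int p (\<lambda>x. F k x - f x)) \<longlonglongrightarrow> 0"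
proof -
  note [measurable] = F f
  have "(\<lambda>k. LINT x|lebesgue. norm (F k x - f x) powr p) \<longlonglongrightarrow> (LINT x|(lebesgue :: 'a measure). 0)"
  proof (rule integral_dominated_convergence[where w = "\<lambda>x. norm (w x) powr p"])
    show "integrable lebesgue (\<lambda>x. norm (w x) powr p)" by (rule Lp_spaceD[OF w(1)])
    show "AE x in lebesgue. norm (norm (F k x - f x) powr p) \<le> norm (w x) powr p" for k
      using w(2) p by (intro AE_I2) (auto intro: powr_mono2)
    show "AE x in lebesgue. (\<lambda>k. norm (F k x - f x) powr p) \<longlonglongrightarrow> 0"
      using lim
    proof eventually_elim
      case (elim x)
      have "(\<lambda>k. norm (F k x - f x)) \<longlonglongrightarrow> 0" by (rule tendsto_norm_zero[OF LIM_zero[OF elim]])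
      then have "(\<lambda>k. norm (F k x - f x) powr p) \<longlonglongrightarrow> 0 powr p" using p by (intro tendsto_powr') auto
      then show ?case by simp
    qed
  qed measurable
  then show ?thesis by (simp add: Lp_int_def)
qed

lemma Lp_space_dominated:
  assumes g: "g \<in> Lp_space p" and [measurable]: "f \<in> borel_measurable lebesgue"
    and le: "\<And>x. norm (f x) \<le> norm (g x)" and p: "0 < p"
  shows "f \<in> Lp_space p"
proof -
  have "integrable lebesgue (\<lambda>x. norm (f x) powr p)"
    by (rule Bochner_Integration.integrable_bound[OF Lp_spaceD(2)[OF g]])
       (use le p in \<open>auto intro!: AE_I2 powr_mono2\<close>)
  then show ?thesis by (simp add: Lp_space_def)
qed

lemma Lp_space_norm: "f \<in> Lp_space p \<Longrightarrow> (\<lambda>x. norm (f x)) \<in> Lp_space p"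
  by (auto simp: Lp_space_def intro: borel_measurable_norm)

section \<open>The closure of the Hermite span\<close>

definition approximable :: "real \<Rightarrow> (real ^ 'd::finite \<Rightarrow> real) \<Rightarrow> bool" where
  "approximable p f \<longleftrightarrow> f \<in> Lp_space p \<and> (\<forall>\<epsilon>>0. \<exists>g\<in>hermite_span. Lp_int p (\<lambda>x. g x - f x) < \<epsilon>)"

lemma approximable_limit:
  assumes p: "1 \<le> p" and f: "f \<in> Lp_space p" and F: "\<And>k. approximable p (F k)"
    and lim: "(\<lambda>k. Lp_int p (\<lambda>x. F k x - f x)) \<longlonglongrightarrow> 0"
  shows "approximable p f"
  unfolding approximable_def
proof (intro conjI allI impI f)
  fix \<epsilon> :: real assume e: "0 < \<epsilon>"
  define A where "A = 2 * 2 powr (p - 1)"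
  have A: "0 < A" by (simp add: A_def)
  have "0 < \<epsilon> / A" using e A by simp
  from order_tendstoD(2)[OF lim this] obtain k where k: "Lp_int p (\<lambda>x. F k x - f x) < \<epsilon> / A"
    unfolding eventually_sequentially by blast
  obtain g where g: "g \<in> hermite_span" "Lp_int p (\<lambda>x. g x - F k x) < \<epsilon> / A"
    using F[of k] \<open>0 < \<epsilon> / A\<close> unfolding approximable_def by blast
  have FL: "F k \<in> Lp_space p" using F by (simp add: approximable_def)
  have gL: "g \<in> Lp_space p" using g(1) p by (intro hermite_span_Lp) auto
  have "Lp_int p (\<lambda>x. (g x - F k x) + (F k x - f x)) \<le> 2 powr (p - 1) * (Lp_int p (\<lambda>x. g x - F k x) + Lp_int p (\<lambda>x. F k x - f x))"
    by (intro Lp_int_add_le Lp_space_diff(1) f FL gL p)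
  also have "\<dots> < 2 powr (p - 1) * (\<epsilon> / A + \<epsilon> / A)"
    using k g(2) by (intro mult_strict_left_mono add_strict_mono) auto
  also have "\<dots> = \<epsilon>" using A by (simp add: A_def field_simps)
  finally show "\<exists>g\<in>hermite_span. Lp_int p (\<lambda>x. g x - f x) < \<epsilon>" using g(1) by auto
qed

lemma approximable_add:
  assumes p: "1 \<le> p" and f: "approximable p f" and g: "approximable p g"
  shows "approximable p (\<lambda>x. f x + g x)"
  unfolding approximable_def
proof (intro conjI allI impI)
  have fL: "f \<in> Lp_space p" and gL: "g \<in> Lp_space p" using f g by (simp_all add: approximable_def)
  show "(\<lambda>x. f x + g x) \<in> Lp_space p" by (rule Lp_space_add(1)[OF fL gL p])
  fix \<epsilon> :: real assume e: "0 < \<epsilon>"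
  define A where "A = 2 * 2 powr (p - 1)"
  have A: "0 < A" by (simp add: A_def)
  have eA: "0 < \<epsilon> / A" using e A by simp
  obtain f' where f': "f' \<in> hermite_span" "Lp_int p (\<lambda>x. f' x - f x) < \<epsilon> / A"
    using f eA unfolding approximable_def by blast
  obtain g' where g': "g' \<in> hermite_span" "Lp_int p (\<lambda>x. g' x - g x) < \<epsilon> / A"
    using g eA unfolding approximable_def by blast
  have L: "f' \<in> Lp_space p" "g' \<in> Lp_space p" using f'(1) g'(1) p by (auto intro: hermite_span_Lp)
  have "Lp_int p (\<lambda>x. (f' x - f x) + (g' x - g x)) \<le> 2 powr (p - 1) * (Lp_int p (\<lambda>x. f' x - f x) + Lp_int p (\<lambda>x. g' x - g x))"
    by (intro Lp_int_add_le Lp_space_diff(1) fL gL L p)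
  also have "\<dots> < 2 powr (p - 1) * (\<epsilon> / A + \<epsilon> / A)"
    using f'(2) g'(2) by (intro mult_strict_left_mono add_strict_mono) auto
  also have "\<dots> = \<epsilon>" using A by (simp add: A_def field_simps)
  finally show "\<exists>h\<in>hermite_span. Lp_int p (\<lambda>x. h x - (f x + g x)) < \<epsilon>"
    using hermite_span_add[OF f'(1) g'(1)] by (intro bexI[of _ "\<lambda>x. f' x + g' x"]) (auto simp: algebra_simps)
qed

text \<open>One factor \<open>gauss\<close> is replaced by its Taylor polynomials in
  \<open>- (norm x)\<^sup>2 / 4\<close>, which keep \<open>g\<close> in the span. They are bounded
  by \<open>exp ((norm x)\<^sup>2 / 4)\<close>; the rate 3/8 of \<open>g\<close> absorbs this once
  and retains 1/8 for the majorant. A higher power expanded at once would exhaust the decay, so the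
  factors are peeled off one at a time.\<close>

lemma approximable_mult_gauss_power:
  fixes g :: "real ^ 'd::finite \<Rightarrow> real"
  assumes p: "1 \<le> p"
  shows "g \<in> hermite_span \<Longrightarrow> approximable p (\<lambda>x. g x * gauss x ^ m)"
proof (induction m arbitrary: g)
  case 0
  have "Lp_int p (\<lambda>x. g x - g x) = 0" using p by (simp add: Lp_int_def)
  then show ?case using 0 hermite_span_Lp[OF _ 0] p unfolding approximable_def by force
next
  case (Suc m)
  define y where "y x = - (norm x)\<^sup>2 / 4" for x :: "real ^ 'd"
  define P where "P K x = (\<Sum>j<K. y x ^ j /\<^sub>R fact j)" for K x
  have ypow: "h \<in> hermite_span \<Longrightarrow> (\<lambda>x. y x ^ j * h x) \<in> hermite_span" for h j
  proof (induction j)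
    case (Suc j)
    have "(\<lambda>x. (- 1 / 4) * (\<Sum>i\<in>UNIV. x $ i * (x $ i * (y x ^ j * h x)))) \<in> hermite_span"
      by (intro hermite_span_scale hermite_span_sum hermite_span_mult_coordinate Suc) auto
    moreover have "(\<Sum>i\<in>UNIV. x $ i * (x $ i * t)) = (norm x)\<^sup>2 * t" for t and x :: "real ^ 'd"
      unfolding norm_square_vec sum_distrib_right by (simp add: power2_eq_square mult.assoc)
    moreover have "y x ^ Suc j * h x = (- 1 / 4) * ((norm x)\<^sup>2 * (y x ^ j * h x))" for x
      by (simp add: y_def)
    ultimately show ?case by simp
  qed simp
  have gP: "(\<lambda>x. g x * P K x) \<in> hermite_span" for K
  proof -
    have "(\<lambda>x. \<Sum>j<K. inverse (fact j) * (y x ^ j * g x)) \<in> hermite_span"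
      by (intro hermite_span_sum hermite_span_scale ypow Suc) auto
    then show ?thesis by (simp add: P_def sum_distrib_left mult_ac)
  qed
  obtain C where C: "0 \<le> C" "\<And>x. \<bar>g x\<bar> \<le> C * exp (- 3 / 8 * (norm x)\<^sup>2)" using hermite_span_bound[OF Suc.prems] by blast
  have gm [measurable]: "g \<in> borel_measurable borel" by (rule borel_measurable_hermite_span[OF Suc.prems])
  have gauss_m [measurable]: "(gauss :: real ^ 'd \<Rightarrow> real) \<in> borel_measurable borel" unfolding gauss_def[abs_def] by measurable
  have P_m [measurable]: "P K \<in> borel_measurable borel" for K unfolding P_def[abs_def] y_def[abs_def] by measurable
  define w where "w x = (2 * C) * exp (- (1/8) * (norm x)\<^sup>2)" for x :: "real ^ 'd"
  have wL: "w \<in> Lp_space p"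
    by (rule Lp_space_of_exp_bound[where C="2*C" and c="1/8"]) (use C(1) p in \<open>auto simp: w_def[abs_def]\<close>)
  have gauss_pow: "\<bar>gauss x ^ k\<bar> \<le> 1" for x :: "real ^ 'd" and k
    using gauss_le_1[of x] by (simp add: power_le_one)
  have Pb: "\<bar>P K x\<bar> \<le> exp ((norm x)\<^sup>2 / 4)" for K x
  proof -
    have "\<bar>P K x\<bar> \<le> (\<Sum>j<K. ((norm x)\<^sup>2 / 4) ^ j /\<^sub>R fact j)"
      unfolding P_def by (rule order_trans[OF sum_abs]) (simp add: y_def abs_mult power_abs)
    also have "\<dots> \<le> (\<Sum>j. ((norm x)\<^sup>2 / 4) ^ j /\<^sub>R fact j)"
      by (rule sum_le_suminf[OF summable_exp_generic]) auto
    finally show ?thesis by (simp add: exp_def)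
  qed
  have lim: "(\<lambda>K. P K x) \<longlonglongrightarrow> gauss x" for x
    using exp_converges[of "y x"] unfolding sums_def P_def gauss_def y_def by simp
  have bd: "\<bar>g x * P K x * gauss x ^ m - g x * gauss x ^ Suc m\<bar> \<le> w x" for K x
  proof -
    have "\<bar>g x * P K x * gauss x ^ m - g x * gauss x ^ Suc m\<bar> = \<bar>g x\<bar> * \<bar>P K x - gauss x\<bar> * \<bar>gauss x ^ m\<bar>"
    proof -
      have "g x * P K x * gauss x ^ m - g x * gauss x ^ Suc m = g x * (P K x - gauss x) * gauss x ^ m"
        by (simp add: algebra_simps)
      then show ?thesis by (simp only: abs_mult)
    qed
    also have "\<dots> \<le> (C * exp (- 3 / 8 * (norm x)\<^sup>2)) * (2 * exp ((norm x)\<^sup>2 / 4)) * 1"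
    proof (intro mult_mono C gauss_pow)
      have "gauss x \<le> exp ((norm x)\<^sup>2 / 4)" by (simp add: gauss_def)
      then show "\<bar>P K x - gauss x\<bar> \<le> 2 * exp ((norm x)\<^sup>2 / 4)" using Pb[of K x] gauss_pos(2)[of x] by linarith
    qed (use C(1) in auto)
    also have "\<dots> = w x" by (simp add: w_def flip: exp_add)
    finally show ?thesis .
  qed
  show ?case
  proof (rule approximable_limit[OF p])
    show "approximable p (\<lambda>x. g x * P K x * gauss x ^ m)" for K by (rule Suc.IH[OF gP])
    show "(\<lambda>x. g x * gauss x ^ Suc m) \<in> Lp_space p"
    proof (rule Lp_space_of_exp_bound[where C=C and c="3/8"])
      show "norm (g x * gauss x ^ Suc m) \<le> C * exp (- (3/8) * (norm x)\<^sup>2)" for x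
        using mult_mono[OF C(2)[of x] gauss_pow[of x "Suc m"]] C(1) by (simp add: abs_mult)
    qed (use p in auto)
    show "(\<lambda>K. Lp_int p (\<lambda>x. g x * P K x * gauss x ^ m - g x * gauss x ^ Suc m)) \<longlonglongrightarrow> 0"
    proof (rule Lp_int_tendsto_0[OF _ _ _ wL])
      show "AE x in lebesgue. (\<lambda>K. g x * P K x * gauss x ^ m) \<longlonglongrightarrow> g x * gauss x ^ Suc m"
        unfolding power_Suc mult.assoc by (intro AE_I2 tendsto_intros lim)
      show "norm (g x * P K x * gauss x ^ m - g x * gauss x ^ Suc m) \<le> norm (w x)" for K x
        using order_trans[OF bd abs_ge_self] by simp
    qed (use p in \<open>auto intro!: borel_imp_lebesgue_measurable\<close>)
  qed
qed

text \<open>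
  Composing with \<open>x \<mapsto> (gauss x, gauss x *\<^sub>R x)\<close> makes a function with compact support the
  restriction of a continuous function on a bounded set, to which Stone--Weierstrass applies. The
  polynomials in this map, multiplied by a Hermite function, lie in the following set.
\<close>

inductive_set gauss_span :: "(real ^ 'd::finite \<Rightarrow> real) set" where
  base: "g \<in> hermite_span \<Longrightarrow> (\<lambda>x. g x * gauss x ^ m) \<in> gauss_span"
| add: "f \<in> gauss_span \<Longrightarrow> g \<in> gauss_span \<Longrightarrow> (\<lambda>x. f x + g x) \<in> gauss_span"

lemma gauss_span_approximable:
  assumes p: "1 \<le> p" and w: "w \<in> gauss_span"
  shows "approximable p w"
  using w by induction (auto intro: approximable_mult_gauss_power[OF p] approximable_add[OF p])

lemma gauss_span_scale: "w \<in> gauss_span \<Longrightarrow> (\<lambda>x. a * w x) \<in> gauss_span"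
proof (induction rule: gauss_span.induct)
  case (base g m)
  then show ?case using gauss_span.base[OF hermite_span_scale[of g a], of m] by (simp add: mult.assoc)
next
  case (add f g)
  then show ?case using gauss_span.add[OF add.IH] by (simp add: distrib_left)
qed

lemma gauss_span_mult_coordinate: "w \<in> gauss_span \<Longrightarrow> (\<lambda>x. x $ i * w x) \<in> gauss_span"
proof (induction rule: gauss_span.induct)
  case (base g m)
  then show ?case using gauss_span.base[OF hermite_span_mult_coordinate[of g i], of m] by (simp add: mult.assoc)
next
  case (add f g)
  then show ?case using gauss_span.add[OF add.IH] by (simp add: distrib_left)
qed

lemma gauss_span_mult_gauss: "w \<in> gauss_span \<Longrightarrow> (\<lambda>x. gauss x * w x) \<in> gauss_span"
proof (induction rule: gauss_span.induct)
  case (base g m)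
  then show ?case using gauss_span.base[of g "Suc m"] by (simp add: mult_ac)
next
  case (add f g)
  then show ?case using gauss_span.add[OF add.IH] by (simp add: distrib_left)
qed

lemma gauss_span_sum:
  fixes f :: "'i \<Rightarrow> real ^ 'd::finite \<Rightarrow> real"
  assumes "finite A" "\<And>a. a \<in> A \<Longrightarrow> f a \<in> gauss_span"
  shows "(\<lambda>x. \<Sum>a\<in>A. f a x) \<in> gauss_span"
  using assms
proof (induction A rule: finite_induct)
  case empty
  show ?case using gauss_span.base[OF hermite_span_scale[OF hermite_fun_in_span[of 0], of 0], of 0] by simp
next
  case (insert a A)
  then show ?case using gauss_span.add[of "f a" "\<lambda>x. \<Sum>a\<in>A. f a x"] by simp
qed

text \<open>\<open>w\<close> varies in the induction because a product is handled by multiplying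
  with one factor after the other. A linear \<open>q\<close> contributes \<open>gauss x\<close>
  times an affine function of \<open>x\<close>, and both kinds of multiplication preserve
  \<open>gauss_span\<close>.\<close>

lemma gauss_span_mult_polynomial:
  fixes q :: "real \<times> (real ^ 'd::finite) \<Rightarrow> real"
  assumes "real_polynomial_function q" "w \<in> gauss_span"
  shows "(\<lambda>x. q (gauss x, gauss x *\<^sub>R x) * w x) \<in> gauss_span"
  using assms
proof (induction arbitrary: w rule: real_polynomial_function.induct)
  case (linear q)
  then interpret q: bounded_linear q by simp
  have "q (gauss x, gauss x *\<^sub>R x) = gauss x * (q (1, 0) + (\<Sum>i\<in>UNIV. x $ i * q (0, axis i 1)))" for x :: "real ^ 'd"
  proof -
    have "x = (\<Sum>i\<in>UNIV. x $ i *\<^sub>R axis i 1)" by (simp add: vec_eq_iff axis_def if_distrib cong: if_cong)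
    then have "(1, x) = (1, 0) + (\<Sum>i\<in>UNIV. x $ i *\<^sub>R (0 :: real, axis i 1 :: real ^ 'd))"
      by (simp add: prod_eq_iff fst_sum snd_sum)
    moreover have "(gauss x, gauss x *\<^sub>R x) = gauss x *\<^sub>R (1, x)" by simp
    ultimately have "(gauss x, gauss x *\<^sub>R x) = gauss x *\<^sub>R ((1, 0) + (\<Sum>i\<in>UNIV. x $ i *\<^sub>R (0 :: real, axis i 1 :: real ^ 'd)))"
      by (simp only:)
    then show ?thesis by (simp only: q.scaleR q.add q.sum real_scaleR_def)
  qed
  moreover have "(\<lambda>x. gauss x * (q (1, 0) * w x + (\<Sum>i\<in>UNIV. q (0, axis i 1) * (x $ i * w x)))) \<in> gauss_span"
    by (intro gauss_span_mult_gauss gauss_span.add gauss_span_scale gauss_span_sum gauss_span_mult_coordinate linear.prems) auto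
  ultimately show ?case by (simp add: algebra_simps sum_distrib_left sum_distrib_right)
next
  case (const c)
  then show ?case by (rule gauss_span_scale)
next
  case (add f g)
  then show ?case using gauss_span.add[OF add.IH(1)[OF add.prems] add.IH(2)[OF add.prems]] by (simp add: distrib_right)
next
  case (mult f g)
  then show ?case using mult.IH(1)[OF mult.IH(2)[OF mult.prems]] by (simp add: mult.assoc)
qed

lemma approximable_compact_support:
  fixes \<psi> :: "real ^ 'd::finite \<Rightarrow> real"
  assumes p: "1 \<le> p" and cont: "continuous_on UNIV \<psi>" and supp: "\<And>x. M < norm x \<Longrightarrow> \<psi> x = 0" and M: "0 \<le> M"
  shows "approximable p \<psi>"
proof -
  define h where "h = hermite_fun (0 :: nat ^ 'd)"
  define r0 where "r0 = exp (- M\<^sup>2 / 4)"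
  have r0: "0 < r0" by (simp add: r0_def)
  have h_pos: "0 < h x" for x
    unfolding h_def hermite_fun_def
    by (intro prod_pos) (simp add: hermite_fun1_eq hermite_coeff_def)
  have hL: "h \<in> Lp_space p" unfolding h_def using p by (intro hermite_span_Lp hermite_fun_in_span) auto
  have hc: "continuous_on UNIV h" unfolding h_def by (rule continuous_on_hermite_fun)
  \<comment> \<open>Division by the positive Gaussian \<open>h\<close> prepares the transfer: a
    uniform approximation of \<open>\<xi>\<close>, multiplied by \<open>h\<close>, approximates
    \<open>\<psi>\<close> in \<open>Lp_space\<close>.\<close>
  define \<xi> where "\<xi> x = \<psi> x / h x" for x
  have \<xi>c: "continuous_on UNIV \<xi>"
    unfolding \<xi>_def using h_pos by (intro continuous_on_divide cont hc) (auto simp: less_imp_neq[symmetric])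
  \<comment> \<open>On the range of \<open>\<Gamma>\<close> the point is recovered as
    \<open>snd z\<close> divided by \<open>fst z\<close>. The cutoff is 0 for
    \<open>fst z \<le> r0 / 2\<close> and 1 for \<open>fst z \<ge> r0\<close>, where
    \<open>r0\<close> bounds \<open>gauss\<close> from below on the ball of radius \<open>M\<close>.
    The maximum keeps the denominator positive, so \<open>H\<close> is continuous
    everywhere.\<close>
  define H where "H z = max 0 (min 1 ((fst z - r0 / 2) * 2 / r0)) * \<xi> ((1 / max (fst z) (r0 / 2)) *\<^sub>R snd z)" for z :: "real \<times> (real ^ 'd)"
  define \<Gamma> where "\<Gamma> x = (gauss x, gauss x *\<^sub>R x)" for x :: "real ^ 'd"
  have H\<Gamma>: "H (\<Gamma> x) = \<xi> x" for x
  proof (cases "gauss x < r0 / 2")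
    case True
    have "M < norm x"
    proof (rule ccontr)
      assume "\<not> M < norm x"
      then have "(norm x)\<^sup>2 \<le> M\<^sup>2" by (intro power_mono) auto
      then have "r0 \<le> gauss x" by (simp add: r0_def gauss_def)
      with True r0 show False by simp
    qed
    moreover have "(gauss x - r0 / 2) * 2 / r0 \<le> 0" using True r0 by (intro divide_nonpos_pos) auto
    ultimately show ?thesis by (simp add: H_def \<Gamma>_def \<xi>_def supp max_def min_def)
  next
    case False
    moreover have "gauss x \<noteq> 0" using gauss_pos(1)[of x] by (metis less_irrefl)
    ultimately have s: "(1 / max (gauss x) (r0 / 2)) *\<^sub>R (gauss x *\<^sub>R x) = x"
      by (simp add: max_def)
    show ?thesis
    proof (cases "M < norm x")
      case True
      then show ?thesis using s by (simp add: H_def \<Gamma>_def \<xi>_def supp)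
    next
      case False
      then have "(norm x)\<^sup>2 \<le> M\<^sup>2" by (intro power_mono) auto
      then have "r0 \<le> gauss x" by (simp add: r0_def gauss_def)
      then have "1 \<le> (gauss x - r0 / 2) * 2 / r0" using r0 by (simp add: field_simps)
      then show ?thesis using s by (simp add: H_def \<Gamma>_def)
    qed
  qed
  have \<Gamma>b: "\<Gamma> x \<in> cball 0 2" for x
  proof -
    have "norm x \<le> 1 + (norm x)\<^sup>2 / 4" using zero_le_power2[of "norm x / 2 - 1"] by (simp add: power2_eq_square algebra_simps)
    also have "\<dots> \<le> exp ((norm x)\<^sup>2 / 4)" by (rule exp_ge_add_one_self)
    finally have "gauss x * norm x \<le> gauss x * exp ((norm x)\<^sup>2 / 4)" by (intro mult_left_mono) auto
    also have "\<dots> = 1" by (simp add: gauss_def flip: exp_add)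
    finally have "norm (gauss x *\<^sub>R x) \<le> 1" by simp
    moreover have "norm (\<Gamma> x) \<le> norm (gauss x) + norm (gauss x *\<^sub>R x)" unfolding \<Gamma>_def by (rule norm_Pair_le)
    ultimately show ?thesis using gauss_le_1[of x] by simp
  qed
  have Hc: "continuous_on (cball 0 2) H"
  proof -
    have "continuous_on (cball 0 2) (\<lambda>z :: real \<times> (real ^ 'd). (1 / max (fst z) (r0 / 2)) *\<^sub>R snd z)"
      using r0 by (intro continuous_intros) (auto simp: max_def)
    from continuous_on_compose2[OF \<xi>c this]
    show ?thesis unfolding H_def using r0 by (intro continuous_intros) auto
  qed
  have \<psi>m: "\<psi> \<in> borel_measurable borel" by (rule borel_measurable_continuous_onI[OF cont])
  have "\<exists>q. real_polynomial_function q \<and> (\<forall>z \<in> cball 0 2. \<bar>H z - q z\<bar> < inverse (real (Suc k)))" for k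
    using Stone_Weierstrass_real_polynomial_function[OF compact_cball Hc, of "inverse (real (Suc k))"] by (metis inverse_positive_iff_positive of_nat_0_less_iff zero_less_Suc)
  then obtain q where q: "\<And>k. real_polynomial_function (q k)"
    "\<And>k z. z \<in> cball 0 2 \<Longrightarrow> \<bar>H z - q k z\<bar> < inverse (real (Suc k))" by metis
  define F where "F k x = q k (\<Gamma> x) * h x" for k x
  have F: "approximable p (F k)" for k
  proof -
    have "h \<in> gauss_span" using gauss_span.base[OF hermite_fun_in_span, of 0 0] by (simp add: h_def)
    from gauss_span_mult_polynomial[OF q(1) this] show ?thesis
      unfolding F_def[abs_def] \<Gamma>_def by (rule gauss_span_approximable[OF p])
  qed
  then have FL: "F k \<in> Lp_space p" for k by (simp add: approximable_def)
  have d: "\<bar>F k x - \<psi> x\<bar> \<le> h x * inverse (real (Suc k))" for k x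
  proof -
    have "\<psi> x = H (\<Gamma> x) * h x" unfolding H\<Gamma> \<xi>_def using h_pos[of x] by simp
    then have "F k x - \<psi> x = h x * - (H (\<Gamma> x) - q k (\<Gamma> x))" by (simp add: F_def algebra_simps)
    then have "\<bar>F k x - \<psi> x\<bar> = h x * \<bar>H (\<Gamma> x) - q k (\<Gamma> x)\<bar>"
      using h_pos[of x] by (simp only: abs_mult abs_minus_cancel abs_of_pos)
    also have "\<dots> \<le> h x * inverse (real (Suc k))"
      using q(2)[OF \<Gamma>b[of x], of k] h_pos[of x] by (intro mult_left_mono) auto
    finally show ?thesis .
  qed
  have d1: "\<bar>F k x - \<psi> x\<bar> \<le> h x" for k x
  proof -
    have "h x * inverse (real (Suc k)) \<le> h x * 1"
      using h_pos[of x] by (intro mult_left_mono) (auto simp: inverse_le_1_iff)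
    with d[of k x] show ?thesis by simp
  qed
  have "\<psi> \<in> Lp_space p"
  proof (rule Lp_space_dominated)
    show "(\<lambda>x. norm (F 0 x) + h x) \<in> Lp_space p"
      by (intro Lp_space_add(1)[OF Lp_space_norm[OF FL] hL p])
    show "norm (\<psi> x) \<le> norm (norm (F 0 x) + h x)" for x
      using d1[of 0 x] h_pos[of x] by simp
  qed (use p in \<open>auto intro: borel_imp_lebesgue_measurable \<psi>m\<close>)
  then show ?thesis
  proof (rule approximable_limit[OF p _ F])
    show "(\<lambda>k. Lp_int p (\<lambda>x. F k x - \<psi> x)) \<longlonglongrightarrow> 0"
    proof (rule Lp_int_tendsto_0[OF Lp_spaceD(1)[OF FL] borel_imp_lebesgue_measurable[OF \<psi>m] _ hL])
      show "AE x in lebesgue. (\<lambda>k. F k x) \<longlonglongrightarrow> \<psi> x"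
      proof (rule AE_I2, rule LIM_zero_cancel, rule Lim_null_comparison)
        fix x
        show "(\<lambda>k. h x * inverse (real (Suc k))) \<longlonglongrightarrow> 0"
          using tendsto_mult_right_zero[OF LIMSEQ_inverse_real_of_nat] by auto
        show "\<forall>\<^sub>F k in sequentially. norm (F k x - \<psi> x) \<le> h x * inverse (real (Suc k))"
          using d by simp
      qed
      show "norm (F k x - \<psi> x) \<le> norm (h x)" for k x using d1[of k x] by simp
    qed (use p in simp)
  qed
qed

lemma approximable_bounded:
  fixes u :: "real ^ 'd::finite \<Rightarrow> real"
  assumes p: "1 \<le> p" and u: "u \<in> borel_measurable lebesgue" and M: "0 \<le> M"
    and bd: "\<And>x. \<bar>u x\<bar> \<le> M" and supp: "\<And>x. M < norm x \<Longrightarrow> u x = 0"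
  shows "approximable p u"
proof -
  have "u measurable_on UNIV" by (rule lebesgue_measurable_imp_measurable_on_real[OF u]) simp
  then obtain N g where N: "negligible N" and gc: "\<And>n. continuous_on UNIV (g n)"
    and gl: "\<And>x. x \<notin> N \<Longrightarrow> (\<lambda>n. g n x) \<longlonglongrightarrow> u x"
    unfolding measurable_on_def by auto
  \<comment> \<open>\<open>g n\<close> converges to \<open>u\<close> almost everywhere, but without
    a common majorant. Truncating its values at \<open>M\<close> and cutting it off between the
    radii \<open>M\<close> and \<open>M + 1\<close> provides one and leaves the limit
    \<open>u\<close> unchanged.\<close>
  define v where "v n x = max 0 (min 1 (M + 1 - norm x)) * max (- M) (min M (g n x))" for n x
  define w where "w x = 2 * M * indicator (cball 0 (M + 1)) x" for x :: "real ^ 'd"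
  have vc: "continuous_on UNIV (v n)" for n unfolding v_def by (intro continuous_intros gc)
  have v0: "v n x = 0" if "M + 1 < norm x" for n x using that by (simp add: v_def)
  have vb: "\<bar>v n x\<bar> \<le> M" for n x
  proof -
    have "\<bar>v n x\<bar> \<le> 1 * M" unfolding v_def abs_mult using M by (intro mult_mono) auto
    then show ?thesis by simp
  qed
  have wL: "w \<in> Lp_space p"
  proof (rule Lp_space_of_exp_bound[where c = 1 and C = "2 * M * exp ((M + 1)\<^sup>2)"])
    fix x :: "real ^ 'd"
    show "norm (w x) \<le> 2 * M * exp ((M + 1)\<^sup>2) * exp (- 1 * (norm x)\<^sup>2)"
    proof (cases "norm x \<le> M + 1")
      case True
      then have "(norm x)\<^sup>2 \<le> (M + 1)\<^sup>2" by (intro power_mono) auto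
      then have "1 \<le> exp ((M + 1)\<^sup>2) * exp (- 1 * (norm x)\<^sup>2)" by (simp flip: exp_add)
      then have "2 * M * 1 \<le> 2 * M * (exp ((M + 1)\<^sup>2) * exp (- 1 * (norm x)\<^sup>2))" using M by (intro mult_left_mono) auto
      then show ?thesis using M True by (simp add: w_def mult.assoc)
    qed (use M in \<open>simp add: w_def\<close>)
    show "w \<in> borel_measurable borel"
      unfolding w_def[abs_def] by (intro borel_measurable_times borel_measurable_const borel_measurable_indicator) auto
  qed (use p in auto)
  have ud: "norm (u x) \<le> norm (w x)" for x
    using bd[of x] supp[of x] M by (cases "norm x \<le> M + 1") (auto simp: w_def)
  have vL: "approximable p (v n)" for n
    by (rule approximable_compact_support[OF p vc, of "M + 1"]) (use M v0 in auto)
  show ?thesis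
  proof (rule approximable_limit[OF p _ vL])
    show "u \<in> Lp_space p" by (rule Lp_space_dominated[OF wL u ud]) (use p in simp)
    show "(\<lambda>n. Lp_int p (\<lambda>x. v n x - u x)) \<longlonglongrightarrow> 0"
    proof (rule Lp_int_tendsto_0[OF _ u _ wL])
      show "v n \<in> borel_measurable lebesgue" for n
        by (rule borel_imp_lebesgue_measurable[OF borel_measurable_continuous_onI[OF vc]])
      have "AE x in lebesgue. x \<notin> N" using N by (intro AE_not_in) (simp add: negligible_iff_null_sets)
      then show "AE x in lebesgue. (\<lambda>n. v n x) \<longlonglongrightarrow> u x"
      proof eventually_elim
        case (elim x)
        have "(\<lambda>n. v n x) \<longlonglongrightarrow> max 0 (min 1 (M + 1 - norm x)) * max (- M) (min M (u x))"
          unfolding v_def by (intro tendsto_intros gl elim)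
        moreover have "max 0 (min 1 (M + 1 - norm x)) * max (- M) (min M (u x)) = u x"
          using bd[of x] supp[of x] by (cases "M < norm x") (auto simp: abs_le_iff max_def min_def)
        ultimately show ?case by simp
      qed
      show "norm (v n x - u x) \<le> norm (w x)" for n x
        using vb[of n x] bd[of x] v0[of x n] supp[of x] M by (cases "norm x \<le> M + 1") (auto simp: w_def)
    qed (use p in simp)
  qed
qed

lemma Lp_space_approximable:
  fixes f :: "real ^ 'd::finite \<Rightarrow> real"
  assumes p: "1 \<le> p" and f: "f \<in> Lp_space p"
  shows "approximable p f"
proof -
  define F where "F k x = (if norm x \<le> real k then max (- real k) (min (real k) (f x)) else 0)" for k x
  have fm [measurable]: "f \<in> borel_measurable lebesgue" by (rule Lp_spaceD[OF f])
  have nm [measurable]: "(\<lambda>x::real^'d. norm x) \<in> borel_measurable lebesgue" by (rule borel_imp_lebesgue_measurable) simp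
  have Fm: "F k \<in> borel_measurable lebesgue" for k unfolding F_def[abs_def] by measurable
  show ?thesis
  proof (rule approximable_limit[OF p f])
    show "approximable p (F k)" for k
      by (rule approximable_bounded[OF p Fm, of "real k"]) (auto simp: F_def)
    show "(\<lambda>k. Lp_int p (\<lambda>x. F k x - f x)) \<longlonglongrightarrow> 0"
    proof (rule Lp_int_tendsto_0[OF Fm fm _ f])
      show "AE x in lebesgue. (\<lambda>k. F k x) \<longlonglongrightarrow> f x"
      proof (rule AE_I2, rule tendsto_eventually)
        fix x
        show "\<forall>\<^sub>F k in sequentially. F k x = f x"
          using eventually_ge_at_top[of "nat \<lceil>norm x + \<bar>f x\<bar>\<rceil>"]
        proof eventually_elim
          case (elim k)
          then have "norm x + \<bar>f x\<bar> \<le> real k" by linarith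
          then have "norm x \<le> real k" "\<bar>f x\<bar> \<le> real k" using norm_ge_zero[of x] by linarith+
          then show ?case by (simp add: F_def)
        qed
      qed
      show "norm (F k x - f x) \<le> norm (f x)" for k x by (auto simp: F_def)
    qed (use p in simp)
  qed
qed

lemma hexp_dense_vector:
  fixes G :: "real ^ 'd::finite \<Rightarrow> real ^ 'd"
  assumes p: "1 \<le> p" and G: "G \<in> Lp_space p" and \<epsilon>: "0 < \<epsilon>"
  shows "\<exists>N g. finite N \<and> Lp_int p (\<lambda>x. hexp N g x - G x) < \<epsilon>"
proof -
  define A where "A = real CARD('d) powr p"
  have A: "0 < A" by (simp add: A_def)
  \<comment> \<open>A crude comparison of norms suffices: the constant \<open>A\<close> enters only
    the choice of \<open>\<eta>\<close>, not the bound on the Riesz transform.\<close>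
  have norm_le: "norm v powr p \<le> A * (\<Sum>i\<in>UNIV. norm (v $ i) powr p)" for v :: "real ^ 'd"
  proof -
    define m where "m = Max (range (\<lambda>i. norm (v $ i)))"
    have m: "norm (v $ i) \<le> m" for i unfolding m_def by (intro Max_ge) auto
    have "m \<in> range (\<lambda>i. norm (v $ i))" unfolding m_def by (intro Max_in) auto
    then obtain j where j: "m = norm (v $ j)" by auto
    have "norm v \<le> (\<Sum>i\<in>UNIV. \<bar>v $ i\<bar>)" by (rule norm_le_l1_cart)
    also have "\<dots> \<le> (\<Sum>i\<in>(UNIV :: 'd set). m)" using m by (intro sum_mono) auto
    finally have "norm v \<le> real CARD('d) * m" by simp
    then have "norm v powr p \<le> (real CARD('d) * m) powr p" using p by (intro powr_mono2) auto
    also have "\<dots> = A * norm (v $ j) powr p" using j by (simp add: A_def powr_mult)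
    also have "\<dots> \<le> A * (\<Sum>i\<in>UNIV. norm (v $ i) powr p)"
      using A by (intro mult_left_mono member_le_sum) auto
    finally show ?thesis .
  qed
  have Gm: "G \<in> borel_measurable lebesgue" by (rule Lp_spaceD[OF G])
  have Gi: "(\<lambda>x. G x $ i) \<in> Lp_space p" for i
  proof (rule Lp_space_dominated[OF G])
    show "(\<lambda>x. G x $ i) \<in> borel_measurable lebesgue"
      by (rule measurable_compose[OF Gm]) simp
  qed (use p component_le_norm_cart in auto)
  define \<eta> where "\<eta> = \<epsilon> / (A * real CARD('d))"
  have \<eta>: "0 < \<eta>" using \<epsilon> A by (simp add: \<eta>_def)
  have "\<exists>z. finite (fst z) \<and> Lp_int p (\<lambda>x. hexp (fst z) (snd z) x - G x $ i) < \<eta>" for i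
  proof -
    obtain h where h: "h \<in> hermite_span" "Lp_int p (\<lambda>x. h x - G x $ i) < \<eta>"
      using Lp_space_approximable[OF p Gi[of i]] \<eta> unfolding approximable_def by blast
    from h(1) obtain N c where "finite N" "h = hexp N c" by (auto simp: hermite_span_iff)
    with h(2) show ?thesis by (intro exI[of _ "(N, c)"]) simp
  qed
  then have "\<exists>z. \<forall>i. finite (fst (z i)) \<and> Lp_int p (\<lambda>x. hexp (fst (z i)) (snd (z i)) x - G x $ i) < \<eta>"
    by (intro choice allI)
  then obtain z where z: "\<And>i. finite (fst (z i))" "\<And>i. Lp_int p (\<lambda>x. hexp (fst (z i)) (snd (z i)) x - G x $ i) < \<eta>"
    by blast
  define N where "N i = fst (z i)" for i
  define c where "c i = snd (z i)" for i
  have Nc: "finite (N i)" "Lp_int p (\<lambda>x. hexp (N i) (c i) x - G x $ i) < \<eta>" for i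
    using z by (simp_all add: N_def c_def)
  define N' where "N' = (\<Union>i. N i)"
  define g where "g n = (\<chi> i. if n \<in> N i then c i n else 0)" for n
  have N': "finite N'" unfolding N'_def using Nc(1) by auto
  have comp: "hexp N' g x $ i = hexp (N i) (c i) x" for i x
  proof -
    have "N i \<subseteq> N'" by (auto simp: N'_def)
    then show ?thesis using hexp_extend[OF N', of "N i" "c i"] by (simp only:) (simp add: hexp_def g_def)
  qed
  have iL: "(\<lambda>x. hexp (N i) (c i) x - G x $ i) \<in> Lp_space p" for i
    using p Nc(1)[of i] by (intro Lp_space_diff(1) Gi hermite_span_Lp) (auto simp: hermite_span_iff)
  have "Lp_int p (\<lambda>x. hexp N' g x - G x) \<le> (LINT x|lebesgue. A * (\<Sum>i\<in>UNIV. norm (hexp (N i) (c i) x - G x $ i) powr p))"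
    unfolding Lp_int_def
  proof (rule integral_mono')
    show "norm (hexp N' g x - G x) powr p \<le> A * (\<Sum>i\<in>UNIV. norm (hexp (N i) (c i) x - G x $ i) powr p)" for x
      using norm_le[of "hexp N' g x - G x"] by (simp add: comp)
  qed (use Lp_spaceD(2)[OF iL] A in \<open>auto intro!: mult_nonneg_nonneg sum_nonneg\<close>)
  also have "\<dots> = A * (\<Sum>i\<in>UNIV. Lp_int p (\<lambda>x. hexp (N i) (c i) x - G x $ i))"
    unfolding Lp_int_def using Lp_spaceD(2)[OF iL] by (simp add: Bochner_Integration.integral_sum)
  also have "\<dots> < A * (\<Sum>i\<in>(UNIV :: 'd set). \<eta>)"
    using Nc(2) A by (intro mult_strict_left_mono sum_strict_mono) auto
  also have "\<dots> = \<epsilon>" using A by (simp add: \<eta>_def)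
  finally show ?thesis using N' by blast
qed

subsection \<open>The Riesz transform on the span of the Hermite functions\<close>

lemma L2_inner_hexp:
  fixes c :: "nat ^ 'd::finite \<Rightarrow> real"
  assumes "finite N"
  shows "L2_inner (hexp N c) (hermite_fun n) = (if n \<in> N then c n else 0)"
proof -
  have "L2_inner (hexp N c) (hermite_fun n) = (LINT x|lborel. hexp N c x * hermite_fun n x)"
    unfolding L2_inner_def by (rule integral_completion) measurable
  also have "\<dots> = (LINT x|lborel. (\<Sum>m\<in>N. c m * (hermite_fun m x * hermite_fun n x)))"
    unfolding hexp_def sum_distrib_right by (simp add: mult_ac)
  also have "\<dots> = (\<Sum>m\<in>N. c m * (if m = n then 1 else 0))"
    by (simp add: Bochner_Integration.integral_sum hermite_fun_orthonormal)
  also have "\<dots> = (if n \<in> N then c n else 0)"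
    using assms by (simp add: if_distrib[of "(*) _"] cong: if_cong)
  finally show ?thesis .
qed

lemma riesz_hexp_eq:
  fixes c :: "nat ^ 'd::finite \<Rightarrow> real"
  assumes "finite N"
  shows "riesz (hexp N c) = riesz_hexp N c"
proof -
  have "riesz_comp i (hexp N c) x = (\<Sum>n\<in>N. eigval n powr (- 1 / 2) * c n * (sqrt (2 * real (n $ i) + 2) * hermite_fun (n + axis i 1) x))" for i x
  proof -
    have "riesz_comp i (hexp N c) x = infsum (\<lambda>n. eigval n powr (- 1 / 2) * c n * (sqrt (2 * real (n $ i) + 2) * hermite_fun (n + axis i 1) x)) N"
      unfolding riesz_comp_def L2_inner_hexp[OF assms] delta_adj_hermite_fun by (rule infsum_cong_neutral) auto
    then show ?thesis using assms by simp
  qed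
  then show ?thesis by (simp add: fun_eq_iff riesz_def riesz_hexp_def)
qed

lemma riesz_add:
  assumes "f \<in> hermite_span" "g \<in> hermite_span"
  shows "riesz (\<lambda>x. f x + g x) = (\<lambda>x. riesz f x + riesz g x)"
proof -
  from assms obtain N c d where *: "finite N" "f = hexp N c" "g = hexp N d" by (rule hermite_span_common)
  have "(\<lambda>x. f x + g x) = hexp N (\<lambda>n. c n + d n)"
    by (simp add: * hexp_def[abs_def] sum.distrib distrib_left)
  then show ?thesis
    by (simp add: *(2,3) riesz_hexp_eq[OF *(1)] riesz_hexp_def vec_eq_iff fun_eq_iff sum.distrib[symmetric] algebra_simps)
qed

lemma riesz_hexp_scale: "riesz_hexp N (\<lambda>n. a * c n) x = a *\<^sub>R riesz_hexp N c x"
  by (simp add: riesz_hexp_def vec_eq_iff sum_distrib_left mult_ac)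

lemma hexp_scale: "hexp N (\<lambda>n. a * c n) x = a * hexp N c x" for c :: "nat ^ 'd::finite \<Rightarrow> real"
  by (simp add: hexp_def sum_distrib_left mult_ac)

lemma riesz_scale:
  assumes "f \<in> hermite_span"
  shows "riesz (\<lambda>x. a * f x) = (\<lambda>x. a *\<^sub>R riesz f x)"
proof -
  from assms obtain N c where *: "finite N" "f = hexp N c" by (auto simp: hermite_span_iff)
  have e: "(\<lambda>x. a * f x) = hexp N (\<lambda>n. a * c n)" by (simp add: *(2) hexp_scale fun_eq_iff)
  have "riesz (\<lambda>x. a * f x) = riesz_hexp N (\<lambda>n. a * c n)" unfolding e by (rule riesz_hexp_eq[OF *(1)])
  then show ?thesis by (simp add: *(2) riesz_hexp_eq[OF *(1)] fun_eq_iff riesz_hexp_scale)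
qed

lemma riesz_hexp_borel [measurable]: "riesz_hexp N c \<in> borel_measurable borel"
proof -
  have "riesz_hexp N c = (\<lambda>x. \<Sum>i\<in>UNIV. (\<Sum>n\<in>N. eigval n powr (- 1 / 2) * c n * (sqrt (2 * real (n $ i) + 2) * hermite_fun (n + axis i 1) x)) *\<^sub>R axis i 1)"
    by (simp add: fun_eq_iff riesz_hexp_def vec_eq_iff axis_def if_distrib cong: if_cong)
  then show ?thesis by simp
qed

lemma riesz_hexp_Lp:
  fixes c :: "nat ^ 'd::finite \<Rightarrow> real"
  assumes "finite N" "0 < p"
  shows "riesz_hexp N c \<in> Lp_space p"
proof -
  define r where "r i x = riesz_hexp N c x $ i" for i x
  have "r i \<in> hermite_span" for i
    unfolding r_def riesz_hexp_def vec_lambda_beta mult.assoc[symmetric] using assms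
    by (intro hermite_span_sum hermite_span_scale hermite_fun_in_span)
  then have "\<forall>i. \<exists>C. 0 \<le> C \<and> (\<forall>x. \<bar>r i x\<bar> \<le> C * exp (- 3 / 8 * (norm x)\<^sup>2))"
    using hermite_span_bound by blast
  from choice[OF this] obtain C where C: "\<And>i x. \<bar>r i x\<bar> \<le> C i * exp (- 3 / 8 * (norm x)\<^sup>2)" by blast
  show ?thesis
  proof (rule Lp_space_of_exp_bound[where C = "\<Sum>i\<in>UNIV. C i" and c = "3 / 8"])
    fix x
    have "norm (riesz_hexp N c x) \<le> (\<Sum>i\<in>UNIV. \<bar>riesz_hexp N c x $ i\<bar>)" by (rule norm_le_l1_cart)
    also have "\<dots> \<le> (\<Sum>i\<in>UNIV. C i * exp (- 3 / 8 * (norm x)\<^sup>2))"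
      using C by (intro sum_mono) (simp add: r_def)
    finally show "norm (riesz_hexp N c x) \<le> (\<Sum>i\<in>UNIV. C i) * exp (- (3 / 8) * (norm x)\<^sup>2)"
      by (simp add: sum_distrib_right)
  qed (use assms in auto)
qed

section \<open>Duality and scaling\<close>

lemma le_of_le_add_mult:
  fixes x a b :: real
  assumes "\<And>e. 0 < e \<Longrightarrow> x \<le> a + b * e"
  shows "x \<le> a"
proof (rule field_le_epsilon)
  fix e :: real assume e: "0 < e"
  have "x \<le> a + b * (e / (\<bar>b\<bar> + 1))" using e by (intro assms) auto
  also have "b * (e / (\<bar>b\<bar> + 1)) \<le> e"
  proof -
    have "b * e \<le> (\<bar>b\<bar> + 1) * e" using e by (intro mult_right_mono) auto
    then show ?thesis by (simp add: divide_le_eq mult.commute)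
  qed
  finally show "x \<le> a + e" by simp
qed

lemma le_of_le_add_powr:
  fixes x a b c :: real
  assumes "\<And>s. 0 < s \<Longrightarrow> s < 1 \<Longrightarrow> x \<le> a + b * (1 - s) powr c"
  shows "x \<le> a + b"
proof -
  have l: "(\<lambda>k. a + b * (1 - inverse (real (Suc (Suc k)))) powr c) \<longlonglongrightarrow> a + b * (1 - 0) powr c"
    by (intro tendsto_intros LIMSEQ_Suc[OF LIMSEQ_inverse_real_of_nat]) auto
  have "x \<le> a + b * (1 - 0) powr c"
  proof (rule LIMSEQ_le_const[OF l], intro exI allI impI)
    fix k
    have "0 < inverse (real (Suc (Suc k)))" "inverse (real (Suc (Suc k))) < 1" by (auto simp: field_simps)
    then show "x \<le> a + b * (1 - inverse (real (Suc (Suc k)))) powr c" by (rule assms)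
  qed
  then show ?thesis by simp
qed

text \<open>Young's inequality for \<open>\<tau> * norm (R x)\<close> and
  \<open>norm (G x) / \<tau>\<close> with \<open>\<tau> powr p = t\<close>, where
  \<open>1 / p\<close> and \<open>1 / q\<close> are bounded by 1. A small \<open>t\<close>
  suppresses the first term; the second is small when \<open>G\<close> is an approximation
  error.\<close>

lemma Lp_inner:
  fixes R G :: "'a::euclidean_space \<Rightarrow> 'b::euclidean_space"
  assumes R: "R \<in> Lp_space p" and G: "G \<in> Lp_space q" and pq: "1 < p" "1 < q" "1 / p + 1 / q = 1"
  shows "integrable lebesgue (\<lambda>x. R x \<bullet> G x)"
    and "0 < t \<Longrightarrow> (LINT x|lebesgue. R x \<bullet> G x) \<le> t * Lp_int p R + t powr (- q / p) * Lp_int q G"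
proof -
  note [measurable] = Lp_spaceD(1)[OF R] Lp_spaceD(1)[OF G]
  have young: "\<bar>R x \<bullet> G x\<bar> \<le> t * norm (R x) powr p + t powr (- q / p) * norm (G x) powr q" if t: "0 < t" for t x
  proof -
    define \<tau> where "\<tau> = t powr (1 / p)"
    have \<tau>: "0 < \<tau>" "\<tau> powr p = t" "\<tau> powr - q = t powr (- q / p)" using t pq by (simp_all add: \<tau>_def powr_powr)
    have "\<bar>R x \<bullet> G x\<bar> \<le> norm (R x) * norm (G x)" by (rule Cauchy_Schwarz_ineq2)
    also have "\<dots> = (\<tau> * norm (R x)) * (norm (G x) / \<tau>)" using \<tau> by simp
    also have "\<dots> \<le> (\<tau> * norm (R x)) powr p / p + (norm (G x) / \<tau>) powr q / q"
      using pq \<tau> by (intro Youngs_inequality) auto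
    also have "\<dots> \<le> (\<tau> * norm (R x)) powr p / 1 + (norm (G x) / \<tau>) powr q / 1"
      using pq by (intro add_mono divide_left_mono) auto
    also have "\<dots> = t * norm (R x) powr p + t powr (- q / p) * norm (G x) powr q"
      using \<tau> by (simp add: powr_mult powr_divide powr_minus_divide)
    finally show ?thesis .
  qed
  have i: "integrable lebesgue (\<lambda>x. t * norm (R x) powr p + t powr (- q / p) * norm (G x) powr q)" for t
    using Lp_spaceD(2)[OF R] Lp_spaceD(2)[OF G] by simp
  show int: "integrable lebesgue (\<lambda>x. R x \<bullet> G x)"
    by (rule Bochner_Integration.integrable_bound[OF i[of 1]])
       (use young[of 1] in \<open>auto intro!: AE_I2 order_trans[OF _ abs_ge_self]\<close>)
  assume t: "0 < t"
  have "(LINT x|lebesgue. R x \<bullet> G x) \<le> (LINT x|lebesgue. t * norm (R x) powr p + t powr (- q / p) * norm (G x) powr q)"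
    by (rule integral_mono[OF int i abs_le_D1[OF young[OF t]]])
  also have "\<dots> = t * Lp_int p R + t powr (- q / p) * Lp_int q G"
    unfolding Lp_int_def using Lp_spaceD(2)[OF R] Lp_spaceD(2)[OF G] by simp
  finally show "(LINT x|lebesgue. R x \<bullet> G x) \<le> t * Lp_int p R + t powr (- q / p) * Lp_int q G" .
qed

text \<open>Density carries the pairing estimate over with the same constants. The order of the
  limits matters: first the error \<open>e\<close>, whose coefficient depends on \<open>s\<close>
  and \<open>t\<close>, then \<open>t\<close>, then \<open>s\<close>.\<close>

lemma riesz_pairing_Lp:
  fixes c :: "nat ^ 'd::finite \<Rightarrow> real" and G :: "real ^ 'd \<Rightarrow> real ^ 'd"
  assumes N: "finite N" and pq: "1 < p" "1 < q" "1 / p + 1 / q = 1" and \<beta>: "0 \<le> \<beta>"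
    and pair: "\<And>N' g. finite N' \<Longrightarrow> (LINT x|lebesgue. riesz_hexp N c x \<bullet> hexp N' g x) \<le> \<alpha> * Lp_int p (hexp N c) + \<beta> * Lp_int q (hexp N' g)"
    and G: "G \<in> Lp_space q"
  shows "(LINT x|lebesgue. riesz_hexp N c x \<bullet> G x) \<le> \<alpha> * Lp_int p (hexp N c) + \<beta> * Lp_int q G"
proof -
  define R where "R = riesz_hexp N c"
  have RL: "R \<in> Lp_space p" unfolding R_def using N pq by (intro riesz_hexp_Lp) auto
  define M where "M = \<alpha> * Lp_int p (hexp N c)"
  define I where "I = (LINT x|lebesgue. R x \<bullet> G x)"
  have q1: "1 \<le> q" using pq by simp
  have main: "I \<le> (M + \<beta> * ((1 - s) powr (1 - q) * Lp_int q G) + t * Lp_int p R) + (\<beta> * s powr (1 - q) + t powr (- q / p)) * e"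
    if s: "0 < s" "s < 1" and t: "0 < t" and e: "0 < e" for s t e
  proof -
    obtain N' g where g: "finite N'" "Lp_int q (\<lambda>x. hexp N' g x - G x) < e"
      using hexp_dense_vector[OF q1 G e] by blast
    have gL: "hexp N' g \<in> Lp_space q"
    proof -
      obtain B where "\<And>x. norm (hexp N' g x) \<le> B * gauss x" using hexp_gauss_bound[of N' g] by blast
      then show ?thesis using pq
        by (intro Lp_space_of_exp_bound[where C = B and c = "1/4"]) (auto simp: gauss_def)
    qed
    have wL: "(\<lambda>x. hexp N' g x - G x) \<in> Lp_space q" "(\<lambda>x. G x - hexp N' g x) \<in> Lp_space q"
      using Lp_space_diff(1)[OF gL G q1] Lp_space_diff(1)[OF G gL q1] by auto
    have w: "Lp_int q (\<lambda>x. G x - hexp N' g x) \<le> e"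
      using g(2) by (simp only: Lp_int_def norm_minus_commute)
    have "Lp_int q (\<lambda>x. G x + (hexp N' g x - G x)) \<le> (1 - s) powr (1 - q) * Lp_int q G + s powr (1 - q) * Lp_int q (\<lambda>x. hexp N' g x - G x)"
      using s by (rule Lp_space_add(2)[OF G wL(1) q1])
    also have "\<dots> \<le> (1 - s) powr (1 - q) * Lp_int q G + s powr (1 - q) * e"
      using g(2) by (intro add_left_mono mult_left_mono) auto
    finally have 1: "Lp_int q (hexp N' g) \<le> (1 - s) powr (1 - q) * Lp_int q G + s powr (1 - q) * e" by simp
    have "I = (LINT x|lebesgue. R x \<bullet> hexp N' g x + R x \<bullet> (G x - hexp N' g x))"
      unfolding I_def by (simp add: inner_diff_right)
    also have "\<dots> = (LINT x|lebesgue. R x \<bullet> hexp N' g x) + (LINT x|lebesgue. R x \<bullet> (G x - hexp N' g x))"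
      by (intro Bochner_Integration.integral_add Lp_inner(1)[OF RL _ pq] gL wL)
    also have "\<dots> \<le> (M + \<beta> * Lp_int q (hexp N' g)) + (t * Lp_int p R + t powr (- q / p) * Lp_int q (\<lambda>x. G x - hexp N' g x))"
      unfolding M_def R_def by (intro add_mono pair g Lp_inner(2)[OF _ wL(2) pq t] RL[unfolded R_def])
    also have "\<dots> \<le> (M + \<beta> * ((1 - s) powr (1 - q) * Lp_int q G + s powr (1 - q) * e)) + (t * Lp_int p R + t powr (- q / p) * e)"
      using 1 w \<beta> by (intro add_mono order_refl mult_left_mono) auto
    finally show ?thesis by (simp add: algebra_simps)
  qed
  have "I \<le> M + \<beta> * Lp_int q G"
  proof (rule le_of_le_add_powr[where c = "1 - q"])
    fix s :: real assume s: "0 < s" "s < 1"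
    show "I \<le> M + \<beta> * Lp_int q G * (1 - s) powr (1 - q)"
    proof (rule le_of_le_add_mult[where b = "Lp_int p R"])
      fix t :: real assume t: "0 < t"
      show "I \<le> M + \<beta> * Lp_int q G * (1 - s) powr (1 - q) + Lp_int p R * t"
      proof (rule le_of_le_add_mult)
        fix e :: real assume "0 < e"
        from main[OF s t this] show "I \<le> M + \<beta> * Lp_int q G * (1 - s) powr (1 - q) + Lp_int p R * t + (\<beta> * s powr (1 - q) + t powr (- q / p)) * e"
          by (simp add: mult_ac)
      qed
    qed
  qed
  then show ?thesis by (simp add: I_def M_def R_def)
qed

text \<open>\<open>X\<close> occurs on both sides because the test function is dual to the function
  being estimated. With \<open>r powr p * M = 1\<close> and \<open>s powr q * X = 1\<close> the
  right-hand side is \<open>\<alpha> + \<beta>\<close> and the left-hand side is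
  \<open>(X / M) powr (1 / p)\<close>.\<close>

lemma homogeneous_bound:
  fixes X M A \<alpha> \<beta> :: real
  assumes h: "\<And>r s. 0 < r \<Longrightarrow> 0 < s \<Longrightarrow> r * s * X \<le> \<alpha> * r powr p * M + \<beta> * s powr q * X"
    and pq: "1 < p" "1 < q" "1 / p + 1 / q = 1" and nn: "0 \<le> X" "0 \<le> M" "0 \<le> \<beta>" and A: "\<alpha> + \<beta> \<le> A"
  shows "X \<le> A powr p * M"
proof (cases "X = 0")
  case True
  then show ?thesis using nn by simp
next
  case False
  then have X: "0 < X" using nn by simp
  have M: "0 < M"
  proof (rule ccontr)
    assume "\<not> 0 < M"
    then have "M = 0" using nn by simp
    \<comment> \<open>With \<open>M = 0\<close> only the terms in \<open>X\<close> remain, and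
      \<open>r = \<beta> + 1\<close> makes the left-hand side the larger one.\<close>
    with h[of "\<beta> + 1" 1] nn have "(\<beta> + 1) * X \<le> \<beta> * X" by simp
    with X show False by (simp add: distrib_right)
  qed
  define r where "r = M powr (- 1 / p)"
  define s where "s = X powr (- 1 / q)"
  have "r powr p = M powr - 1" "s powr q = X powr - 1" using pq by (simp_all add: r_def s_def powr_powr)
  then have r: "0 < r" "r powr p * M = 1" and s: "0 < s" "s powr q * X = 1"
    using M X by (simp_all add: r_def s_def powr_minus_divide)
  have "s * X = X powr (- 1 / q) * X powr 1" using X by (simp add: s_def)
  also have "\<dots> = X powr (- 1 / q + 1)" by (rule powr_add[symmetric])
  also have "- 1 / q + 1 = 1 / p" using pq(3) by simp
  finally have "r * s * X = (X / M) powr (1 / p)"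
    using X M by (simp add: r_def powr_divide powr_minus_divide mult.assoc)
  then have "(X / M) powr (1 / p) \<le> A"
    using h[OF r(1) s(1)] r(2) s(2) A by (simp add: mult.assoc)
  then have "((X / M) powr (1 / p)) powr p \<le> A powr p" using pq by (intro powr_mono2) auto
  then have "X / M \<le> A powr p" using X M pq by (simp add: powr_powr)
  then show ?thesis using M by (simp add: divide_le_eq)
qed

lemma riesz_hexp_bound:
  fixes c :: "nat ^ 'd::finite \<Rightarrow> real"
  assumes N: "finite N" and p: "1 < p"
  shows "Lp_int p (riesz_hexp N c) \<le> (36 * (p_star p - 1)) powr p * Lp_int p (hexp N c)"
proof -
  define q where "q = p / (p - 1)"
  have pq: "1 < p" "1 < q" "1 / p + 1 / q = 1" and qp: "q / (q - 1) = p"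
    using p by (auto simp: q_def field_simps)
  have lb: "(LINT x|lebesgue. norm (hexp N' g x) powr r) = (LINT x|lborel. norm (hexp N' g x) powr r)"
    for N' and g :: "nat ^ 'd \<Rightarrow> 'z::euclidean_space" and r
    by (rule integral_completion) measurable
  have lb2: "(LINT x|lebesgue. riesz_hexp N c x \<bullet> hexp N' g x) = (LINT x|lborel. riesz_hexp N c x \<bullet> hexp N' g x)" for N' g c
    by (rule integral_completion) measurable
  \<comment> \<open>\<open>\<alpha>\<close> and \<open>\<beta>\<close> are fixed before the
    coefficients \<open>c\<close>, because the estimate is applied below to all multiples of
    \<open>c\<close>. They are 2 and \<open>2 * (8 * p_star p + 1)\<close>, in an order that depends
    on the case.\<close>
  have "\<exists>\<alpha> \<beta>. 0 \<le> \<beta> \<and> \<alpha> + \<beta> \<le> 36 * (p_star p - 1) \<and>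
    (\<forall>c N' g. finite N' \<longrightarrow> (LINT x|lebesgue. riesz_hexp N c x \<bullet> hexp N' g x) \<le> \<alpha> * Lp_int p (hexp N c) + \<beta> * Lp_int q (hexp N' g))"
  proof (cases "2 \<le> p")
    case True
    then have "p / (p - 1) \<le> p" by (simp add: divide_le_eq)
    then have ps: "p_star p = p" by (simp add: p_star_def)
    show ?thesis
      using riesz_bilinear_bound(1)[OF N _ True] True unfolding ps Lp_int_def lb lb2 q_def[symmetric]
      by (intro exI[of _ 2] exI[of _ "2 * (8 * p + 1)"]) auto
  next
    case False
    then have q2: "2 \<le> q" using p by (simp add: q_def le_divide_eq)
    have "p \<le> p / (p - 1)" using False p by (simp add: le_divide_eq)
    then have ps: "p_star p = q" by (simp add: p_star_def q_def)
    show ?thesis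
      using riesz_bilinear_bound(2)[OF N _ q2] q2 unfolding ps Lp_int_def lb lb2 qp
      by (intro exI[of _ "2 * (8 * q + 1)"] exI[of _ 2]) (auto simp: add.commute)
  qed
  then obtain \<alpha> \<beta> where \<beta>: "0 \<le> \<beta>" and sum: "\<alpha> + \<beta> \<le> 36 * (p_star p - 1)"
    and pair: "\<And>c N' g. finite N' \<Longrightarrow> (LINT x|lebesgue. riesz_hexp N c x \<bullet> hexp N' g x) \<le> \<alpha> * Lp_int p (hexp N c) + \<beta> * Lp_int q (hexp N' g)"
    by blast
  define R where "R = riesz_hexp N c"
  have RL: "R \<in> Lp_space p" unfolding R_def using N p by (intro riesz_hexp_Lp) auto
  note [measurable] = Lp_spaceD(1)[OF RL]
  \<comment> \<open>The extremal function of the duality: both \<open>norm (G x) powr q\<close> and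
    the pairing \<open>R x \<bullet> G x\<close> equal \<open>norm (R x) powr p\<close>.\<close>
  define G where "G x = norm (R x) powr (p - 2) *\<^sub>R R x" for x
  have G_norm: "norm (G x) powr q = norm (R x) powr p" for x
  proof (cases "R x = 0")
    case False
    then have "norm (G x) = norm (R x) powr (p - 2 + 1)" unfolding G_def powr_add by simp
    moreover have "(p - 2 + 1) * q = p" using p by (simp add: q_def field_simps)
    ultimately show ?thesis by (simp add: powr_powr)
  qed (simp add: G_def)
  have RG: "R x \<bullet> G x = norm (R x) powr p" for x
  proof (cases "R x = 0")
    case False
    have "R x \<bullet> G x = norm (R x) powr (p - 2) * (norm (R x))\<^sup>2"
      by (simp add: G_def power2_norm_eq_inner)
    also have "(norm (R x))\<^sup>2 = norm (R x) powr 2" using False by simp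
    also have "norm (R x) powr (p - 2) * norm (R x) powr 2 = norm (R x) powr (p - 2 + 2)" by (rule powr_add[symmetric])
    finally show ?thesis by simp
  qed simp
  have GL: "G \<in> Lp_space q"
    unfolding Lp_space_def G_norm mem_Collect_eq using Lp_spaceD(2)[OF RL]
    by (intro conjI) (auto simp: G_def[abs_def])
  have Gint: "Lp_int q G = Lp_int p R" by (simp add: Lp_int_def G_norm)
  have "Lp_int p R \<le> (36 * (p_star p - 1)) powr p * Lp_int p (hexp N c)"
  proof (rule homogeneous_bound[OF _ pq Lp_int_nonneg Lp_int_nonneg \<beta> sum])
    fix r s :: real assume r: "0 < r" and s: "0 < s"
    have sG: "(\<lambda>x. s *\<^sub>R G x) \<in> Lp_space q" "Lp_int q (\<lambda>x. s *\<^sub>R G x) = s powr q * Lp_int p R"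
      using Lp_space_scaleR[OF GL, of s] s Gint by auto
    have "r * s * Lp_int p R = (LINT x|lebesgue. riesz_hexp N (\<lambda>n. r * c n) x \<bullet> (s *\<^sub>R G x))"
      by (simp add: riesz_hexp_scale R_def[symmetric] RG Lp_int_def mult.assoc)
    also have "\<dots> \<le> \<alpha> * Lp_int p (hexp N (\<lambda>n. r * c n)) + \<beta> * Lp_int q (\<lambda>x. s *\<^sub>R G x)"
      by (rule riesz_pairing_Lp[OF N pq \<beta> pair sG(1)])
    also have "Lp_int p (hexp N (\<lambda>n. r * c n)) = r powr p * Lp_int p (hexp N c)"
      using r by (simp add: Lp_int_def hexp_scale abs_mult powr_mult)
    finally show "r * s * Lp_int p R \<le> \<alpha> * r powr p * Lp_int p (hexp N c) + \<beta> * s powr q * Lp_int p R"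
      by (simp add: sG(2) mult.assoc)
  qed
  then show ?thesis by (simp add: R_def)
qed

theorem theorem2:
  fixes p :: real
  assumes "1 < p"
  shows
    "(\<forall>f \<in> (hermite_span :: (real ^ 'd \<Rightarrow> real) set).
        riesz f \<in> Lp_space p \<and> Lp_norm p (riesz f) \<le> 36 * (p_star p - 1) * Lp_norm p f) \<and>
     (\<exists>T :: (real ^ 'd \<Rightarrow> real) \<Rightarrow> real ^ 'd \<Rightarrow> real ^ 'd.
        bounded_Lp_extension p hermite_span riesz T \<and>
        (\<forall>T'. bounded_Lp_extension p hermite_span riesz T' \<longrightarrow>
           (\<forall>f \<in> Lp_space p. AE x in lebesgue. T' f x = T f x)) \<and>
        (\<forall>f \<in> Lp_space p. Lp_norm p (T f) \<le> 36 * (p_star p - 1) * Lp_norm p f))"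
proof -
  have C: "0 \<le> 36 * (p_star p - 1)" using assms by (simp add: p_star_def)
  have R: "riesz f \<in> Lp_space p \<and> Lp_int p (riesz f) \<le> (36 * (p_star p - 1)) powr p * Lp_int p f"
    if "f \<in> hermite_span" for f :: "real ^ 'd \<Rightarrow> real"
  proof -
    from that obtain N c where "finite N" "f = hexp N c" by (auto simp: hermite_span_iff)
    then show ?thesis using riesz_hexp_Lp[of N p c] riesz_hexp_bound[of N p c] assms by (simp add: riesz_hexp_eq)
  qed
  interpret densely_defined_operator p "hermite_span :: (real ^ 'd \<Rightarrow> real) set" riesz "36 * (p_star p - 1)"
  proof
    show "\<exists>g\<in>hermite_span. Lp_int p (\<lambda>x. g x - f x) < \<epsilon>" if "f \<in> Lp_space p" "0 < \<epsilon>" for f :: "real ^ 'd \<Rightarrow> real" and \<epsilon>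
      using Lp_space_approximable[of p f] that assms unfolding approximable_def by auto
    show "(hermite_span :: (real ^ 'd \<Rightarrow> real) set) \<subseteq> Lp_space p" using hermite_span_Lp[of p] assms by auto
  qed (use assms C R hermite_span_add hermite_span_scale riesz_add riesz_scale in auto)
  have norm_iff: "Lp_norm p g \<le> 36 * (p_star p - 1) * Lp_norm p f \<longleftrightarrow> Lp_int p g \<le> (36 * (p_star p - 1)) powr p * Lp_int p f"
    for f :: "real ^ 'd \<Rightarrow> real" and g :: "real ^ 'd \<Rightarrow> real ^ 'd"
    using assms C by (intro Lp_norm_le_iff) auto
  show ?thesis
    unfolding norm_iff
    using R bounded_Lp_extension_ext bounded_Lp_extension_unique ext_Lp(2)
    by (intro conjI ballI exI[of _ ext] allI impI) blast+
qed

end
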